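(* Let $n\ge2$ and use the notation of the context. (a) The relations $e(a,b)$, over all incomparable pairs $\{a,b\}\subset\mathcal N$, form a minimal generating set of $I$. (b) For each incomparable pair $\{a,b\}$, one of the terms of $e(a,b)$ is $-X_{a\odot b}X_{a\vee b}$, i.e. one may index so that $g_0(a,b)=a\odot b$, $h_0(a,b)=a\vee b$, $c_0(a,b)=1$. (c) With this indexing, for $1\le i\le m(a,b)$ one has $g_i(a,b)\le a\wedge b$ and $h_i(a,b)>a\vee b$. In particular, $R/I$ is an algebra with straightening laws over $\mathcal N$ with respect to the injection $\varepsilon':\mathcal N\to R/I$ sending $b$ to the class of $X_b$.
   Context: $R$ is the polynomial ring over $\mathbb{C}$ in the Plücker variables $X_{i_1,\ldots,i_k}$, $1\le k\le n-1$, $1\le i_1<\dots<i_k\le n$, with $X_{i_{\sigma(1)},\ldots,i_{\sigma(k)}}=\mathrm{sgn}(\sigma)X_{i_1,\ldots,i_k}$; $I$ is the ideal of Plücker relations, the kernel of $X_{i_1,\ldots,i_k}\mapsto\det(z_{r,i_s})_{1\le r,s\le k}$. A one-column tableau $(\alpha_1,\ldots,\alpha_k)$ is PBW-semistandard if $\alpha_r\le k$ implies $\alpha_r=r$, and $r_1<r_2$, $\alpha_{r_1},\alpha_{r_2}>k$ imply $\alpha_{r_1}>\alpha_{r_2}$. Two columns $(\alpha_1..\alpha_k)$, $(\beta_1..\beta_l)$, $k\ge l$, form a PBW-semistandard tableau if each is PBW-semistandard and for each $r\le l$ there is $s\ge r$ with $\alpha_s\ge\beta_r$. $\mathcal N$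 is the set of $b_{\alpha_1,\ldots,\alpha_k}$, $1\le k\le n-1$, over one-column PBW-semistandard tableaux, ordered by $b_\beta\le b_\alpha$ iff columns $\alpha,\beta$ (in this order) form a PBW-semistandard tableau; it is a distributive lattice, and $X_{b_{\alpha_1,\ldots,\alpha_k}}:=X_{\alpha_1,\ldots,\alpha_k}$ (each Plücker variable corresponds up to sign to exactly one element). Let $P=\{(r,s):1\le r\le s\le n\}\setminus\{(1,1),(n,n)\}$, ordered componentwise; for an order ideal $J$ of $P$, $b(J)=b_{\alpha_1..\alpha_k}$ with $k$ the largest $l$ with $(l,l)\in J$ ($k=1$ if none), $\alpha_s=t$ for each maximal $(s,t)\in J$, $\alpha_r=r$ otherwise; $J\mapsto b(J)$ is a lattice isomorphism from order ideals of $P$ (union, intersection) onto $\mathcal N$, with inverse $\iota$. Let $V_o=\{(i,i):2\le i\le n-1\}$, $V_c=\{(r,s):r<s\}$, $K(J)=(J\cap V_o)\cup\{$maximal elements of $J$ in $V_c\}$. For $a,b\in\mathcal N$, $a\odot b=b(J')$ where $J'$ is the unique order ideal with $\mathbf 1_{K(\iota(a))}+\mathbf 1_{K(\iota(b))}=\mathbf 1_{K(\iota(a)\cup\iota(b))}+\mathbf 1_{K(J')}$. Monomials $X_{c_1}\cdots X_{c_m}$ with $c_1,\dots,c_m$ pairwise comparable in $\mathcal N$ project to a basis of $R/I$; hence for incomparable $a,b$ there is a unique element $e(a,b)=X_aX_b-\sum_{i=0}^{m(a,b)}c_i(a,b)X_{g_i(a,b)}X_{h_i(a,b)}\in I$ with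 pairwise distinct pairs, $g_i<h_i$ and $c_i\ne0$. A commutative algebra $\mathcal R$ with an injection $\varepsilon:\Omega\to\mathcal R$ from a finite poset is an algebra with straightening laws over $\Omega$ if the products $\varepsilon(\omega_1)\cdots\varepsilon(\omega_m)$ with $\omega_1\le\dots\le\omega_m$ form a basis of $\mathcal R$, and for incomparable $\chi_1,\chi_2$, every such product $\varepsilon(\omega_1)\cdots\varepsilon(\omega_m)$ ($\omega_1\le\dots\le\omega_m$) occurring in the expansion of $\varepsilon(\chi_1)\varepsilon(\chi_2)$ satisfies $\omega_1\le\chi_1$ and $\omega_1\le\chi_2$. *)

theory Defs
  imports
    "HOL-Library.Poly_Mapping"
    "HOL-Library.Indicator_Function"
    "HOL-Combinatorics.Permutations"
    "HOL-Algebra.Lattice"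
    "HOL-Algebra.Module"
    "HOL-Algebra.QuotRing"
    "HOL-Algebra.Algebraic_Closure_Type"
    "Jordan_Normal_Form.Determinant"
begin

section \<open>Polynomials with complex coefficients\<close>

text \<open>
  Exponent vectors are finitely supported maps from variables to \<^typ>\<open>nat\<close>, polynomials are
  finitely supported maps from exponent vectors to \<^typ>\<open>complex\<close>; multiplication on
  \<^type>\<open>poly_mapping\<close> is convolution.
\<close>

type_synonym 'v cpoly = "('v \<Rightarrow>\<^sub>0 nat) \<Rightarrow>\<^sub>0 complex"

definition pconst :: "complex \<Rightarrow> 'v cpoly" where
  "pconst c = Poly_Mapping.single 0 c"

definition pvar :: "'v \<Rightarrow> 'v cpoly" where
  "pvar v = Poly_Mapping.single (Poly_Mapping.single v 1) 1"

definition psubst :: "('v \<Rightarrow> 'w cpoly) \<Rightarrow> 'v cpoly \<Rightarrow> 'w cpoly" where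
  "psubst f p =
     (\<Sum>m\<in>Poly_Mapping.keys p.
        pconst (Poly_Mapping.lookup p m) *
        (\<Prod>v\<in>Poly_Mapping.keys m. f v ^ Poly_Mapping.lookup m v))"


section \<open>The Pluecker algebra\<close>

text \<open>The variable $X_{i_1,\ldots,i_k}$ with $i_1<\cdots<i_k$ is indexed by the list of the $i_s$.\<close>

definition plucker_indices :: "nat \<Rightarrow> nat list set" where
  "plucker_indices n =
     {is. sorted_wrt (<) is \<and> set is \<subseteq> {1..n} \<and> 1 \<le> length is \<and> length is \<le> n - 1}"

definition plucker_ring :: "nat \<Rightarrow> nat list cpoly ring" where
  "plucker_ring n =
     ring_of_type_algebra
       \<lparr>carrier := {p. \<forall>m\<in>Poly_Mapping.keys p. Poly_Mapping.keys m \<subseteq> plucker_indices n}\<rparr>"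

text \<open>
  $X_{\alpha_1,\ldots,\alpha_k}$ for a list of distinct, not necessarily increasing indices:
  if $\alpha_r = i_{\sigma(r)}$ with $i_1<\cdots<i_k$, this is
  $\mathrm{sgn}(\sigma) X_{i_1,\ldots,i_k}$.
\<close>

definition plucker_var :: "nat list \<Rightarrow> nat list cpoly" where
  "plucker_var \<alpha> =
     of_int (sign (THE \<sigma>. \<sigma> permutes {..<length \<alpha>} \<and> permute_list \<sigma> (sort \<alpha>) = \<alpha>)) *
     pvar (sort \<alpha>)"

text \<open>Matrix entries are indexed from 0 in the library, hence the shift of the row index.\<close>

definition minor :: "nat list \<Rightarrow> (nat \<times> nat) cpoly" where
  "minor is = det (mat (length is) (length is) (\<lambda>(r, s). pvar (r + 1, is ! s)))"

definition plucker_ideal :: "nat \<Rightarrow> nat list cpoly set" where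
  "plucker_ideal n = {p \<in> carrier (plucker_ring n). psubst minor p = 0}"

definition plucker_algebra :: "nat \<Rightarrow> (complex, nat list cpoly set) module" where
  "plucker_algebra n =
     (let Q = plucker_ring n Quot plucker_ideal n in
       \<lparr>carrier = carrier Q, monoid.mult = monoid.mult Q, monoid.one = monoid.one Q,
        ring.zero = ring.zero Q, ring.add = ring.add Q,
        module.smult = (\<lambda>c Y. (plucker_ideal n +>\<^bsub>plucker_ring n\<^esub> pconst c) \<otimes>\<^bsub>Q\<^esub> Y)\<rparr>)"


section \<open>PBW-semistandard tableaux\<close>

text \<open>
  A column $(\alpha_1,\ldots,\alpha_k)$ is the list \<open>\<alpha>\<close> with $\alpha_r$ = \<open>\<alpha> ! (r - 1)\<close>;
  in the next two definitions positions are counted from 0.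
\<close>

definition pbw_column :: "nat list \<Rightarrow> bool" where
  "pbw_column \<alpha> \<longleftrightarrow>
     (\<forall>r<length \<alpha>. \<alpha> ! r \<le> length \<alpha> \<longrightarrow> \<alpha> ! r = r + 1) \<and>
     (\<forall>r\<^sub>1 r\<^sub>2. r\<^sub>1 < r\<^sub>2 \<and> r\<^sub>2 < length \<alpha> \<and> length \<alpha> < \<alpha> ! r\<^sub>1 \<and> length \<alpha> < \<alpha> ! r\<^sub>2 \<longrightarrow>
        \<alpha> ! r\<^sub>2 < \<alpha> ! r\<^sub>1)"

definition pbw_pair :: "nat list \<Rightarrow> nat list \<Rightarrow> bool" where
  "pbw_pair \<alpha> \<beta> \<longleftrightarrow>
     length \<beta> \<le> length \<alpha> \<and> pbw_column \<alpha> \<and> pbw_column \<beta> \<and>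
     (\<forall>r<length \<beta>. \<exists>s. r \<le> s \<and> s < length \<alpha> \<and> \<beta> ! r \<le> \<alpha> ! s)"

text \<open>The element $b_\alpha$ is represented by the column $\alpha$ itself.\<close>

definition pbw_lattice :: "nat \<Rightarrow> nat list gorder" where
  "pbw_lattice n =
     \<lparr>carrier = {\<alpha>. pbw_column \<alpha> \<and> set \<alpha> \<subseteq> {1..n} \<and> 1 \<le> length \<alpha> \<and> length \<alpha> \<le> n - 1},
      eq = (=), le = (\<lambda>\<beta> \<alpha>. pbw_pair \<alpha> \<beta>)\<rparr>"

definition incomparable :: "('a, 'c) gorder_scheme \<Rightarrow> 'a \<Rightarrow> 'a \<Rightarrow> bool" where
  "incomparable L a b \<longleftrightarrow>
     a \<in> carrier L \<and> b \<in> carrier L \<and> \<not> a \<sqsubseteq>\<^bsub>L\<^esub> b \<and> \<not> b \<sqsubseteq>\<^bsub>L\<^esub> a"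


section \<open>Order ideals and the operation $\odot$\<close>

definition poset_P :: "nat \<Rightarrow> (nat \<times> nat) set" where
  "poset_P n = {(r, s). 1 \<le> r \<and> r \<le> s \<and> s \<le> n} - {(1, 1), (n, n)}"

definition P_le :: "nat \<times> nat \<Rightarrow> nat \<times> nat \<Rightarrow> bool" where
  "P_le x y \<longleftrightarrow> fst x \<le> fst y \<and> snd x \<le> snd y"

definition order_ideals :: "nat \<Rightarrow> (nat \<times> nat) set set" where
  "order_ideals n = {J. J \<subseteq> poset_P n \<and> (\<forall>x\<in>J. \<forall>y\<in>poset_P n. P_le y x \<longrightarrow> y \<in> J)}"

definition maximal_elements :: "(nat \<times> nat) set \<Rightarrow> (nat \<times> nat) set" where
  "maximal_elements J = {x \<in> J. \<forall>y\<in>J. P_le x y \<longrightarrow> y = x}"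

definition column_of_ideal :: "(nat \<times> nat) set \<Rightarrow> nat list" where
  "column_of_ideal J =
     (let k = (if \<exists>l. (l, l) \<in> J then Max {l. (l, l) \<in> J} else 1) in
        map (\<lambda>s. if \<exists>t. (s, t) \<in> maximal_elements J
                  then (THE t. (s, t) \<in> maximal_elements J) else s) [1..<k + 1])"

definition ideal_of_column :: "nat \<Rightarrow> nat list \<Rightarrow> (nat \<times> nat) set" where
  "ideal_of_column n = the_inv_into (order_ideals n) column_of_ideal"

definition V_o :: "nat \<Rightarrow> (nat \<times> nat) set" where
  "V_o n = {(i, i) | i. 2 \<le> i \<and> i \<le> n - 1}"

definition V_c :: "nat \<Rightarrow> (nat \<times> nat) set" where
  "V_c n = {(r, s) \<in> poset_P n. r < s}"

definition K :: "nat \<Rightarrow> (nat \<times> nat) set \<Rightarrow> (nat \<times> nat) set" where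
  "K n J = (J \<inter> V_o n) \<union> (maximal_elements J \<inter> V_c n)"

definition odot :: "nat \<Rightarrow> nat list \<Rightarrow> nat list \<Rightarrow> nat list" where
  "odot n a b = column_of_ideal (THE J'. J' \<in> order_ideals n \<and>
     (\<forall>p. (indicator (K n (ideal_of_column n a)) p :: nat) + indicator (K n (ideal_of_column n b)) p =
           indicator (K n (ideal_of_column n a \<union> ideal_of_column n b)) p + indicator (K n J') p))"


section \<open>Straightening relations\<close>

definition straightening_expansion ::
  "nat \<Rightarrow> nat list \<Rightarrow> nat list \<Rightarrow> nat list cpoly \<Rightarrow>
   nat \<Rightarrow> (nat \<Rightarrow> complex) \<Rightarrow> (nat \<Rightarrow> nat list) \<Rightarrow> (nat \<Rightarrow> nat list) \<Rightarrow> bool" where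
  "straightening_expansion n a b p m c g h \<longleftrightarrow>
     p = plucker_var a * plucker_var b -
         (\<Sum>i=0..m. pconst (c i) * plucker_var (g i) * plucker_var (h i)) \<and>
     inj_on (\<lambda>i. (g i, h i)) {0..m} \<and>
     (\<forall>i\<in>{0..m}. g i \<in> carrier (pbw_lattice n) \<and> h i \<in> carrier (pbw_lattice n) \<and>
        g i \<sqsubset>\<^bsub>pbw_lattice n\<^esub> h i \<and> c i \<noteq> 0)"

definition straightening_relation :: "nat \<Rightarrow> nat list \<Rightarrow> nat list \<Rightarrow> nat list cpoly" where
  "straightening_relation n a b =
     (THE p. p \<in> plucker_ideal n \<and> (\<exists>m c g h. straightening_expansion n a b p m c g h))"

definition minimal_generating_set :: "('a, 'c) ring_scheme \<Rightarrow> 'a set \<Rightarrow> 'a set \<Rightarrow> bool" where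
  "minimal_generating_set A \<I> E \<longleftrightarrow>
     E \<subseteq> carrier A \<and> Idl\<^bsub>A\<^esub> E = \<I> \<and> (\<forall>E'. E' \<subset> E \<longrightarrow> Idl\<^bsub>A\<^esub> E' \<noteq> \<I>)"


section \<open>Algebras with straightening laws\<close>

definition standard_words :: "('w, 'c) gorder_scheme \<Rightarrow> 'w list set" where
  "standard_words \<Omega> = {ws. set ws \<subseteq> carrier \<Omega> \<and> sorted_wrt (\<lambda>x y. x \<sqsubseteq>\<^bsub>\<Omega>\<^esub> y) ws}"

definition word_product :: "('b, 'c) ring_scheme \<Rightarrow> ('w \<Rightarrow> 'b) \<Rightarrow> 'w list \<Rightarrow> 'b" where
  "word_product A \<epsilon> ws = foldr (\<lambda>w x. \<epsilon> w \<otimes>\<^bsub>A\<^esub> x) ws \<one>\<^bsub>A\<^esub>"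

definition word_combination ::
  "(complex, 'b) module \<Rightarrow> ('w \<Rightarrow> 'b) \<Rightarrow> ('w list \<Rightarrow>\<^sub>0 complex) \<Rightarrow> 'b" where
  "word_combination A \<epsilon> c =
     (\<Oplus>\<^bsub>A\<^esub>ws\<in>Poly_Mapping.keys c. Poly_Mapping.lookup c ws \<odot>\<^bsub>A\<^esub> word_product A \<epsilon> ws)"

text \<open>
  That the standard products form a basis is expressed by bijectivity of the map sending a
  finitely supported coefficient function to the corresponding linear combination. The empty
  word, whose product is 1, is standard. It has no first letter, so it must not
  occur in the expansion of a product of two incomparable generators.
\<close>

definition algebra_with_straightening_laws ::
  "(complex, 'b) module \<Rightarrow> 'w gorder \<Rightarrow> ('w \<Rightarrow> 'b) \<Rightarrow> bool" where
  "algebra_with_straightening_laws A \<Omega> \<epsilon> \<longleftrightarrow>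
     algebra ring_of_type_algebra A \<and>
     partial_order \<Omega> \<and> finite (carrier \<Omega>) \<and>
     \<epsilon> \<in> carrier \<Omega> \<rightarrow> carrier A \<and> inj_on \<epsilon> (carrier \<Omega>) \<and>
     bij_betw (word_combination A \<epsilon>)
       {c. Poly_Mapping.keys c \<subseteq> standard_words \<Omega>} (carrier A) \<and>
     (\<forall>\<chi>\<^sub>1 \<chi>\<^sub>2 c.
        incomparable \<Omega> \<chi>\<^sub>1 \<chi>\<^sub>2 \<and> Poly_Mapping.keys c \<subseteq> standard_words \<Omega> \<and>
        word_combination A \<epsilon> c = \<epsilon> \<chi>\<^sub>1 \<otimes>\<^bsub>A\<^esub> \<epsilon> \<chi>\<^sub>2 \<longrightarrow>
        (\<forall>ws\<in>Poly_Mapping.keys c.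
           ws \<noteq> [] \<and> hd ws \<sqsubseteq>\<^bsub>\<Omega>\<^esub> \<chi>\<^sub>1 \<and> hd ws \<sqsubseteq>\<^bsub>\<Omega>\<^esub> \<chi>\<^sub>2))"

end

theory Submission
  imports Defs "HOL-Library.Product_Lexorder"
begin

text \<open>
  Columns correspond to order ideals, and comparison of columns is inclusion of ideals. Weight the
  entry $z_{r,j}$ of an upper triangular matrix by $rj$. The cheapest term of the minor of a PBW
  column $\alpha$ is $\prod_r z_{r,\alpha_r}$, and the products of these monomials along chains are
  pairwise distinct, so the standard monomials are independent. If $b \not\le a$, Pluecker's relation at
  a violated row expresses $X_a X_b$ by products in which the longer column is larger, read from the
  bottom row; so the standard pairs span in degree two.

  A minor restricted to the matrices supported on the ideal of $h$ vanishes unless its column is at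
  most $h$. Restricting an expansion of $X_a X_b$ in this way shows that every term has
  $h \ge a \vee b$. Passing to complementary minors is an antiautomorphism of the lattice and
  gives $g \le a \wedge b$. The leading monomials identify the term
  $X_{a \odot b} X_{a \vee b}$ and its coefficient. All terms have the same content, so no other
  one has $h = a \vee b$.
\<close>

section \<open>Substitution into polynomials\<close>

text \<open>The weight \<open>r * j\<close> favours columns that decrease downwards (rearrangement
  inequality), while the triangular shape stops an entry \<open>j\<close> at row \<open>j\<close>;
  the cheapest arrangement under both constraints is the PBW one. Restricting the matrix costs
  nothing: a linear dependency among products of minors survives every substitution, so it may be
  refuted on triangular matrices or on a still smaller support. The obstacle is the bound on
  \<open>g\<close>. Restriction to an ideal sees only the larger factor of a standard pair, hence
  bounds \<open>h\<close> and says nothing about \<open>g\<close>. For this reason the expansion is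
  kept as an identity for the generic matrix. It can then also be evaluated at a matrix of
  cofactors, whose minors are complementary minors up to signs and powers of the determinant, and
  there \<open>g\<close> and \<open>h\<close> exchange their roles. Independence also carries the
  passage from degree two to the whole ideal: the quadratic relations reduce any polynomial to a
  combination of chains, and such a combination lies in \<open>I\<close> only if it is zero.\<close>

abbreviation pkeys where "pkeys \<equiv> Poly_Mapping.keys"
abbreviation plook where "plook \<equiv> Poly_Mapping.lookup"
abbreviation psingle where "psingle \<equiv> Poly_Mapping.single"

definition psubst_monom :: "('v \<Rightarrow> 'w cpoly) \<Rightarrow> ('v \<Rightarrow>\<^sub>0 nat) \<Rightarrow> 'w cpoly" where
  "psubst_monom f m = (\<Prod>v\<in>pkeys m. f v ^ plook m v)"

lemma psubst_monom_superset:
  assumes "finite A" "pkeys m \<subseteq> A"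
  shows "psubst_monom f m = (\<Prod>v\<in>A. f v ^ plook m v)"
  unfolding psubst_monom_def
  by (rule prod.mono_neutral_left) (use assms in \<open>auto simp: in_keys_iff\<close>)

lemma psubst_monom_add: "psubst_monom f (m + m') = psubst_monom f m * psubst_monom f m'"
proof -
  have "pkeys (m + m') \<subseteq> pkeys m \<union> pkeys m'" by (rule Poly_Mapping.keys_add)
  then show ?thesis
    by (simp add: psubst_monom_superset[of "pkeys m \<union> pkeys m'"] lookup_add power_add prod.distrib)
qed

lemma psubst_monom_zero [simp]: "psubst_monom f 0 = 1"
  by (simp add: psubst_monom_def)

lemma psubst_monom_single [simp]: "psubst_monom f (psingle v k) = f v ^ k"
  by (simp add: psubst_monom_def)

lemma pconst_0 [simp]: "pconst 0 = 0"
  and pconst_1 [simp]: "pconst 1 = 1"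
  and pconst_add: "pconst (c + d) = pconst c + pconst d"
  and pconst_diff: "pconst (c - d) = pconst c - pconst d"
  and pconst_mult: "pconst (c * d) = pconst c * pconst d"
  by (simp_all add: pconst_def single_add single_diff mult_single)

lemma pconst_sum: "pconst (sum f A) = (\<Sum>x\<in>A. pconst (f x))"
  by (induction A rule: infinite_finite_induct) (simp_all add: pconst_add)

lemma psingle_eq: "psingle m c = pconst c * psingle m 1"
  by (simp add: pconst_def mult_single)

lemma psubst_superset:
  assumes "finite A" "pkeys p \<subseteq> A"
  shows "psubst f p = (\<Sum>m\<in>A. pconst (plook p m) * psubst_monom f m)"
  unfolding psubst_def psubst_monom_def[symmetric]
  by (rule sum.mono_neutral_left) (use assms in \<open>auto simp: in_keys_iff\<close>)

lemma psubst_0 [simp]: "psubst f 0 = 0"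
  by (simp add: psubst_def)

lemma psubst_add: "psubst f (p + q) = psubst f p + psubst f q"
proof -
  have "pkeys (p + q) \<subseteq> pkeys p \<union> pkeys q" by (rule Poly_Mapping.keys_add)
  then show ?thesis
    by (simp add: psubst_superset[of "pkeys p \<union> pkeys q"] lookup_add pconst_add
        algebra_simps sum.distrib)
qed

lemma psubst_sum: "psubst f (sum g A) = (\<Sum>x\<in>A. psubst f (g x))"
  by (induction A rule: infinite_finite_induct) (simp_all add: psubst_add)

lemma psubst_single: "psubst f (psingle m c) = pconst c * psubst_monom f m"
  by (cases "c = 0") (simp_all add: psubst_def psubst_monom_def)

lemma sum_single_lookup: "(\<Sum>m\<in>pkeys p. psingle m (plook p m)) = p"
proof (rule poly_mapping_eqI)
  fix k
  have "plook (\<Sum>m\<in>pkeys p. psingle m (plook p m)) k = (\<Sum>m\<in>pkeys p. if m = k then plook p k else 0)"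
    unfolding lookup_sum by (rule sum.cong) (auto simp: lookup_single when_def)
  also have "\<dots> = plook p k" by (auto simp: in_keys_iff)
  finally show "plook (\<Sum>m\<in>pkeys p. psingle m (plook p m)) k = plook p k" .
qed

lemma psubst_single_mult: "psubst f (psingle m c * psingle m' c') = psubst f (psingle m c) * psubst f (psingle m' c')"
  by (simp add: mult_single psubst_single psubst_monom_add pconst_mult algebra_simps)

lemma psubst_mult: "psubst f (p * q) = psubst f p * psubst f q"
proof -
  let ?p = "\<lambda>m. psingle m (plook p m)" and ?q = "\<lambda>m. psingle m (plook q m)"
  have "psubst f (p * q) = psubst f ((\<Sum>m\<in>pkeys p. ?p m) * (\<Sum>m\<in>pkeys q. ?q m))"
    by (simp add: sum_single_lookup)
  also have "\<dots> = (\<Sum>m\<in>pkeys p. \<Sum>m'\<in>pkeys q. psubst f (?p m) * psubst f (?q m'))"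
    by (simp add: sum_product psubst_sum psubst_single_mult)
  also have "\<dots> = psubst f (\<Sum>m\<in>pkeys p. ?p m) * psubst f (\<Sum>m\<in>pkeys q. ?q m)"
    by (simp add: sum_product psubst_sum)
  finally show ?thesis by (simp add: sum_single_lookup)
qed

lemma psubst_pconst [simp]: "psubst f (pconst c) = pconst c"
  by (simp add: pconst_def psubst_single)

lemma psubst_1 [simp]: "psubst f 1 = 1"
  using psubst_pconst[of f 1] by simp

lemma psubst_pvar [simp]: "psubst f (pvar v) = f v"
  by (simp add: pvar_def psubst_single)

lemma psubst_uminus: "psubst f (- p) = - psubst f p"
proof -
  have "psubst f (- p) + psubst f p = 0"
    by (simp flip: psubst_add)
  then show ?thesis by (simp add: add_eq_0_iff2)
qed

lemma psubst_diff: "psubst f (p - q) = psubst f p - psubst f q"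
  using psubst_add[of f p "- q"] by (simp add: psubst_uminus)

lemma psubst_prod: "psubst f (prod g A) = (\<Prod>x\<in>A. psubst f (g x))"
  by (induction A rule: infinite_finite_induct) (simp_all add: psubst_mult)

lemma psubst_of_int [simp]: "psubst f (of_int k) = of_int k"
  by (metis pconst_def psubst_pconst single_of_int)

section \<open>PBW-semistandard columns\<close>

text \<open>
  The order ideal of a column together with the corner $(1,1)$, which the poset omits; as always,
  \<open>c ! s\<close> is the entry in row \<open>s + 1\<close>.
\<close>

definition dn :: "nat list \<Rightarrow> (nat \<times> nat) set" where
  "dn c = {(r, j). 1 \<le> r \<and> r \<le> j \<and> (\<exists>s<length c. r \<le> s + 1 \<and> j \<le> c ! s)}"

lemma pbw_nth_eq: "pbw_column c \<Longrightarrow> s < length c \<Longrightarrow> c ! s \<le> length c \<Longrightarrow> c ! s = s + 1"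
  unfolding pbw_column_def by metis

lemma pbw_nth_ge: "pbw_column c \<Longrightarrow> s < length c \<Longrightarrow> s + 1 \<le> c ! s"
  using pbw_nth_eq[of c s] by linarith

lemma pbw_nth_less:
  "pbw_column c \<Longrightarrow> r < s \<Longrightarrow> s < length c \<Longrightarrow> length c < c ! r \<Longrightarrow> length c < c ! s \<Longrightarrow> c ! s < c ! r"
  unfolding pbw_column_def by metis

lemma pbw_distinct:
  assumes "pbw_column c" shows "distinct c"
proof -
  have False if "r < s" "s < length c" "c ! r = c ! s" for r s
  proof (cases "c ! r \<le> length c")
    case True
    then have "c ! r = r + 1" "c ! s = s + 1" using pbw_nth_eq[OF assms] that by auto
    then show False using that by simp
  next
    case False
    then have "c ! s < c ! r" using pbw_nth_less[OF assms that(1,2)] that(3) by simp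
    then show False using that by simp
  qed
  then show ?thesis unfolding distinct_conv_nth using nat_neq_iff by metis
qed

text \<open>At the topmost row where the columns differ, the larger entry exceeds the length and
  must occur in the other column further down. The smaller entry at that row is either fixed, which
  forces the same place in both columns, or exceeds the length too, which contradicts the decreasing
  order of such entries.\<close>

lemma pbw_unique:
  assumes a: "pbw_column a" and b: "pbw_column b" and eq: "set a = set b"
  shows "a = b"
proof -
  have len: "length a = length b"
    using eq a b by (metis distinct_card pbw_distinct)
  have main: "a' ! r < b' ! r \<Longrightarrow> False"
    if ab: "pbw_column a'" "pbw_column b'" "set a' = set b'" "length a' = length b'" and r: "r < length a'"
      and below: "\<And>s. s < r \<Longrightarrow> a' ! s = b' ! s" for a' b' r
  proof -
    assume less: "a' ! r < b' ! r"
    have db: "distinct b'" using ab pbw_distinct by auto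
    have big: "length b' < b' ! r"
      using pbw_nth_eq[OF ab(2), of r] pbw_nth_ge[OF ab(1), of r] ab(4) r less by (metis leI not_le)
    obtain q where q: "q < length a'" "a' ! q = b' ! r"
      using r ab by (metis in_set_conv_nth)
    have "q \<noteq> r" using q less by auto
    moreover have "\<not> q < r"
      using below[of q] q r db ab(4) by (metis nat_neq_iff nth_eq_iff_index_eq)
    ultimately have qr: "r < q" by simp
    have bigq: "length a' < a' ! q" using q big ab by simp
    show False
    proof (cases "a' ! r \<le> length a'")
      case True
      then have ar: "a' ! r = r + 1" using pbw_nth_eq[OF ab(1) r] by simp
      then have "r + 1 \<in> set b'" using ab(3) r by (metis nth_mem)
      then obtain t where t: "t < length b'" "b' ! t = r + 1" by (metis in_set_conv_nth)
      then have "t = r" using pbw_nth_eq[OF ab(2), of t] True ar ab(4) by auto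
      then show False using t big True ar ab(4) by simp
    next
      case False
      then show False using pbw_nth_less[OF ab(1) qr q(1)] bigq q less by simp
    qed
  qed
  show ?thesis
  proof (rule nth_equalityI[OF len])
    fix i assume "i < length a"
    then show "a ! i = b ! i"
    proof (induction i rule: less_induct)
      case (less i)
      have "a ! s = b ! s" if "s < i" for s using less that by simp
      then have "\<not> a ! i < b ! i" "\<not> b ! i < a ! i"
        using main[OF a b eq len, of i] main[OF b a eq[symmetric] len[symmetric], of i] less.prems len by auto
      then show ?case by simp
    qed
  qed
qed

text \<open>The corner \<open>(r + 1, \<beta> ! r)\<close> lies in \<open>dn \<beta>\<close>, and
  its membership in \<open>dn \<alpha>\<close> is the condition of \<open>pbw_pair\<close> at row
  \<open>r\<close>. The last row of \<open>\<beta>\<close> gives the inequality of lengths.\<close>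

lemma pbw_pair_iff_dn:
  assumes "pbw_column \<alpha>" "pbw_column \<beta>"
  shows "pbw_pair \<alpha> \<beta> \<longleftrightarrow> dn \<beta> \<subseteq> dn \<alpha>"
proof
  assume p: "pbw_pair \<alpha> \<beta>"
  show "dn \<beta> \<subseteq> dn \<alpha>"
  proof
    fix x assume "x \<in> dn \<beta>"
    then obtain r j s where x: "x = (r, j)" "1 \<le> r" "r \<le> j" "s < length \<beta>" "r \<le> s + 1" "j \<le> \<beta> ! s"
      unfolding dn_def by blast
    then obtain t where "s \<le> t" "t < length \<alpha>" "\<beta> ! s \<le> \<alpha> ! t"
      using p unfolding pbw_pair_def by blast
    then show "x \<in> dn \<alpha>" unfolding dn_def using x by (auto intro!: exI[of _ t])
  qed
next
  assume sub: "dn \<beta> \<subseteq> dn \<alpha>"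
  have ex: "\<exists>s. r \<le> s \<and> s < length \<alpha> \<and> \<beta> ! r \<le> \<alpha> ! s" if r: "r < length \<beta>" for r
  proof -
    have "(r + 1, \<beta> ! r) \<in> dn \<beta>" unfolding dn_def using pbw_nth_ge[OF assms(2) r] r by auto
    then have "(r + 1, \<beta> ! r) \<in> dn \<alpha>" using sub by blast
    then show ?thesis unfolding dn_def by auto
  qed
  have "length \<beta> \<le> length \<alpha>"
  proof (cases "length \<beta>")
    case (Suc l)
    then show ?thesis using ex[of l] by auto
  qed simp
  then show "pbw_pair \<alpha> \<beta>" unfolding pbw_pair_def using assms ex by blast
qed

lemma dn_diag: "pbw_column c \<Longrightarrow> (l, l) \<in> dn c \<longleftrightarrow> 1 \<le> l \<and> l \<le> length c"
proof -
  assume c: "pbw_column c"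
  have "\<exists>s<length c. l \<le> s + 1 \<and> l \<le> c ! s" if "1 \<le> l" "l \<le> length c"
    using that pbw_nth_ge[OF c, of "l - 1"] by (intro exI[of _ "l - 1"]) auto
  then show ?thesis unfolding dn_def by auto
qed

text \<open>Entries exceeding the length decrease strictly down the column, so no lower row reaches
  as far right as such a corner.\<close>

lemma supp_maximal:
  assumes c: "pbw_column c" and s: "s < length c" "length c < c ! s"
    and rj: "(r, j) \<in> dn c" "s + 1 \<le> r" "c ! s \<le> j"
  shows "r = s + 1 \<and> j = c ! s"
proof -
  obtain t where t: "t < length c" "r \<le> t + 1" "j \<le> c ! t" using rj(1) unfolding dn_def by auto
  then have "\<not> s < t" using pbw_nth_less[OF c, of s t] rj s by auto
  then have "t = s" using t rj(2) by auto
  then show ?thesis using t rj by auto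
qed

text \<open>The diagonal of \<open>dn\<close> reveals the length. The entries exceeding it are
  maximal points by \<open>supp_maximal\<close>, and all other entries are fixed by the
  length.\<close>

lemma dn_inj:
  assumes a: "pbw_column a" and b: "pbw_column b" and eq: "dn a = dn b"
  shows "a = b"
proof -
  have "1 \<le> l \<and> l \<le> length a \<longleftrightarrow> 1 \<le> l \<and> l \<le> length b" for l
    using dn_diag[OF a, of l] dn_diag[OF b, of l] eq by simp
  from this[of "length a"] this[of "length b"] have "length a \<le> length b" "length b \<le> length a"
    by linarith+
  then have len: "length a = length b" by simp
  have key: "b' ! s = a' ! s"
    if ab: "pbw_column a'" "pbw_column b'" "dn a' = dn b'" "length a' = length b'" "s < length a'" "length a' < a' ! s" for a' b' s
  proof -
    have "(s + 1, a' ! s) \<in> dn b'"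
      unfolding that(3)[symmetric] unfolding dn_def using pbw_nth_ge[OF that(1,5)] that(5) by auto
    then obtain t where t: "t < length b'" "s + 1 \<le> t + 1" "a' ! s \<le> b' ! t" unfolding dn_def by auto
    have "(t + 1, b' ! t) \<in> dn a'"
      unfolding that(3) unfolding dn_def using pbw_nth_ge[OF that(2) t(1)] t(1) by auto
    then have "t + 1 = s + 1 \<and> b' ! t = a' ! s" using supp_maximal[OF that(1,5,6)] t by auto
    then show ?thesis by auto
  qed
  show ?thesis
  proof (rule nth_equalityI[OF len])
    fix i assume i: "i < length a"
    show "a ! i = b ! i"
    proof (cases "length a < a ! i \<or> length b < b ! i")
      case True then show ?thesis using key[OF a b eq len i] key[OF b a eq[symmetric] len[symmetric], of i] i len by auto
    next
      case False then show ?thesis using pbw_nth_eq[OF a i] pbw_nth_eq[OF b, of i] i len by auto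
    qed
  qed
qed

section \<open>Arrangements of a column inside a triangular region\<close>

definition staircase_down :: "(nat \<times> nat) set \<Rightarrow> bool" where
  "staircase_down D \<longleftrightarrow> D \<subseteq> {(r, j). 1 \<le> r \<and> r \<le> j} \<and>
     (\<forall>r j r' j'. (r, j) \<in> D \<and> 1 \<le> r' \<and> r' \<le> r \<and> r' \<le> j' \<and> j' \<le> j \<longrightarrow> (r', j') \<in> D)"

lemma staircase_down_dn: "staircase_down (dn c)"
  unfolding staircase_down_def dn_def by (auto intro: order_trans)

lemma staircase_down_full: "staircase_down {(r, j). 1 \<le> r \<and> r \<le> j}"
  unfolding staircase_down_def by auto

definition column_support :: "nat list \<Rightarrow> (nat \<times> nat) set" where
  "column_support c = {(s + 1, c ! s) | s. s < length c}"

lemma column_support_subset_dn: "pbw_column c \<Longrightarrow> column_support c \<subseteq> dn c"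
  unfolding column_support_def dn_def by (auto dest: pbw_nth_ge)

lemma dn_subset_iff:
  assumes "pbw_column c" "staircase_down D"
  shows "dn c \<subseteq> D \<longleftrightarrow> column_support c \<subseteq> D"
proof
  assume sub: "column_support c \<subseteq> D"
  show "dn c \<subseteq> D"
  proof
    fix x assume "x \<in> dn c"
    then obtain r j s where x: "x = (r, j)" "1 \<le> r" "r \<le> j" "s < length c" "r \<le> s + 1" "j \<le> c ! s"
      unfolding dn_def by blast
    have "(s + 1, c ! s) \<in> D" using sub x unfolding column_support_def by auto
    then show "x \<in> D" using assms(2) x unfolding staircase_down_def by blast
  qed
qed (use column_support_subset_dn[OF assms(1)] in blast)

definition column_cost :: "nat list \<Rightarrow> nat" where
  "column_cost c = (\<Sum>s<length c. (s + 1) * c ! s)"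

text \<open>The cost drops by \<open>(j - i) * (c ! j - c ! i)\<close>: the rearrangement inequality
  for a single transposition.\<close>

lemma swap_cost:
  assumes ij: "i < j" "j < length c" and less: "c ! i < c ! j"
  shows "column_cost (c[j := c ! i, i := c ! j]) < column_cost c"
proof -
  let ?c = "c[j := c ! i, i := c ! j]" and ?R = "{..<length c} - {i, j}"
  have split: "(\<Sum>s<length c. f s) = f i + f j + sum f ?R" for f :: "nat \<Rightarrow> nat"
  proof -
    have "{..<length c} = insert i (insert j ?R)" using ij by auto
    then have "sum f {..<length c} = sum f (insert i (insert j ?R))" by simp
    also have "\<dots> = f i + f j + sum f ?R" using ij by (subst sum.insert; simp)+
    finally show ?thesis .
  qed
  have "column_cost ?c = (i + 1) * c ! j + (j + 1) * c ! i + (\<Sum>s\<in>?R. (s + 1) * ?c ! s)"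
    unfolding column_cost_def length_list_update split using ij by simp
  also have "(\<Sum>s\<in>?R. (s + 1) * ?c ! s) = (\<Sum>s\<in>?R. (s + 1) * c ! s)"
    by (rule sum.cong) auto
  finally have 1: "column_cost ?c = (i + 1) * c ! j + (j + 1) * c ! i + (\<Sum>s\<in>?R. (s + 1) * c ! s)" .
  have 2: "column_cost c = (i + 1) * c ! i + (j + 1) * c ! j + (\<Sum>s\<in>?R. (s + 1) * c ! s)"
    unfolding column_cost_def split by simp
  \<comment> \<open>Writing both gaps as successors reduces the claim to an inequality without
    subtraction.\<close>
  obtain d e where "c ! j = c ! i + Suc d" "j = i + Suc e"
    using less_imp_Suc_add[OF less] less_imp_Suc_add[OF ij(1)] by auto
  then have "(i + 1) * c ! j + (j + 1) * c ! i < (i + 1) * c ! i + (j + 1) * c ! j"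
    by (simp add: algebra_simps)
  then show ?thesis using 1 2 by simp
qed

text \<open>
  Exchanging two entries that stand in increasing order lowers the cost, and it keeps every entry
  weakly above its row as long as the smaller entry is not below the larger row. So a PBW column
  is the arrangement of least cost among those with entries weakly above their rows.
\<close>

lemma not_pbw_swap:
  assumes dist: "distinct c" and ge: "\<And>s. s < length c \<Longrightarrow> s + 1 \<le> c ! s" and np: "\<not> pbw_column c"
  shows "\<exists>i j. i < j \<and> j < length c \<and> c ! i < c ! j \<and> j + 1 \<le> c ! i"
proof (rule ccontr)
  assume no: "\<not> ?thesis"
  have "c ! r = r + 1" if r: "r < length c" "c ! r \<le> length c" for r
  proof (rule ccontr)
    assume ne: "c ! r \<noteq> r + 1"
    \<comment> \<open>\<open>s\<close> is the row that the small entry \<open>c ! r\<close> ought to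
      occupy. It lies below \<open>r\<close>, and its own entry is at least
      \<open>s + 1 = c ! r\<close>, hence strictly larger because the entries are distinct: these
      two rows can be swapped.\<close>
    define s where "s = c ! r - 1"
    have s: "r < s" "s < length c" "s + 1 = c ! r" using ne r ge[OF r(1)] unfolding s_def by auto
    have "c ! r < c ! s" using ge[OF s(2)] s r dist
      by (metis le_neq_implies_less nat_neq_iff nth_eq_iff_index_eq)
    then show False using no s(1,2) by (metis s(3) le_refl)
  qed
  moreover have "c ! r2 < c ! r1"
    if "r1 < r2" "r2 < length c" "length c < c ! r1" "length c < c ! r2" for r1 r2
  proof -
    have "r2 + 1 \<le> c ! r1" using that by simp
    then have "\<not> c ! r1 < c ! r2" using no that by blast
    moreover have "c ! r1 \<noteq> c ! r2" using dist that by (simp add: nth_eq_iff_index_eq)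
    ultimately show ?thesis by simp
  qed
  ultimately have "pbw_column c" unfolding pbw_column_def by auto
  with np show False ..
qed

lemma pbw_arrangement:
  assumes D: "staircase_down D" and "distinct c" "column_support c \<subseteq> D"
  shows "\<exists>c'. pbw_column c' \<and> mset c' = mset c \<and> column_support c' \<subseteq> D \<and> (c' = c \<or> column_cost c' < column_cost c)"
  using assms(2,3)
proof (induction c rule: measure_induct_rule[of column_cost])
  case (less c)
  show ?case
  proof (cases "pbw_column c")
    case True then show ?thesis using less by blast
  next
    case False
    have inD: "(s + 1, c ! s) \<in> D" if "s < length c" for s using less.prems(2) that unfolding column_support_def by auto
    have ge: "s + 1 \<le> c ! s" if "s < length c" for s using inD[OF that] D unfolding staircase_down_def by auto
    obtain i j where ij: "i < j" "j < length c" "c ! i < c ! j" "j + 1 \<le> c ! i"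
      using not_pbw_swap[OF less.prems(1) ge False] by blast
    let ?c = "c[j := c ! i, i := c ! j]"
    have m: "mset ?c = mset c" using ij by (simp add: mset_swap)
    have d: "distinct ?c" using less.prems(1) ij by (simp add: distinct_swap)
    have closed: "(r', j') \<in> D" if "(r, j) \<in> D" "1 \<le> r'" "r' \<le> r" "r' \<le> j'" "j' \<le> j" for r j r' j'
      using D that unfolding staircase_down_def by blast
    \<comment> \<open>Both new positions are dominated by the old position
      \<open>(j + 1, c ! j)\<close>, so the region is not left. That the second one stays in the
      triangle is the condition \<open>j + 1 \<le> c ! i\<close>.\<close>
    have "(i + 1, c ! j) \<in> D" using closed[OF inD[OF ij(2)], of "i + 1" "c ! j"] ij ge[OF ij(2)] by simp
    moreover have "(j + 1, c ! i) \<in> D" using closed[OF inD[OF ij(2)], of "j + 1" "c ! i"] ij by simp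
    ultimately have "(s + 1, ?c ! s) \<in> D" if "s < length c" for s
      using inD[OF that] ij that by (cases "s = i"; cases "s = j") auto
    then have sub: "column_support ?c \<subseteq> D" unfolding column_support_def by auto
    have cost: "column_cost ?c < column_cost c" by (rule swap_cost[OF ij(1-3)])
    obtain c' where "pbw_column c'" "mset c' = mset ?c" "column_support c' \<subseteq> D"
      "c' = ?c \<or> column_cost c' < column_cost ?c"
      using less.IH[OF cost d sub] by blast
    then show ?thesis using m cost by (intro exI[of _ c']) auto
  qed
qed

text \<open>The descent started at \<open>t\<close> can only end at \<open>c\<close>, as
  \<open>pbw_unique\<close> leaves no other PBW arrangement. The first conclusion makes restricted
  minors vanish, the second singles out their leading term.\<close>

lemma pbw_column_minimal:
  assumes D: "staircase_down D" and c: "pbw_column c" and t: "mset t = mset c" "column_support t \<subseteq> D"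
  shows "column_support c \<subseteq> D" "t = c \<or> column_cost c < column_cost t"
proof -
  have "distinct t" using c t by (metis mset_eq_imp_distinct_iff pbw_distinct)
  then obtain c' where c': "pbw_column c'" "mset c' = mset t" "column_support c' \<subseteq> D" "c' = t \<or> column_cost c' < column_cost t"
    using pbw_arrangement[OF D _ t(2)] by blast
  then have "c' = c" using pbw_unique[OF c'(1) c] t by (metis mset_eq_setD)
  then show "column_support c \<subseteq> D" "t = c \<or> column_cost c < column_cost t" using c' by auto
qed

text \<open>The increasing arrangement of a set of positive numbers has all entries weakly above
  their rows, so the descent can start from it.\<close>

lemma ex_pbw_column:
  assumes "finite A" "0 \<notin> A"
  shows "\<exists>c. pbw_column c \<and> set c = A"
proof -
  define xs where "xs = sorted_list_of_set A"
  have xs: "set xs = A" "distinct xs" "sorted_wrt (<) xs" using assms unfolding xs_def by auto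
  have ge: "s + 1 \<le> xs ! s" if "s < length xs" for s
    using that
  proof (induction s)
    case 0 then show ?case using xs assms by (metis One_nat_def Suc_leI add_0 gr0I nth_mem)
  next
    case (Suc s)
    then have "xs ! s < xs ! Suc s" using xs(3) by (simp add: sorted_wrt_nth_less)
    then show ?case using Suc by simp
  qed
  have "column_support xs \<subseteq> {(r, j). 1 \<le> r \<and> r \<le> j}" unfolding column_support_def using ge by auto
  then obtain c where "pbw_column c" "mset c = mset xs"
    using pbw_arrangement[OF staircase_down_full xs(2)] by blast
  then show ?thesis using xs by (metis mset_eq_setD)
qed

text \<open>A rank criterion in terms of the set of entries alone, which makes ideals accessible for
  complements and for exchanges of entries. An entry smaller than \<open>r\<close> can only stand
  above row \<open>r\<close>; so unless some row from \<open>r\<close> on reaches \<open>j\<close>,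
  at most \<open>r - 1\<close> entries are counted.\<close>

lemma dn_iff_card:
  assumes c: "pbw_column c" and rj: "1 \<le> r" "r \<le> j"
  shows "(r, j) \<in> dn c \<longleftrightarrow> r \<le> card {x \<in> set c. x < r \<or> j \<le> x}"
proof
  assume "(r, j) \<in> dn c"
  then obtain s0 where s0: "s0 < length c" "r \<le> s0 + 1" "j \<le> c ! s0" unfolding dn_def by auto
  \<comment> \<open>The rows above row \<open>r\<close> together with the witness row,
    \<open>r\<close> rows in all. An entry above row \<open>r\<close> is either fixed, hence smaller
    than \<open>r\<close>, or exceeds the length and then is at least the entry of the witness
    row.\<close>
  define Q where "Q = insert s0 {..<r - 1}"
  have Q: "Q \<subseteq> {..<length c}" "card Q = r" unfolding Q_def using s0 rj by auto
  have "(!) c ` Q \<subseteq> {x \<in> set c. x < r \<or> j \<le> x}"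
  proof
    fix x assume "x \<in> (!) c ` Q"
    then obtain s where s: "s \<in> Q" "x = c ! s" by auto
    have "c ! s < r \<or> j \<le> c ! s"
    proof (cases "s = s0")
      case False
      then have sr: "s < r - 1" "s < s0" "s < length c" using s s0 Q unfolding Q_def by auto
      show ?thesis
      proof (cases "c ! s \<le> length c")
        case True then show ?thesis using pbw_nth_eq[OF c sr(3) True] sr(1) by linarith
      next
        case False
        then show ?thesis using pbw_nth_less[OF c sr(2) s0(1)] s0 by linarith
      qed
    qed (use s0 in simp)
    then show "x \<in> {x \<in> set c. x < r \<or> j \<le> x}" using s Q by auto
  qed
  moreover have "card ((!) c ` Q) = r"
    using Q pbw_distinct[OF c] by (subst card_image) (auto intro: inj_on_nth)
  moreover have "finite {x \<in> set c. x < r \<or> j \<le> x}" by simp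
  ultimately show "r \<le> card {x \<in> set c. x < r \<or> j \<le> x}"
    by (metis card_mono)
next
  assume card: "r \<le> card {x \<in> set c. x < r \<or> j \<le> x}"
  show "(r, j) \<in> dn c"
  proof (rule ccontr)
    assume no: "(r, j) \<notin> dn c"
    have "{x \<in> set c. x < r \<or> j \<le> x} \<subseteq> (!) c ` {..<r - 1}"
    proof
      fix x assume x: "x \<in> {x \<in> set c. x < r \<or> j \<le> x}"
      then obtain s where s: "s < length c" "x = c ! s" by (auto simp: in_set_conv_nth)
      have "s < r - 1"
      proof (rule ccontr)
        assume "\<not> s < r - 1"
        then have "r \<le> s + 1" by simp
        then have "j \<le> c ! s" using x s pbw_nth_ge[OF c s(1)] by auto
        then show False using no s \<open>r \<le> s + 1\<close> rj unfolding dn_def by auto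
      qed
      then show "x \<in> (!) c ` {..<r - 1}" using s by auto
    qed
    then have "card {x \<in> set c. x < r \<or> j \<le> x} \<le> card ((!) c ` {..<r - 1})" by (intro card_mono) auto
    also have "\<dots> \<le> r - 1" using card_image_le[of "{..<r - 1}" "(!) c"] by simp
    finally show False using card rj by simp
  qed
qed

section \<open>The lattice of PBW columns\<close>

definition pbw_columns :: "nat \<Rightarrow> nat list set" where
  "pbw_columns n = {c. pbw_column c \<and> set c \<subseteq> {1..n} \<and> 1 \<le> length c \<and> length c \<le> n - 1}"

lemma pbw_columnsD:
  assumes "c \<in> pbw_columns n"
  shows "pbw_column c" "set c \<subseteq> {1..n}" "1 \<le> length c" "length c \<le> n - 1" "distinct c"
  using assms pbw_distinct unfolding pbw_columns_def by auto

lemma dn_bound: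
  assumes c: "c \<in> pbw_columns n" and rj: "(r, j) \<in> dn c"
  shows "1 \<le> r \<and> r \<le> j \<and> j \<le> n"
proof -
  obtain s where s: "s < length c" "j \<le> c ! s" "1 \<le> r" "r \<le> j" using rj unfolding dn_def by auto
  have "c ! s \<le> n" using pbw_columnsD(2)[OF c] nth_mem[OF s(1)] by auto
  then show ?thesis using s by simp
qed

lemma finite_pbw_columns: "finite (pbw_columns n)"
  by (rule finite_subset[OF _ finite_lists_length_le[of "{1..n}" "n - 1"]])
    (auto simp: pbw_columns_def)

lemma carrier_pbw_lattice: "carrier (pbw_lattice n) = pbw_columns n"
  by (simp add: pbw_lattice_def pbw_columns_def)

lemma eq_pbw_lattice: "x .=\<^bsub>pbw_lattice n\<^esub> y \<longleftrightarrow> x = y"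
  by (simp add: pbw_lattice_def)

lemma le_pbw_lattice:
  "a \<in> pbw_columns n \<Longrightarrow> b \<in> pbw_columns n \<Longrightarrow> a \<sqsubseteq>\<^bsub>pbw_lattice n\<^esub> b \<longleftrightarrow> dn a \<subseteq> dn b"
  using pbw_pair_iff_dn[of b a] by (simp add: pbw_lattice_def pbw_columnsD)

lemma lless_pbw_lattice:
  "a \<in> pbw_columns n \<Longrightarrow> b \<in> pbw_columns n \<Longrightarrow> a \<sqsubset>\<^bsub>pbw_lattice n\<^esub> b \<longleftrightarrow> dn a \<subset> dn b"
  using le_pbw_lattice[of a n b] dn_inj[of a b] by (auto simp: lless_def eq_pbw_lattice pbw_columnsD)

lemma partial_order_pbw_lattice: "partial_order (pbw_lattice n)"
proof -
  have eq: "(.=\<^bsub>pbw_lattice n\<^esub>) = (=)" by (simp add: pbw_lattice_def)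
  have antisym: "x = y" if "x \<in> pbw_columns n" "y \<in> pbw_columns n" "dn x \<subseteq> dn y" "dn y \<subseteq> dn x" for x y
    using dn_inj[of x y] that pbw_columnsD(1) by (metis subset_antisym)
  show ?thesis
    by (unfold_locales; simp add: carrier_pbw_lattice le_pbw_lattice eq antisym subset_trans)
qed

lemma incomparable_pbw_lattice:
  "incomparable (pbw_lattice n) a b \<longleftrightarrow>
     a \<in> pbw_columns n \<and> b \<in> pbw_columns n \<and> \<not> dn a \<subseteq> dn b \<and> \<not> dn b \<subseteq> dn a"
  unfolding incomparable_def carrier_pbw_lattice using le_pbw_lattice by metis

text \<open>The column realising the union is a hypothesis: for incomparable columns it will be
  supplied by the straightening expansion itself, whereas the intersection needed for the meet comes
  from \<open>ex_meet\<close>.\<close>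

lemma join_pbw_lattice:
  assumes ab: "a \<in> pbw_columns n" "b \<in> pbw_columns n" and c: "c \<in> pbw_columns n" "dn c = dn a \<union> dn b"
  shows "a \<squnion>\<^bsub>pbw_lattice n\<^esub> b = c"
proof -
  interpret partial_order "pbw_lattice n" by (rule partial_order_pbw_lattice)
  have upper: "Upper (pbw_lattice n) {a, b} = {u \<in> pbw_columns n. dn a \<subseteq> dn u \<and> dn b \<subseteq> dn u}"
    unfolding Upper_def carrier_pbw_lattice using ab le_pbw_lattice by blast
  have l: "least (pbw_lattice n) c (Upper (pbw_lattice n) {a, b})"
    unfolding least_def upper carrier_pbw_lattice using c by (simp add: le_pbw_lattice)
  then show ?thesis unfolding join_def sup_def
    by (rule some_equality) (use least_unique[OF _ l] eq_pbw_lattice in metis)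
qed

lemma meet_pbw_lattice:
  assumes ab: "a \<in> pbw_columns n" "b \<in> pbw_columns n" and c: "c \<in> pbw_columns n" "dn c = dn a \<inter> dn b"
  shows "a \<sqinter>\<^bsub>pbw_lattice n\<^esub> b = c"
proof -
  interpret partial_order "pbw_lattice n" by (rule partial_order_pbw_lattice)
  have lower: "Lower (pbw_lattice n) {a, b} = {u \<in> pbw_columns n. dn u \<subseteq> dn a \<and> dn u \<subseteq> dn b}"
    unfolding Lower_def carrier_pbw_lattice using ab le_pbw_lattice by blast
  have l: "greatest (pbw_lattice n) c (Lower (pbw_lattice n) {a, b})"
    unfolding greatest_def lower carrier_pbw_lattice using c by (simp add: le_pbw_lattice)
  then show ?thesis unfolding meet_def inf_def
    by (rule some_equality) (use greatest_unique[OF _ l] eq_pbw_lattice in metis)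
qed

text \<open>Negation modulo \<open>n\<close> on the representatives \<open>1, ..., n\<close>. The
  sets \<open>{i. i < r \<or> j \<le> i}\<close> of the rank criterion are cyclic intervals, and
  negation carries such a set to the one belonging to \<open>(n + 1 - j, n + 1 - r)\<close>.\<close>

definition flip_index :: "nat \<Rightarrow> nat \<Rightarrow> nat" where
  "flip_index n i = (if i = n then n else n - i)"

lemma flip_index_flip_index [simp]: "1 \<le> i \<Longrightarrow> i \<le> n \<Longrightarrow> flip_index n (flip_index n i) = i"
  unfolding flip_index_def by auto

lemma flip_index_range [simp]: "1 \<le> i \<Longrightarrow> i \<le> n \<Longrightarrow> 1 \<le> flip_index n i \<and> flip_index n i \<le> n"
  unfolding flip_index_def by auto

lemma inj_on_flip_index: "inj_on (flip_index n) {1..n}"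
  by (rule inj_on_inverseI[of _ "flip_index n"]) auto

text \<open>
  Complementing a column and flipping the indices reverses the order of the lattice: it sends the
  ideal of a column to the complement of its image under $(r,s) \mapsto (n+1-s,n+1-r)$.
\<close>

definition dual_column :: "nat \<Rightarrow> nat list \<Rightarrow> nat list" where
  "dual_column n c = (SOME d. pbw_column d \<and> set d = flip_index n ` ({1..n} - set c))"

lemma
  assumes c: "c \<in> pbw_columns n"
  shows set_dual_column: "set (dual_column n c) = flip_index n ` ({1..n} - set c)"
    and dual_column_in: "dual_column n c \<in> pbw_columns n"
    and length_dual_column: "length (dual_column n c) = n - length c"
proof -
  let ?d = "dual_column n c" and ?A = "flip_index n ` ({1..n} - set c)"
  have A: "?A \<subseteq> {1..n}" "finite ?A" using flip_index_range[of _ n] by fastforce+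
  then have "\<exists>d. pbw_column d \<and> set d = ?A" by (intro ex_pbw_column) auto
  then have d: "pbw_column ?d \<and> set ?d = ?A" unfolding dual_column_def by (rule someI_ex)
  then show "set ?d = ?A" by simp
  have "card ?A = card ({1..n} - set c)"
    by (rule card_image) (rule inj_on_subset[OF inj_on_flip_index], auto)
  also have "\<dots> = n - length c"
    using pbw_columnsD[OF c] by (subst card_Diff_subset) (auto simp: distinct_card)
  finally show l: "length ?d = n - length c" using d pbw_distinct by (metis distinct_card)
  show "?d \<in> pbw_columns n" using d A l pbw_columnsD[OF c] unfolding pbw_columns_def by auto
qed

text \<open>The cyclic interval of the rank criterion has \<open>n + r - j\<close> elements. Those
  missing from \<open>c\<close> become, after flipping, the ones counted for the dual column, so the
  two counts add up to \<open>n + r - j\<close>, and one criterion holds exactly when the other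
  fails.\<close>

lemma dn_dual_column:
  assumes c: "c \<in> pbw_columns n" and rj: "1 \<le> r" "r \<le> j" "j \<le> n"
  shows "(n + 1 - j, n + 1 - r) \<in> dn (dual_column n c) \<longleftrightarrow> (r, j) \<notin> dn c"
proof -
  let ?d = "dual_column n c"
  let ?C = "{i \<in> {1..n}. i < r \<or> j \<le> i}" and ?cC = "{x \<in> set c. x < r \<or> j \<le> x}"
  have iff: "flip_index n i < n + 1 - j \<or> n + 1 - r \<le> flip_index n i \<longleftrightarrow> i < r \<or> j \<le> i"
    if "1 \<le> i" "i \<le> n" for i using that rj unfolding flip_index_def by auto
  have sub: "?cC \<subseteq> ?C" using pbw_columnsD[OF c] by auto
  have "{x \<in> set ?d. x < n + 1 - j \<or> n + 1 - r \<le> x} = flip_index n ` (?C - ?cC)"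
  proof -
    have "{x \<in> set ?d. x < n + 1 - j \<or> n + 1 - r \<le> x}
        = flip_index n ` {i \<in> {1..n} - set c. flip_index n i < n + 1 - j \<or> n + 1 - r \<le> flip_index n i}"
      unfolding set_dual_column[OF c] by blast
    also have "{i \<in> {1..n} - set c. flip_index n i < n + 1 - j \<or> n + 1 - r \<le> flip_index n i} = ?C - ?cC"
      using iff by auto
    finally show ?thesis .
  qed
  then have "card {x \<in> set ?d. x < n + 1 - j \<or> n + 1 - r \<le> x} = card (?C - ?cC)"
    by (simp only:) (intro card_image inj_on_subset[OF inj_on_flip_index], auto)
  also have "\<dots> = card ?C - card ?cC" by (rule card_Diff_subset[OF _ sub]) simp
  also have "?C = {1..<r} \<union> {j..n}" using rj by auto
  also have "card ({1..<r} \<union> {j..n}) = n + r - j" using rj by (subst card_Un_disjoint) auto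
  finally have card: "card {x \<in> set ?d. x < n + 1 - j \<or> n + 1 - r \<le> x} = n + r - j - card ?cC" .
  have "card ?cC \<le> card ?C" by (rule card_mono[OF _ sub]) simp
  then have le: "card ?cC \<le> n + r - j" using \<open>?C = {1..<r} \<union> {j..n}\<close> \<open>card ({1..<r} \<union> {j..n}) = n + r - j\<close> by simp
  have "(n + 1 - j, n + 1 - r) \<in> dn ?d \<longleftrightarrow> n + 1 - j \<le> n + r - j - card ?cC"
    unfolding card[symmetric] by (rule dn_iff_card) (use rj pbw_columnsD[OF dual_column_in[OF c]] in auto)
  also have "\<dots> \<longleftrightarrow> \<not> r \<le> card ?cC" using rj le by linarith
  also have "\<dots> \<longleftrightarrow> (r, j) \<notin> dn c" using dn_iff_card[OF pbw_columnsD(1)[OF c] rj(1,2)] by simp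
  finally show ?thesis .
qed

lemma dn_dual_column_subset_iff:
  assumes c: "c \<in> pbw_columns n" and d: "d \<in> pbw_columns n"
  shows "dn (dual_column n d) \<subseteq> dn (dual_column n c) \<longleftrightarrow> dn c \<subseteq> dn d"
proof
  assume sub: "dn (dual_column n d) \<subseteq> dn (dual_column n c)"
  show "dn c \<subseteq> dn d"
  proof
    fix x assume x: "x \<in> dn c"
    obtain r j where rj: "x = (r, j)" "1 \<le> r" "r \<le> j" "j \<le> n" using dn_bound[OF c] x by (metis surj_pair)
    show "x \<in> dn d" using dn_dual_column[OF c rj(2-4)] dn_dual_column[OF d rj(2-4)] x rj(1) sub by blast
  qed
next
  assume sub: "dn c \<subseteq> dn d"
  show "dn (dual_column n d) \<subseteq> dn (dual_column n c)"
  proof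
    fix x assume x: "x \<in> dn (dual_column n d)"
    obtain r j where rj: "x = (r, j)" "1 \<le> r" "r \<le> j" "j \<le> n"
      using dn_bound[OF dual_column_in[OF d]] x by (metis surj_pair)
    define r' j' where "r' = n + 1 - j" and "j' = n + 1 - r"
    have rj': "1 \<le> r'" "r' \<le> j'" "j' \<le> n" "r = n + 1 - j'" "j = n + 1 - r'" using rj unfolding r'_def j'_def by auto
    show "x \<in> dn (dual_column n c)"
      using dn_dual_column[OF c rj'(1-3)] dn_dual_column[OF d rj'(1-3)] x rj(1) sub rj'(4,5) by blast
  qed
qed

section \<open>Order ideals\<close>

definition ideal_of :: "nat list \<Rightarrow> (nat \<times> nat) set" where
  "ideal_of c = dn c - {(1, 1)}"

lemma P_le_trans: "P_le x y \<Longrightarrow> P_le y z \<Longrightarrow> P_le x z"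
  unfolding P_le_def by auto

lemma finite_poset_P: "finite (poset_P n)"
  by (rule finite_subset[of _ "{1..n} \<times> {1..n}"]) (auto simp: poset_P_def)

lemma ex_maximal_above:
  assumes "finite J" "x \<in> J"
  shows "\<exists>y\<in>maximal_elements J. P_le x y"
proof -
  let ?A = "{y \<in> J. P_le x y}"
  have "finite ?A" "x \<in> ?A" using assms by (auto simp: P_le_def)
  \<comment> \<open>A point above \<open>x\<close> with the largest coordinate sum is maximal, since
    anything strictly above it would have a larger sum.\<close>
  define m where "m = Max ((\<lambda>y. fst y + snd y) ` ?A)"
  have "m \<in> (\<lambda>y. fst y + snd y) ` ?A"
    unfolding m_def using \<open>finite ?A\<close> \<open>x \<in> ?A\<close> by (intro Max_in finite_imageI) blast+
  then obtain y where y: "y \<in> ?A" "m = fst y + snd y" by blast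
  have "z = y" if z: "z \<in> J" "P_le y z" for z
  proof -
    have "z \<in> ?A" using z y(1) P_le_trans by blast
    then have "fst z + snd z \<le> fst y + snd y"
      unfolding y(2)[symmetric] m_def using \<open>finite ?A\<close> by (intro Max_ge) auto
    then show ?thesis using z(2) by (auto simp: P_le_def prod_eq_iff)
  qed
  then show ?thesis using y unfolding maximal_elements_def by blast
qed

lemma ideal_of_order_ideal:
  assumes c: "c \<in> pbw_columns n"
  shows "ideal_of c \<in> order_ideals n"
proof -
  have "(n, n) \<notin> dn c" using dn_diag[OF pbw_columnsD(1)[OF c], of n] pbw_columnsD(3,4)[OF c] by auto
  then have "ideal_of c \<subseteq> poset_P n"
    unfolding ideal_of_def poset_P_def using dn_bound[OF c] by auto
  moreover have "y \<in> ideal_of c" if "x \<in> ideal_of c" "y \<in> poset_P n" "P_le y x" for x y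
  proof -
    obtain r j r' j' where xy: "x = (r, j)" "y = (r', j')" by (meson surj_pair)
    have "(r', j') \<in> dn c"
      using staircase_down_dn[of c] that unfolding xy staircase_down_def ideal_of_def poset_P_def P_le_def
      by (metis (no_types, lifting) DiffD1 case_prodD fst_conv mem_Collect_eq snd_conv)
    then show ?thesis using that(2) unfolding xy ideal_of_def poset_P_def by simp
  qed
  ultimately show ?thesis unfolding order_ideals_def by blast
qed

text \<open>Each point of the ideal is dominated by the corner of its witness row, so a maximal
  point is such a corner.\<close>

lemma maximal_ideal_of:
  assumes c: "c \<in> pbw_columns n" and st: "(s, t) \<in> maximal_elements (ideal_of c)"
  shows "1 \<le> s" "s \<le> length c" "c ! (s - 1) = t"
proof -
  have P: "pbw_column c" by (rule pbw_columnsD(1)[OF c])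
  have mem: "(s, t) \<in> dn c" "(s, t) \<noteq> (1, 1)" using st unfolding maximal_elements_def ideal_of_def by auto
  then obtain q where q: "q < length c" "s \<le> q + 1" "t \<le> c ! q" "1 \<le> s" "s \<le> t" unfolding dn_def by auto
  have "(q + 1, c ! q) \<in> dn c" unfolding dn_def using q pbw_nth_ge[OF P q(1)] by auto
  moreover have "(q + 1, c ! q) \<noteq> (1, 1)" using mem(2) q by auto
  ultimately have "(q + 1, c ! q) \<in> ideal_of c" unfolding ideal_of_def by simp
  moreover have "P_le (s, t) (q + 1, c ! q)" using q by (simp add: P_le_def)
  ultimately have "(q + 1, c ! q) = (s, t)" using st unfolding maximal_elements_def by blast
  then show "1 \<le> s" "s \<le> length c" "c ! (s - 1) = t" using q by auto
qed

lemma maximal_ideal_of_big: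
  assumes c: "c \<in> pbw_columns n" and s: "s < length c" "s + 1 < c ! s"
  shows "(s + 1, c ! s) \<in> maximal_elements (ideal_of c)"
proof -
  have P: "pbw_column c" by (rule pbw_columnsD(1)[OF c])
  have big: "length c < c ! s" using pbw_nth_eq[OF P s(1)] s(2) by linarith
  have "(s + 1, c ! s) \<in> ideal_of c" unfolding ideal_of_def dn_def using s by auto
  moreover have "y = (s + 1, c ! s)" if "y \<in> ideal_of c" "P_le (s + 1, c ! s) y" for y
  proof -
    have "(fst y, snd y) \<in> dn c" "s + 1 \<le> fst y" "c ! s \<le> snd y"
      using that unfolding ideal_of_def P_le_def by simp_all
    from supp_maximal[OF P s(1) big this] show ?thesis by (simp add: prod_eq_iff)
  qed
  ultimately show ?thesis unfolding maximal_elements_def by blast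
qed

lemma column_of_ideal_of:
  assumes c: "c \<in> pbw_columns n"
  shows "column_of_ideal (ideal_of c) = c"
proof -
  let ?J = "ideal_of c" and ?M = "maximal_elements (ideal_of c)"
  have P: "pbw_column c" by (rule pbw_columnsD(1)[OF c])
  \<comment> \<open>The diagonal starts at 2 because \<open>(1, 1)\<close> is removed. A column of
    length one therefore has no diagonal point at all, which is the case covered by the default
    \<open>1\<close> in \<open>column_of_ideal\<close>.\<close>
  have diag: "{l. (l, l) \<in> ?J} = {2..length c}"
  proof (rule Set.set_eqI)
    fix l show "l \<in> {l. (l, l) \<in> ?J} \<longleftrightarrow> l \<in> {2..length c}"
      using dn_diag[OF P, of l] by (cases "l = 1") (auto simp: ideal_of_def)
  qed
  have k: "(if \<exists>l. (l, l) \<in> ?J then Max {l. (l, l) \<in> ?J} else 1) = length c"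
  proof (cases "length c \<ge> 2")
    case True
    then have "2 \<in> {l. (l, l) \<in> ?J}" unfolding diag by simp
    then have "\<exists>l. (l, l) \<in> ?J" by blast
    moreover have "Max {2..length c} = length c" using True by (intro Max_eqI) auto
    ultimately show ?thesis unfolding diag by simp
  next
    case False
    then have "{l. (l, l) \<in> ?J} = {}" unfolding diag by simp
    then have "\<not> (\<exists>l. (l, l) \<in> ?J)" by blast
    moreover have "length c = 1" using False pbw_columnsD(3)[OF c] by simp
    ultimately show ?thesis by (simp only: if_False)
  qed
  have "(if \<exists>t. (s, t) \<in> ?M then THE t. (s, t) \<in> ?M else s) = c ! (s - 1)" if s: "1 \<le> s" "s \<le> length c" for s
  proof (cases "\<exists>t. (s, t) \<in> ?M")
    case True
    then obtain t where t: "(s, t) \<in> ?M" by blast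
    then have "(s, c ! (s - 1)) \<in> ?M" using maximal_ideal_of(3)[OF c t] by simp
    then have "(THE t. (s, t) \<in> ?M) = c ! (s - 1)"
      by (rule the_equality) (rule maximal_ideal_of(3)[OF c, symmetric])
    then show ?thesis using True by simp
  next
    case False
    have s': "s - 1 < length c" "s - 1 + 1 = s" using s by linarith+
    have "\<not> s < c ! (s - 1)" using False maximal_ideal_of_big[OF c s'(1)] unfolding s'(2) by blast
    moreover have "s \<le> c ! (s - 1)" using pbw_nth_ge[OF P s'(1)] unfolding s'(2) .
    ultimately show ?thesis using False by simp
  qed
  note entry = this
  have "map (\<lambda>s. if \<exists>t. (s, t) \<in> ?M then THE t. (s, t) \<in> ?M else s) [1..<length c + 1] = c"
    (is "map ?f _ = _")
  proof (rule nth_equalityI)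
    fix i assume "i < length (map ?f [1..<length c + 1])"
    then have i: "i < length c" by (simp del: upt_Suc)
    have "map ?f [1..<length c + 1] ! i = ?f (i + 1)" using i by (simp del: upt_Suc)
    also have "\<dots> = c ! i" using entry[of "i + 1"] i by simp
    finally show "map ?f [1..<length c + 1] ! i = c ! i" .
  qed (simp del: upt_Suc)
  then show ?thesis unfolding column_of_ideal_def k Let_def .
qed

text \<open>With \<open>k\<close> the largest diagonal index, row \<open>s\<close> receives
  \<open>t\<close> if \<open>(s, t)\<close> is maximal with \<open>t > k\<close>, and is fixed
  otherwise. A maximal element with \<open>t \<le> k\<close> can only be \<open>(k, k)\<close>,
  which the fixed entry of row \<open>k\<close> reproduces.\<close>

lemma order_ideal_cases:
  assumes n: "n \<ge> 2" and J: "J \<in> order_ideals n"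
  obtains c where "c \<in> pbw_columns n" "ideal_of c = J"
proof -
  have sub: "J \<subseteq> poset_P n" and down: "\<And>x y. x \<in> J \<Longrightarrow> y \<in> poset_P n \<Longrightarrow> P_le y x \<Longrightarrow> y \<in> J"
    using J unfolding order_ideals_def by blast+
  have fin: "finite J" using finite_subset[OF sub finite_poset_P] .
  define M where "M = maximal_elements J"
  have MJ: "M \<subseteq> J" unfolding M_def maximal_elements_def by auto
  have above: "\<exists>y\<in>M. P_le x y" if "x \<in> J" for x using ex_maximal_above[OF fin that] unfolding M_def .
  have Meq: "x = y" if "x \<in> M" "y \<in> J" "P_le x y" for x y using that unfolding M_def maximal_elements_def by blast
  have inP: "1 \<le> s \<and> s \<le> t \<and> t \<le> n \<and> (s, t) \<noteq> (1, 1) \<and> (s, t) \<noteq> (n, n)" if "(s, t) \<in> J" for s t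
    using sub that unfolding poset_P_def by auto
  \<comment> \<open>The inserted \<open>1\<close> is the length to be used when \<open>J\<close>
    contains no diagonal point.\<close>
  let ?D = "insert 1 {l. (l, l) \<in> J}"
  have finD: "finite ?D" by (rule finite_subset[of _ "{1..n}"]) (use inP n in auto)
  define k where "k = Max ?D"
  have kmem: "k = 1 \<or> (k, k) \<in> J" using Max_in[OF finD] unfolding k_def by auto
  have kmax: "l \<le> k" if "(l, l) \<in> J" for l using Max_ge[OF finD, of l] that unfolding k_def by auto
  have k1: "1 \<le> k" using Max_ge[OF finD, of 1] unfolding k_def by auto
  have kn: "k \<le> n - 1" using kmem inP[of k k] n by auto
  have row: "s \<le> k" if "(s, t) \<in> J" for s t
  proof (cases "s = 1")
    case False
    have "(s, s) \<in> poset_P n" using inP[OF that] False unfolding poset_P_def by auto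
    then have "(s, s) \<in> J" using down[OF that] inP[OF that] by (auto simp: P_le_def)
    then show ?thesis by (rule kmax)
  qed (use k1 in simp)
  have small: "s = k \<and> t = k \<and> k \<ge> 2" if "(s, t) \<in> M" "t \<le> k" for s t
  proof -
    have st: "(s, t) \<in> J" using that MJ by auto
    have "k \<ge> 2" using inP[OF st] that by auto
    then have "(k, k) \<in> J" using kmem by auto
    then have "(s, t) = (k, k)" using Meq[OF that(1)] row[OF st] that(2) by (auto simp: P_le_def)
    then show ?thesis using \<open>k \<ge> 2\<close> by simp
  qed
  \<comment> \<open>The choice is harmless: two maximal elements in the same row are comparable,
    hence equal, as \<open>fM\<close> records.\<close>
  define f where "f s = (if \<exists>t>k. (s, t) \<in> M then SOME t. k < t \<and> (s, t) \<in> M else s)" for s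
  have f: "k < f s \<and> (s, f s) \<in> M \<or> f s = s" for s
  proof (cases "\<exists>t>k. (s, t) \<in> M")
    case True
    then show ?thesis using someI_ex[OF True] unfolding f_def by simp
  qed (auto simp: f_def)
  have fM: "f s = t" if "(s, t) \<in> M" "k < t" for s t
  proof -
    have ex: "\<exists>t>k. (s, t) \<in> M" using that by blast
    have "k < f s \<and> (s, f s) \<in> M" using someI_ex[OF ex] ex unfolding f_def by simp
    then have "(s, f s) \<in> M" "(s, f s) \<in> J" "(s, t) \<in> J" using MJ that by auto
    then show ?thesis using Meq[of "(s, f s)" "(s, t)"] Meq[of "(s, t)" "(s, f s)"] that
      by (cases "f s \<le> t") (auto simp: P_le_def)
  qed
  define c where "c = map f [1..<k + 1]"
  have len: "length c = k" unfolding c_def by simp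
  have nth: "c ! r = f (r + 1)" if "r < k" for r using that unfolding c_def by (simp del: upt_Suc)
  have P: "pbw_column c"
    unfolding pbw_column_def len
  proof (intro conjI allI impI)
    fix r assume "r < k" "c ! r \<le> k"
    then show "c ! r = r + 1" using nth[of r] f[of "r + 1"] by auto
  next
    fix r1 r2 assume r: "r1 < r2 \<and> r2 < k \<and> k < c ! r1 \<and> k < c ! r2"
    then have m: "(r1 + 1, c ! r1) \<in> M" "(r2 + 1, c ! r2) \<in> M"
      using nth[of r1] nth[of r2] f[of "r1 + 1"] f[of "r2 + 1"] by auto
    show "c ! r2 < c ! r1"
    proof (rule ccontr)
      assume "\<not> c ! r2 < c ! r1"
      then have "P_le (r1 + 1, c ! r1) (r2 + 1, c ! r2)" using r by (auto simp: P_le_def)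
      then show False using Meq[OF m(1)] m(2) MJ r by auto
    qed
  qed
  have frange: "1 \<le> f s \<and> f s \<le> n" if "1 \<le> s" "s \<le> k" for s
  proof (cases "f s = s")
    case False
    then have "(s, f s) \<in> J" using f[of s] MJ by blast
    from inP[OF this] show ?thesis using that by linarith
  qed (use that kn in linarith)
  have "set c \<subseteq> {1..n}"
  proof
    fix x assume "x \<in> set c"
    then obtain r where "r < k" "x = f (r + 1)" using nth len by (metis in_set_conv_nth)
    then show "x \<in> {1..n}" using frange[of "r + 1"] by simp
  qed
  then have c: "c \<in> pbw_columns n" unfolding pbw_columns_def using P len k1 kn by auto
  have "ideal_of c = J"
  proof
    show "ideal_of c \<subseteq> J"
    proof
      fix x assume x: "x \<in> ideal_of c"
      then have "x \<in> dn c" unfolding ideal_of_def by simp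
      then obtain r j s where rj': "x = (r, j)" "1 \<le> r" "r \<le> j" "s < length c" "r \<le> s + 1" "j \<le> c ! s"
        unfolding dn_def by blast
      then have rj: "x = (r, j)" "1 \<le> r" "r \<le> j" "s < k" "r \<le> s + 1" "j \<le> f (s + 1)"
        using nth[of s] unfolding len by simp_all
      have xP: "x \<in> poset_P n" using x ideal_of_order_ideal[OF c] unfolding order_ideals_def by blast
      show "x \<in> J"
      proof (cases "f (s + 1) = s + 1")
        case False
        then have "(s + 1, f (s + 1)) \<in> J" using f[of "s + 1"] MJ by auto
        then show ?thesis using down[OF _ xP] rj by (auto simp: P_le_def)
      next
        case True
        \<comment> \<open>For \<open>k = 1\<close> a fixed row dominates only \<open>(1, 1)\<close>,
          which is not in the ideal.\<close>
        have "k \<noteq> 1"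
        proof
          assume "k = 1"
          then have "x = (1, 1)" using rj True by auto
          then show False using x unfolding ideal_of_def by auto
        qed
        then have "(k, k) \<in> J" using kmem by auto
        then show ?thesis using down[OF _ xP] rj True by (auto simp: P_le_def)
      qed
    qed
    show "J \<subseteq> ideal_of c"
    proof
      fix x assume x: "x \<in> J"
      obtain s t where st: "(s, t) \<in> M" "P_le x (s, t)" using above[OF x] by auto
      obtain r j where rj: "x = (r, j)" by (cases x)
      have s: "1 \<le> s" "s \<le> k" using row[of s t] inP[of s t] st(1) MJ by auto
      have "t \<le> c ! (s - 1)"
      proof (cases "t \<le> k")
        case True
        then have "s = k" "t = k" using small[OF st(1)] by auto
        then show ?thesis using pbw_nth_ge[OF P, of "k - 1"] len k1 by auto
      next
        case False
        then show ?thesis using fM[OF st(1)] nth[of "s - 1"] s by auto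
      qed
      then have "x \<in> dn c" unfolding dn_def rj using st(2) s inP[of r j] x rj len
        by (auto simp: P_le_def intro!: exI[of _ "s - 1"])
      then show "x \<in> ideal_of c" unfolding ideal_of_def using inP[of r j] x rj by auto
    qed
  qed
  then show thesis using c that by blast
qed

text \<open>\<open>column_of_ideal\<close> is injective on order ideals because each of them is
  \<open>ideal_of c\<close> for some \<open>c\<close>, and \<open>c\<close> is recovered from it.
  From here on the inverse isomorphism is explicit.\<close>

lemma ideal_of_column_eq:
  assumes n: "n \<ge> 2" and c: "c \<in> pbw_columns n"
  shows "ideal_of_column n c = ideal_of c"
  unfolding ideal_of_column_def
proof (rule the_inv_into_f_eq)
  show "inj_on column_of_ideal (order_ideals n)"
  proof (rule inj_onI)
    fix J J' assume J: "J \<in> order_ideals n" "J' \<in> order_ideals n" "column_of_ideal J = column_of_ideal J'"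
    obtain c where "c \<in> pbw_columns n" "ideal_of c = J" using order_ideal_cases[OF n J(1)] .
    moreover obtain c' where "c' \<in> pbw_columns n" "ideal_of c' = J'" using order_ideal_cases[OF n J(2)] .
    ultimately show "J = J'" using J(3) column_of_ideal_of by metis
  qed
qed (use column_of_ideal_of[OF c] ideal_of_order_ideal[OF c] in auto)

lemma dn_ideal_of: "c \<in> pbw_columns n \<Longrightarrow> dn c = insert (1, 1) (ideal_of c)"
  using dn_diag[of c 1] pbw_columnsD(1,3)[of c n] unfolding ideal_of_def by auto

lemma ex_meet:
  assumes n: "n \<ge> 2" and ab: "a \<in> pbw_columns n" "b \<in> pbw_columns n"
  obtains c where "c \<in> pbw_columns n" "dn c = dn a \<inter> dn b"
proof -
  have "ideal_of a \<inter> ideal_of b \<in> order_ideals n"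
    using ideal_of_order_ideal[OF ab(1)] ideal_of_order_ideal[OF ab(2)] unfolding order_ideals_def by blast
  then obtain c where c: "c \<in> pbw_columns n" "ideal_of c = ideal_of a \<inter> ideal_of b"
    using order_ideal_cases[OF n] by blast
  then have "dn c = dn a \<inter> dn b" using dn_ideal_of ab by auto
  then show thesis using c that by blast
qed

section \<open>Leading monomials of minors\<close>

text \<open>The matrix is a parameter because the same expansion is evaluated at the generic matrix,
  at triangular and restricted ones, and at a matrix of cofactors. The column list may be unsorted
  or contain repetitions, as exchanges produce such lists.\<close>

definition cdet :: "(nat \<times> nat \<Rightarrow> 'a :: comm_ring_1) \<Rightarrow> nat list \<Rightarrow> 'a" where
  "cdet z c = det (mat (length c) (length c) (\<lambda>(r, s). z (r + 1, c ! s)))"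

lemma cdet_expand:
  "cdet z c = (\<Sum>p | p permutes {..<length c}. of_int (sign p) * (\<Prod>i<length c. z (i + 1, c ! p i)))"
proof -
  have "cdet z c = (\<Sum>p | p permutes {0..<length c}. of_int (sign p) *
      (\<Prod>i = 0..<length c. mat (length c) (length c) (\<lambda>(r, s). z (r + 1, c ! s)) $$ (i, p i)))"
    unfolding cdet_def by (rule det_def') simp
  also have "\<dots> = (\<Sum>p | p permutes {0..<length c}. of_int (sign p) * (\<Prod>i = 0..<length c. z (i + 1, c ! p i)))"
  proof (intro sum.cong refl arg_cong2[of _ _ _ _ "(*)"] prod.cong)
    fix p i assume "p \<in> {p. p permutes {0..<length c}}" "i \<in> {0..<length c}"
    moreover from this have "p i < length c" using permutes_in_image[of p "{0..<length c}" i] by simp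
    ultimately show "mat (length c) (length c) (\<lambda>(r, s). z (r + 1, c ! s)) $$ (i, p i) = z (i + 1, c ! p i)" by simp
  qed
  finally show ?thesis by (simp only: atLeast0LessThan)
qed

lemma cdet_permute_list:
  assumes p: "p permutes {..<length c}"
  shows "cdet z (permute_list p c) = of_int (sign p) * cdet z c"
proof -
  let ?k = "length c"
  let ?A = "mat ?k ?k (\<lambda>(r, s). z (r + 1, c ! s))"
  let ?B = "mat ?k ?k (\<lambda>(r, s). z (r + 1, permute_list p c ! s))"
  have p': "p permutes {0..<?k}" using p by (simp only: atLeast0LessThan)
  have "transpose_mat ?B = mat ?k ?k (\<lambda>(i, j). transpose_mat ?A $$ (p i, j))"
  proof (rule eq_matI)
    fix i j assume "i < dim_row (mat ?k ?k (\<lambda>(i, j). transpose_mat ?A $$ (p i, j)))"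
      "j < dim_col (mat ?k ?k (\<lambda>(i, j). transpose_mat ?A $$ (p i, j)))"
    then have ij: "i < ?k" "j < ?k" by simp_all
    moreover have "p i < ?k" using permutes_in_image[OF p, of i] ij by simp
    ultimately show "transpose_mat ?B $$ (i, j) = mat ?k ?k (\<lambda>(i, j). transpose_mat ?A $$ (p i, j)) $$ (i, j)"
      using permute_list_nth[OF p ij(1)] by simp
  qed simp_all
  then have "det (transpose_mat ?B) = of_int (sign p) * det (transpose_mat ?A)"
    using det_permute_rows[of "transpose_mat ?A" ?k p] p' by simp
  then show ?thesis
    unfolding cdet_def by (subst (asm) (1 2) det_transpose[where n = ?k]) simp_all
qed

lemma cdet_mset:
  assumes "mset c = mset d"
  obtains e :: int where "e \<in> {1, - 1}" "\<And>z. cdet z c = of_int e * cdet z d"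
proof -
  obtain p where p: "p permutes {..<length d}" "permute_list p d = c"
    using mset_eq_permutation[OF assms] by blast
  have "sign p \<in> {1, - 1}" by (simp add: sign_def)
  then show thesis using that[of "sign p"] cdet_permute_list[OF p(1)] p(2) by blast
qed

lemma cdet_not_distinct:
  assumes "\<not> distinct c" shows "cdet z c = 0"
proof -
  obtain i j where ij: "i < length c" "j < length c" "i \<noteq> j" "c ! i = c ! j"
    using assms unfolding distinct_conv_nth by blast
  show ?thesis unfolding cdet_def
    by (rule det_identical_columns[OF _ ij(3,1,2)]) (use ij in \<open>auto intro!: eq_vecI simp: col_def\<close>)
qed

lemma psubst_cdet: "psubst f (cdet z c) = cdet (\<lambda>x. psubst f (z x)) c"
  unfolding cdet_expand by (simp add: psubst_sum psubst_mult psubst_prod)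

lemma minor_eq_cdet: "minor is = cdet pvar is"
  unfolding minor_def cdet_def ..

text \<open>Distinct entries make the sorting permutation unique, so the definite description inside
  \<open>plucker_var\<close> denotes.\<close>

lemma plucker_var_sign:
  assumes "distinct \<alpha>"
  obtains \<sigma> where "\<sigma> permutes {..<length \<alpha>}" "permute_list \<sigma> (sort \<alpha>) = \<alpha>"
    "plucker_var \<alpha> = of_int (sign \<sigma>) * pvar (sort \<alpha>)"
proof -
  obtain \<sigma> where s: "\<sigma> permutes {..<length (sort \<alpha>)}" "permute_list \<sigma> (sort \<alpha>) = \<alpha>"
    using mset_eq_permutation[of \<alpha> "sort \<alpha>"] by auto
  have s1: "\<sigma> permutes {..<length \<alpha>}" using s(1) by simp
  have "(THE \<sigma>. \<sigma> permutes {..<length \<alpha>} \<and> permute_list \<sigma> (sort \<alpha>) = \<alpha>) = \<sigma>"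
  proof (rule the_equality)
    show "\<sigma> permutes {..<length \<alpha>} \<and> permute_list \<sigma> (sort \<alpha>) = \<alpha>" using s1 s(2) by simp
  next
    fix \<tau> assume t: "\<tau> permutes {..<length \<alpha>} \<and> permute_list \<tau> (sort \<alpha>) = \<alpha>"
    show "\<tau> = \<sigma>"
    proof
      fix i show "\<tau> i = \<sigma> i"
      proof (cases "i < length \<alpha>")
        case True
        have "sort \<alpha> ! \<tau> i = \<alpha> ! i" "sort \<alpha> ! \<sigma> i = \<alpha> ! i"
          using permute_list_nth[of \<tau> "sort \<alpha>" i] permute_list_nth[of \<sigma> "sort \<alpha>" i] t s s1 True by simp_all
        moreover have "\<tau> i < length \<alpha>" "\<sigma> i < length \<alpha>"
          using permutes_in_image[of \<tau> "{..<length \<alpha>}" i] permutes_in_image[OF s1, of i] t True by simp_all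
        ultimately show ?thesis using assms nth_eq_iff_index_eq[of "sort \<alpha>" "\<tau> i" "\<sigma> i"] by simp
      next
        case False
        then show ?thesis
          using permutes_not_in[of \<tau> "{..<length \<alpha>}" i] permutes_not_in[OF s1, of i] t by simp
      qed
    qed
  qed
  then show thesis using that[OF s1 s(2)] unfolding plucker_var_def by simp
qed

text \<open>The sign in \<open>plucker_var\<close> is the one that the minor picks up when its
  columns are sorted, so both signs disappear and PBW columns can be used in their own
  order.\<close>

lemma psubst_minor_plucker_var:
  assumes "distinct \<alpha>"
  shows "psubst minor (plucker_var \<alpha>) = cdet pvar \<alpha>"
proof -
  obtain \<sigma> where s: "\<sigma> permutes {..<length \<alpha>}" "permute_list \<sigma> (sort \<alpha>) = \<alpha>"
    "plucker_var \<alpha> = of_int (sign \<sigma>) * pvar (sort \<alpha>)" by (rule plucker_var_sign[OF assms])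
  have "psubst minor (plucker_var \<alpha>) = of_int (sign \<sigma>) * cdet pvar (sort \<alpha>)"
    unfolding s(3) by (simp add: psubst_mult minor_eq_cdet)
  also have "\<dots> = cdet pvar \<alpha>"
    using cdet_permute_list[of \<sigma> "sort \<alpha>" pvar] s(1) unfolding s(2) by simp
  finally show ?thesis .
qed

section \<open>Weights of monomials and leading terms\<close>

definition mcost :: "(nat \<times> nat \<Rightarrow>\<^sub>0 nat) \<Rightarrow> nat" where
  "mcost m = (\<Sum>x\<in>pkeys m. fst x * snd x * plook m x)"

lemma mcost_superset:
  assumes "finite A" "pkeys m \<subseteq> A" shows "mcost m = (\<Sum>x\<in>A. fst x * snd x * plook m x)"
  unfolding mcost_def by (rule sum.mono_neutral_left) (use assms in \<open>auto simp: in_keys_iff\<close>)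

lemma mcost_add: "mcost (m + m') = mcost m + mcost m'"
  using Poly_Mapping.keys_add[of m m']
  by (simp add: mcost_superset[of "pkeys m \<union> pkeys m'"] lookup_add algebra_simps sum.distrib)

lemma mcost_0 [simp]: "mcost 0 = 0"
  by (simp add: mcost_def)

lemma mcost_single [simp]: "mcost (psingle x k) = fst x * snd x * k"
  by (simp add: mcost_def)

lemma mcost_sum: "mcost (sum f A) = (\<Sum>x\<in>A. mcost (f x))"
  by (induction A rule: infinite_finite_induct) (simp_all add: mcost_add)

text \<open>No total monomial order is involved: the part of lowest weight is required to be a
  single monomial with coefficient 1. This form is stable under products and fixes the coefficient
  of the distinguished term later.\<close>

definition leads :: "(nat \<times> nat \<Rightarrow>\<^sub>0 nat) \<Rightarrow> (nat \<times> nat) cpoly \<Rightarrow> bool" where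
  "leads m p \<longleftrightarrow> (\<exists>q. p = psingle m 1 + q \<and> (\<forall>k\<in>pkeys q. mcost m < mcost k))"

lemma keys_multE:
  assumes "k \<in> pkeys (p * q)"
  obtains u v where "u \<in> pkeys p" "v \<in> pkeys q" "k = u + v"
  using assms keys_mult[of p q] by blast

lemma leads_1: "leads 0 1"
  unfolding leads_def by (intro exI[of _ 0]) simp

lemma leads_mult:
  assumes "leads m p" "leads m' p'"
  shows "leads (m + m') (p * p')"
proof -
  obtain q where q: "p = psingle m 1 + q" "\<And>k. k \<in> pkeys q \<Longrightarrow> mcost m < mcost k"
    using assms(1) unfolding leads_def by blast
  obtain q' where q': "p' = psingle m' 1 + q'" "\<And>k. k \<in> pkeys q' \<Longrightarrow> mcost m' < mcost k"
    using assms(2) unfolding leads_def by blast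
  define r where "r = psingle m 1 * q' + q * psingle m' 1 + q * q'"
  have "p * p' = psingle (m + m') 1 + r"
    unfolding q(1) q'(1) r_def by (simp add: algebra_simps mult_single)
  moreover have "mcost (m + m') < mcost k" if k: "k \<in> pkeys r" for k
  proof -
    have "k \<in> pkeys (psingle m 1 * q') \<union> pkeys (q * psingle m' 1) \<union> pkeys (q * q')"
      using k Poly_Mapping.keys_add[of "psingle m 1 * q' + q * psingle m' 1" "q * q'"]
        Poly_Mapping.keys_add[of "psingle m 1 * q'" "q * psingle m' 1"] unfolding r_def by blast
    then consider "k \<in> pkeys (psingle m 1 * q')" | "k \<in> pkeys (q * psingle m' 1)" | "k \<in> pkeys (q * q')"
      by blast
    then have "\<exists>u v. k = u + v \<and> (mcost m < mcost u \<and> mcost m' \<le> mcost v \<or> mcost m \<le> mcost u \<and> mcost m' < mcost v)"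
    proof cases
      case 1
      then obtain u v where "u \<in> pkeys (psingle m (1::complex))" "v \<in> pkeys q'" "k = u + v" by (rule keys_multE)
      then show ?thesis using q'(2)[of v] by (intro exI[of _ u] exI[of _ v]) simp
    next
      case 2
      then obtain u v where "u \<in> pkeys q" "v \<in> pkeys (psingle m' (1::complex))" "k = u + v" by (rule keys_multE)
      then show ?thesis using q(2)[of u] by (intro exI[of _ u] exI[of _ v]) simp
    next
      case 3
      then obtain u v where "u \<in> pkeys q" "v \<in> pkeys q'" "k = u + v" by (rule keys_multE)
      then show ?thesis using q(2)[of u] q'(2)[of v] by (intro exI[of _ u] exI[of _ v]) simp
    qed
    then obtain u v where uv: "k = u + v"
      "mcost m < mcost u \<and> mcost m' \<le> mcost v \<or> mcost m \<le> mcost u \<and> mcost m' < mcost v" by blast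
    then show ?thesis unfolding uv(1) mcost_add by linarith
  qed
  ultimately show ?thesis unfolding leads_def by blast
qed

lemma leads_lookup:
  assumes "leads m p"
  shows "plook p m = 1" "k \<in> pkeys p \<Longrightarrow> k = m \<or> mcost m < mcost k"
proof -
  obtain q where q: "p = psingle m 1 + q" "\<And>k. k \<in> pkeys q \<Longrightarrow> mcost m < mcost k"
    using assms unfolding leads_def by blast
  have "m \<notin> pkeys q" using q(2) by blast
  then show "plook p m = 1" unfolding q(1) by (simp add: lookup_add in_keys_iff)
  assume "k \<in> pkeys p"
  then have "k \<in> pkeys (psingle m (1::complex)) \<or> k \<in> pkeys q"
    unfolding q(1) using Poly_Mapping.keys_add[of "psingle m 1" q] by blast
  then show "k = m \<or> mcost m < mcost k" using q(2) by auto
qed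

lemma lookup_pconst_mult: "plook (pconst c * p) m = c * plook p m"
proof -
  have "pconst c * p = (\<Sum>k\<in>pkeys p. psingle k (c * plook p k))"
    by (subst sum_single_lookup[of p, symmetric])
      (simp add: sum_distrib_left pconst_def mult_single)
  then have "plook (pconst c * p) m = (\<Sum>k\<in>pkeys p. if k = m then c * plook p m else 0)"
    by (simp add: lookup_sum lookup_single when_def cong: if_cong sum.cong)
  also have "\<dots> = c * plook p m" by (auto simp: in_keys_iff)
  finally show ?thesis .
qed

text \<open>Among the indices with nonzero coefficient take one whose leading monomial is cheapest.
  In any other summand this monomial would have to be the leading one, against injectivity, or
  strictly costlier than the leading one, against the choice; so nothing cancels it.\<close>

lemma leads_independent:
  assumes fin: "finite S" and inj: "inj_on M S" and lead: "\<And>i. i \<in> S \<Longrightarrow> leads (M i) (P i)"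
    and sum0: "(\<Sum>i\<in>S. pconst (a i) * P i) = 0" and i: "i \<in> S"
  shows "a i = 0"
proof (rule ccontr)
  assume "a i \<noteq> 0"
  let ?A = "{i \<in> S. a i \<noteq> 0}"
  have "finite ?A" "?A \<noteq> {}" using fin i \<open>a i \<noteq> 0\<close> by auto
  then obtain j where j: "j \<in> ?A" "\<And>k. k \<in> ?A \<Longrightarrow> mcost (M j) \<le> mcost (M k)"
    using ex_has_least_nat[of "\<lambda>i. i \<in> ?A" i "\<lambda>i. mcost (M i)"] i \<open>a i \<noteq> 0\<close> by auto
  have "0 = plook (\<Sum>i\<in>S. pconst (a i) * P i) (M j)" using sum0 by simp
  also have "\<dots> = (\<Sum>i\<in>S. a i * plook (P i) (M j))" by (simp add: lookup_sum lookup_pconst_mult)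
  also have "\<dots> = (\<Sum>i\<in>S. if i = j then a j else 0)"
  proof (rule sum.cong[OF refl])
    fix k assume k: "k \<in> S"
    show "a k * plook (P k) (M j) = (if k = j then a j else 0)"
    proof (cases "k = j \<or> a k = 0")
      case True
      then show ?thesis using leads_lookup(1)[OF lead[OF k]] by auto
    next
      case False
      then have "M j \<noteq> M k" using inj j(1) k by (auto dest: inj_onD)
      moreover have "mcost (M j) \<le> mcost (M k)" using j(2)[of k] k False by simp
      ultimately have "M j \<notin> pkeys (P k)" using leads_lookup(2)[OF lead[OF k], of "M j"] by auto
      then show ?thesis using False by (simp add: in_keys_iff)
    qed
  qed
  also have "\<dots> = a j" using j(1) fin by simp
  finally show False using j(1) by simp
qed

section \<open>Diagonal monomials and minors of restricted generic matrices\<close>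

definition cmon :: "nat list \<Rightarrow> (nat \<times> nat \<Rightarrow>\<^sub>0 nat)" where
  "cmon c = (\<Sum>s<length c. psingle (s + 1, c ! s) 1)"

lemma mcost_cmon: "mcost (cmon c) = column_cost c"
  by (simp add: cmon_def mcost_sum column_cost_def)

lemma lookup_cmon: "plook (cmon c) (r, j) = (if 1 \<le> r \<and> r \<le> length c \<and> c ! (r - 1) = j then 1 else 0)"
proof -
  have *: "plook (psingle (s + 1, c ! s) (1::nat)) (r, j) =
      (if s = r - 1 then if 1 \<le> r \<and> c ! (r - 1) = j then 1 else 0 else 0)" for s
    by (cases "1 \<le> r"; cases "s = r - 1") (simp_all add: lookup_single when_def, linarith?)
  have "plook (cmon c) (r, j) = (\<Sum>s<length c. if s = r - 1 then if 1 \<le> r \<and> c ! (r - 1) = j then 1 else 0 else 0)"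
    unfolding cmon_def lookup_sum * ..
  also have "\<dots> = (if r - 1 < length c then if 1 \<le> r \<and> c ! (r - 1) = j then 1 else 0 else 0)"
    by (subst sum.delta) simp_all
  also have "\<dots> = (if 1 \<le> r \<and> r \<le> length c \<and> c ! (r - 1) = j then 1 else 0)"
    by (cases r) (auto simp: Suc_le_eq)
  finally show ?thesis .
qed

lemma in_column_support: "(r, j) \<in> column_support c \<longleftrightarrow> 1 \<le> r \<and> r \<le> length c \<and> c ! (r - 1) = j"
proof
  assume "1 \<le> r \<and> r \<le> length c \<and> c ! (r - 1) = j"
  then have "(r, j) = (r - 1 + 1, c ! (r - 1)) \<and> r - 1 < length c" by (cases r) (auto simp: Suc_le_eq)
  then show "(r, j) \<in> column_support c" unfolding column_support_def by blast
qed (auto simp: column_support_def)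

lemma keys_cmon: "pkeys (cmon c) = column_support c"
proof (rule Set.set_eqI)
  fix x :: "nat \<times> nat"
  obtain r j where x: "x = (r, j)" by (cases x)
  show "x \<in> pkeys (cmon c) \<longleftrightarrow> x \<in> column_support c"
    unfolding x in_column_support in_keys_iff lookup_cmon by simp
qed

text \<open>Serves in two roles: as a matrix supported on \<open>D\<close>, and as the substitution
  that restricts a polynomial in the entries to that support.\<close>

definition zres :: "(nat \<times> nat) set \<Rightarrow> nat \<times> nat \<Rightarrow> (nat \<times> nat) cpoly" where
  "zres D x = (if x \<in> D then pvar x else 0)"

lemma psubst_zres: "D \<subseteq> D' \<Longrightarrow> psubst (zres D) (zres D' x) = zres D x"
  by (auto simp: zres_def)

lemma prod_psingle: "(\<Prod>i\<in>A. psingle (f i) (1::complex)) = psingle (sum f A) 1"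
  by (induction A rule: infinite_finite_induct) (simp_all add: mult_single)

lemma prod_zres:
  "(\<Prod>i<length t. zres D (i + 1, t ! i)) = (if column_support t \<subseteq> D then psingle (cmon t) 1 else 0)"
proof (cases "column_support t \<subseteq> D")
  case True
  then have "zres D (i + 1, t ! i) = psingle (psingle (i + 1, t ! i) 1) 1" if "i < length t" for i
    using that unfolding zres_def pvar_def column_support_def by auto
  then have "(\<Prod>i<length t. zres D (i + 1, t ! i)) = (\<Prod>i<length t. psingle (psingle (i + 1, t ! i) 1) 1)"
    by (intro prod.cong) auto
  then show ?thesis using True by (simp only: prod_psingle cmon_def if_True)
next
  case False
  then obtain s where "s < length t" "(s + 1, t ! s) \<notin> D" unfolding column_support_def by auto
  then have "(\<Prod>i<length t. zres D (i + 1, t ! i)) = 0"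
    by (intro prod_zero) (auto simp: zres_def intro!: bexI[of _ s])
  then show ?thesis using False by simp
qed

lemma cdet_zres_expand:
  "cdet (zres D) c = (\<Sum>p | p permutes {..<length c}. of_int (sign p) *
     (if column_support (permute_list p c) \<subseteq> D then psingle (cmon (permute_list p c)) 1 else 0))"
  unfolding cdet_expand
proof (intro sum.cong refl arg_cong2[of _ _ _ _ "(*)"])
  fix p assume "p \<in> {p. p permutes {..<length c}}"
  then have "(\<Prod>i<length c. zres D (i + 1, c ! p i)) = (\<Prod>i<length (permute_list p c). zres D (i + 1, permute_list p c ! i))"
    using permute_list_nth[of p c] by (intro prod.cong) auto
  then show "(\<Prod>i<length c. zres D (i + 1, c ! p i)) =
      (if column_support (permute_list p c) \<subseteq> D then psingle (cmon (permute_list p c)) 1 else 0)"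
    unfolding prod_zres .
qed

text \<open>A surviving term of the expansion would be an arrangement of \<open>c\<close> inside
  \<open>D\<close>, and by minimality of PBW columns \<open>c\<close> itself would then fit into
  \<open>D\<close>.\<close>

lemma cdet_zres_zero:
  assumes D: "staircase_down D" and c: "pbw_column c" and not: "\<not> dn c \<subseteq> D"
  shows "cdet (zres D) c = 0"
  unfolding cdet_zres_expand
proof (rule sum.neutral, safe)
  fix p assume p: "p permutes {..<length c}"
  have "\<not> column_support (permute_list p c) \<subseteq> D"
    using pbw_column_minimal(1)[OF D c mset_permute_list[OF p]] not dn_subset_iff[OF c D] by blast
  then show "of_int (sign p) * (if column_support (permute_list p c) \<subseteq> D
      then psingle (cmon (permute_list p c)) 1 else 0) = (0 :: (nat \<times> nat) cpoly)" by simp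
qed

text \<open>The identity permutation contributes \<open>cmon c\<close>. Every other permutation
  gives a different arrangement, as the entries are distinct, and if it survives the restriction it
  is strictly costlier by \<open>pbw_column_minimal\<close>.\<close>

lemma leads_cdet_zres:
  assumes D: "staircase_down D" and c: "pbw_column c" and sub: "dn c \<subseteq> D"
  shows "leads (cmon c) (cdet (zres D) c)"
proof -
  let ?P = "{p. p permutes {..<length c}}"
  let ?f = "\<lambda>p. of_int (sign p) * (if column_support (permute_list p c) \<subseteq> D
    then psingle (cmon (permute_list p c)) 1 else 0) :: (nat \<times> nat) cpoly"
  have fin: "finite ?P" by (rule finite_permutations) simp
  have "cdet (zres D) c = ?f id + sum ?f (?P - {id})"
    unfolding cdet_zres_expand by (rule sum.remove[OF fin]) (simp add: permutes_id)
  moreover have "?f id = psingle (cmon c) 1" using sub dn_subset_iff[OF c D] by simp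
  moreover have "mcost (cmon c) < mcost k" if "k \<in> pkeys (sum ?f (?P - {id}))" for k
  proof -
    have "k \<in> (\<Union>p\<in>?P - {id}. pkeys (?f p))"
      by (rule subsetD[OF Poly_Mapping.keys_sum that])
    then obtain p where p': "p \<in> ?P - {id}" "k \<in> pkeys (?f p)" by (rule UN_E)
    then have p: "p \<in> ?P" "p \<noteq> id" "k \<in> pkeys (?f p)" by simp_all
    let ?t = "permute_list p c"
    have t: "column_support ?t \<subseteq> D" using p(3) by (cases "column_support ?t \<subseteq> D") simp_all
    have "?f p = psingle (cmon ?t) (of_int (sign p))" using t by (simp add: mult_single flip: single_of_int)
    then have k: "k = cmon ?t" using p(3) by (simp split: if_splits)
    have "?t \<noteq> c"
    proof
      assume eq: "?t = c"
      have "p i = i" for i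
      proof (cases "i < length c")
        case True
        have pi: "p i < length c" using permutes_in_image[of p "{..<length c}" i] p(1) True by simp
        have "c ! p i = c ! i" using permute_list_nth[of p c i] p(1) True eq by simp
        then show ?thesis using pbw_distinct[OF c] pi True by (simp add: nth_eq_iff_index_eq)
      next
        case False
        then show ?thesis using permutes_not_in[of p "{..<length c}" i] p(1) by simp
      qed
      then show False using p(2) by auto
    qed
    moreover have "mset ?t = mset c" using p(1) by simp
    ultimately show ?thesis using pbw_column_minimal(2)[OF D c _ t] unfolding k mcost_cmon by blast
  qed
  ultimately show ?thesis unfolding leads_def by auto
qed

section \<open>Independence of standard monomials\<close>

definition staircase_hull :: "(nat \<times> nat) set \<Rightarrow> (nat \<times> nat) set" where
  "staircase_hull A = {(r, j). 1 \<le> r \<and> r \<le> j \<and> (\<exists>x\<in>A. r \<le> fst x \<and> j \<le> snd x)}"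

lemma staircase_hull_UN: "staircase_hull (\<Union>x\<in>A. f x) = (\<Union>x\<in>A. staircase_hull (f x))"
  unfolding staircase_hull_def by fast

lemma dn_eq_hull: "dn c = staircase_hull (column_support c)"
  unfolding dn_def staircase_hull_def column_support_def by fastforce

lemma keys_add_nat: "pkeys (a + b) = pkeys a \<union> pkeys (b :: 'x \<Rightarrow>\<^sub>0 nat)"
  by (rule Set.set_eqI) (simp add: in_keys_iff lookup_add)

definition wmon :: "nat list list \<Rightarrow> (nat \<times> nat \<Rightarrow>\<^sub>0 nat)" where
  "wmon w = sum_list (map cmon w)"

lemma hull_keys_wmon: "staircase_hull (pkeys (wmon w)) = (\<Union>c\<in>set w. dn c)"
proof -
  have "pkeys (wmon w) = (\<Union>c\<in>set w. column_support c)"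
    unfolding wmon_def by (induction w) (simp_all add: keys_add_nat keys_cmon)
  then show ?thesis by (simp only: staircase_hull_UN dn_eq_hull)
qed

lemma leads_prod_list:
  "(\<And>c. c \<in> set w \<Longrightarrow> leads (cmon c) (f c)) \<Longrightarrow> leads (wmon w) (prod_list (map f w))"
  unfolding wmon_def by (induction w) (simp_all add: leads_1 leads_mult)

definition chain_word :: "nat \<Rightarrow> nat list list \<Rightarrow> bool" where
  "chain_word n w \<longleftrightarrow> set w \<subseteq> pbw_columns n \<and> sorted_wrt (\<lambda>x y. dn x \<subseteq> dn y) w"

lemma chain_word_snoc:
  "chain_word n (w @ [c]) \<longleftrightarrow> chain_word n w \<and> c \<in> pbw_columns n \<and> (\<forall>x\<in>set w. dn x \<subseteq> dn c)"
  unfolding chain_word_def sorted_wrt_append by auto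

lemma hull_chain_word_snoc:
  assumes "chain_word n (w @ [c])" shows "staircase_hull (pkeys (wmon (w @ [c]))) = dn c"
  using assms unfolding hull_keys_wmon chain_word_snoc by auto

lemma dn_nonempty: "c \<in> pbw_columns n \<Longrightarrow> dn c \<noteq> {}"
  using dn_diag[of c 1] pbw_columnsD(1,3)[of c n] by blast

text \<open>
  The monomial of a chain determines its largest column, because the staircase hull of its support
  is the ideal of that column.
\<close>

lemma wmon_inj: "chain_word n w \<Longrightarrow> chain_word n w' \<Longrightarrow> wmon w = wmon w' \<Longrightarrow> w = w'"
proof (induction w arbitrary: w' rule: rev_induct)
  case Nil
  show ?case
  proof (cases w' rule: rev_cases)
    case (snoc v c)
    have "staircase_hull (pkeys (wmon [])) = dn c" using hull_chain_word_snoc Nil snoc by metis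
    then show ?thesis using dn_nonempty[of c n] Nil(2) by (simp add: hull_keys_wmon snoc chain_word_snoc)
  qed simp
next
  case (snoc c w)
  show ?case
  proof (cases w' rule: rev_cases)
    case Nil
    have "staircase_hull (pkeys (wmon [])) = dn c" using hull_chain_word_snoc[OF snoc.prems(1)] snoc.prems(3) Nil by simp
    then show ?thesis using dn_nonempty[of c n] snoc.prems(1) by (simp add: hull_keys_wmon chain_word_snoc)
  next
    case (snoc v d)
    note w' = this
    have cd: "c \<in> pbw_columns n" "d \<in> pbw_columns n"
      using snoc.prems(1,2) unfolding w' chain_word_snoc by blast+
    have "dn c = dn d"
      using hull_chain_word_snoc[OF snoc.prems(1)] hull_chain_word_snoc[of n v d] snoc.prems(2,3) unfolding w' by simp
    then have "c = d" using dn_inj pbw_columnsD(1) cd by blast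
    \<comment> \<open>Exponent vectors can be cancelled, so equal largest columns leave equal
      monomials for the shorter chains.\<close>
    moreover have "wmon w = wmon v" using snoc.prems(3) unfolding w' \<open>c = d\<close> by (simp add: wmon_def)
    ultimately show ?thesis using snoc.IH[of v] snoc.prems(1,2) unfolding w' chain_word_snoc by simp
  qed
qed

text \<open>Independence on a restricted support, for chains that fit into it. The full triangle
  gives the standard basis; the ideal of a single column gives the bounds on the terms of an
  expansion.\<close>

lemma chain_words_independent:
  assumes D: "staircase_down D" and fin: "finite S"
    and S: "\<And>w. w \<in> S \<Longrightarrow> chain_word n w" "\<And>w c. w \<in> S \<Longrightarrow> c \<in> set w \<Longrightarrow> dn c \<subseteq> D"
    and sum0: "(\<Sum>w\<in>S. pconst (a w) * prod_list (map (cdet (zres D)) w)) = 0" and w: "w \<in> S"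
  shows "a w = 0"
proof (rule leads_independent[OF fin _ _ sum0 w, of wmon])
  show "inj_on wmon S" by (rule inj_onI) (use wmon_inj S(1) in blast)
next
  fix v assume v: "v \<in> S"
  show "leads (wmon v) (prod_list (map (cdet (zres D)) v))"
  proof (rule leads_prod_list)
    fix c assume c: "c \<in> set v"
    then have "pbw_column c" using S(1)[OF v] pbw_columnsD(1) unfolding chain_word_def by blast
    then show "leads (cmon c) (cdet (zres D) c)" using leads_cdet_zres[OF D] S(2)[OF v c] by blast
  qed
qed

abbreviation triangle :: "(nat \<times> nat) set" where
  "triangle \<equiv> {(r, j). 1 \<le> r \<and> r \<le> j}"

lemma dn_subset_triangle: "dn c \<subseteq> triangle"
  unfolding dn_def by auto

lemma psubst_cdet_zres: "D \<subseteq> D' \<Longrightarrow> psubst (zres D) (cdet (zres D') c) = cdet (zres D) c"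
  by (simp add: psubst_cdet psubst_zres)

lemma psubst_cdet_pvar: "psubst (zres D) (cdet pvar c) = cdet (zres D) c"
  by (simp add: psubst_cdet)

definition standard_pairs :: "nat \<Rightarrow> (nat list \<times> nat list) set" where
  "standard_pairs n = {(g, h). g \<in> pbw_columns n \<and> h \<in> pbw_columns n \<and> dn g \<subseteq> dn h}"

lemma finite_standard_pairs: "finite (standard_pairs n)"
  by (rule finite_subset[of _ "pbw_columns n \<times> pbw_columns n"])
    (auto simp: standard_pairs_def finite_pbw_columns)

lemma standard_pairs_independent:
  assumes D: "staircase_down D" and S: "S \<subseteq> standard_pairs n" "\<And>g h. (g, h) \<in> S \<Longrightarrow> dn h \<subseteq> D"
    and sum0: "(\<Sum>(g, h)\<in>S. pconst (c (g, h)) * (cdet (zres D) g * cdet (zres D) h)) = 0" and gh: "(g, h) \<in> S"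
  shows "c (g, h) = 0"
proof -
  let ?w = "\<lambda>(g, h). [g, h]" and ?S = "(\<lambda>(g, h). [g, h]) ` S"
  have inj: "inj_on ?w S" by (rule inj_onI) auto
  have fin: "finite S" using finite_subset[OF S(1) finite_standard_pairs] .
  \<comment> \<open>Pairs are treated as words of two letters; \<open>hd\<close> and
    \<open>last\<close> recover the pair.\<close>
  have "(\<lambda>w. c (hd w, last w)) [g, h] = 0"
  proof (rule chain_words_independent[OF D, of ?S n])
    show "finite ?S" using fin by simp
    show "chain_word n w" if "w \<in> ?S" for w
      using that S(1) unfolding chain_word_def standard_pairs_def by auto
    show "dn x \<subseteq> D" if "w \<in> ?S" "x \<in> set w" for w x
    proof -
      from that(1) obtain x where x: "w = ?w x" "x \<in> S" by (rule imageE)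
      obtain g' h' where "x = (g', h')" by (cases x)
      then have gh': "(g', h') \<in> S" "w = [g', h']" using x by simp_all
      then have "dn g' \<subseteq> dn h'" "dn h' \<subseteq> D" using S unfolding standard_pairs_def by auto
      then show ?thesis using that(2) gh'(2) by auto
    qed
    show "(\<Sum>w\<in>?S. pconst (c (hd w, last w)) * prod_list (map (cdet (zres D)) w)) = 0"
      unfolding sum.reindex[OF inj] sum0[symmetric] by (rule sum.cong) auto
    show "[g, h] \<in> ?S" using gh by force
  qed
  then show ?thesis by simp
qed

text \<open>
  Restricting to the matrices supported on the ideal of \<open>h\<close> kills exactly the determinants of
  the columns that do not lie below \<open>h\<close>.
\<close>

lemma expansion_upper_bound:
  assumes ab: "a \<in> pbw_columns n" "b \<in> pbw_columns n" and S: "S \<subseteq> standard_pairs n"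
    and c: "\<And>x. x \<in> S \<Longrightarrow> c x \<noteq> 0"
    and eq: "cdet (zres triangle) a * cdet (zres triangle) b =
      (\<Sum>(g, h)\<in>S. pconst (c (g, h)) * (cdet (zres triangle) g * cdet (zres triangle) h))"
    and gh: "(g, h) \<in> S"
  shows "dn a \<subseteq> dn h \<and> dn b \<subseteq> dn h"
proof (rule ccontr)
  assume not: "\<not> ?thesis"
  let ?D = "dn h" and ?S = "{(g', h') \<in> S. dn h' \<subseteq> dn h}"
  let ?d = "cdet (zres (dn h))"
  have fin: "finite S" using finite_subset[OF S finite_standard_pairs] .
  \<comment> \<open>If \<open>a\<close> or \<open>b\<close> does not lie below \<open>h\<close>, the
    left side dies on the matrices supported on \<open>dn h\<close>. The term of
    \<open>(g, h)\<close> stays alive there, and so do only terms that are independent on this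
    support, which forces its coefficient to be zero.\<close>
  have "?d a * ?d b = 0"
    using not cdet_zres_zero[OF staircase_down_dn] pbw_columnsD(1) ab by (metis mult_eq_0_iff)
  moreover have "?d a * ?d b = (\<Sum>(g', h')\<in>S. pconst (c (g', h')) * (?d g' * ?d h'))"
    using arg_cong[OF eq, of "psubst (zres ?D)"] psubst_cdet_zres[OF dn_subset_triangle]
    by (simp add: psubst_mult psubst_sum case_prod_unfold)
  moreover have "\<dots> = (\<Sum>(g', h')\<in>?S. pconst (c (g', h')) * (?d g' * ?d h'))"
  proof (rule sum.mono_neutral_right[OF fin], blast, rule ballI)
    fix x assume x: "x \<in> S - ?S"
    obtain g' h' where x': "x = (g', h')" by (cases x)
    have gh': "(g', h') \<in> S" "\<not> dn h' \<subseteq> dn h" using x unfolding x' by simp_all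
    then have "pbw_column h'" using S pbw_columnsD(1) unfolding standard_pairs_def by blast
    then show "(case x of (g', h') \<Rightarrow> pconst (c (g', h')) * (?d g' * ?d h')) = 0"
      using cdet_zres_zero[OF staircase_down_dn _ gh'(2)] by (simp add: x')
  qed
  ultimately have "(\<Sum>(g', h')\<in>?S. pconst (c (g', h')) * (?d g' * ?d h')) = 0" by simp
  then have "c (g, h) = 0"
    using standard_pairs_independent[OF staircase_down_dn[of h], of ?S n c g h] S gh by blast
  then show False using c[OF gh] by simp
qed

section \<open>Spanning by standard pairs\<close>

text \<open>Entry of a block diagonal matrix whose determinant is a product of two minors; both
  blocks use the rows of \<open>z\<close> from the top. The column label \<open>v\<close> is
  separate from the position \<open>j\<close>, so that labels can be permuted while the positions
  stay.\<close>

definition block_entry :: "nat \<Rightarrow> (nat \<times> nat \<Rightarrow> 'a :: comm_ring_1) \<Rightarrow> nat \<Rightarrow> nat \<Rightarrow> nat \<Rightarrow> 'a" where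
  "block_entry k z i j v = (if (i < k) = (j < k) then z ((if i < k then i else i - k) + 1, v) else 0)"

definition block_mat :: "nat \<Rightarrow> (nat \<times> nat \<Rightarrow> 'a :: comm_ring_1) \<Rightarrow> nat list \<Rightarrow> 'a mat" where
  "block_mat k z L = mat (length L) (length L) (\<lambda>(i, j). block_entry k z i j (L ! j))"

definition cdet2 :: "nat \<Rightarrow> (nat \<times> nat \<Rightarrow> 'a :: comm_ring_1) \<Rightarrow> nat list \<Rightarrow> 'a" where
  "cdet2 k z L = cdet z (take k L) * cdet z (drop k L)"

lemma block_mat_carrier [simp]: "block_mat k z L \<in> carrier_mat (length L) (length L)"
  by (simp add: block_mat_def)

lemma det_block_mat:
  fixes z :: "nat \<times> nat \<Rightarrow> 'a :: idom"
  assumes k: "k \<le> length L"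
  shows "det (block_mat k z L) = cdet2 k z L"
proof -
  let ?l = "length L - k"
  let ?A = "mat k k (\<lambda>(r, s). z (r + 1, take k L ! s))"
  let ?B = "mat ?l ?l (\<lambda>(r, s). z (r + 1, drop k L ! s))"
  have "block_mat k z L = four_block_mat ?A (0\<^sub>m k ?l) (0\<^sub>m ?l k) ?B"
  proof (rule eq_matI)
    fix i j
    assume "i < dim_row (four_block_mat ?A (0\<^sub>m k ?l) (0\<^sub>m ?l k) ?B)"
      "j < dim_col (four_block_mat ?A (0\<^sub>m k ?l) (0\<^sub>m ?l k) ?B)"
    then have ij: "i < length L" "j < length L" using k by simp_all
    then show "block_mat k z L $$ (i, j) = four_block_mat ?A (0\<^sub>m k ?l) (0\<^sub>m ?l k) ?B $$ (i, j)"
      using k by (cases "i < k"; cases "j < k") (simp_all add: block_mat_def block_entry_def)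
  qed (use k in \<open>simp_all add: block_mat_def\<close>)
  also have "det \<dots> = det ?A * det ?B"
    by (rule det_four_block_mat_upper_right_zero[OF mat_carrier refl zero_carrier_mat mat_carrier])
  also have "\<dots> = cdet2 k z L" using k by (simp add: cdet2_def cdet_def min_absorb2)
  finally show ?thesis .
qed

lemma cdet2_expand:
  fixes z :: "nat \<times> nat \<Rightarrow> 'a :: idom"
  assumes k: "k \<le> length L"
  shows "cdet2 k z L = (\<Sum>\<sigma> | \<sigma> permutes {..<length L}.
    of_int (sign \<sigma>) * (\<Prod>j<length L. block_entry k z (\<sigma> j) j (L ! j)))"
proof -
  have "cdet2 k z L = (\<Sum>\<sigma> | \<sigma> permutes {0..<length L}.
      of_int (sign \<sigma>) * (\<Prod>j<length L. block_mat k z L $$ (\<sigma> j, j)))"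
    unfolding det_block_mat[OF k, symmetric] by (rule det_col) simp
  also have "\<dots> = (\<Sum>\<sigma> | \<sigma> permutes {0..<length L}.
      of_int (sign \<sigma>) * (\<Prod>j<length L. block_entry k z (\<sigma> j) j (L ! j)))"
  proof (intro sum.cong refl arg_cong2[of _ _ _ _ "(*)"] prod.cong)
    fix \<sigma> j assume "\<sigma> \<in> {\<sigma>. \<sigma> permutes {0..<length L}}" "j \<in> {..<length L}"
    moreover from this have "\<sigma> j < length L" using permutes_in_image[of \<sigma> "{0..<length L}" j] by simp
    ultimately show "block_mat k z L $$ (\<sigma> j, j) = block_entry k z (\<sigma> j) j (L ! j)" by (simp add: block_mat_def)
  qed
  finally show ?thesis by (simp only: atLeast0LessThan)
qed

lemma cdet2_permute_list:
  fixes z :: "nat \<times> nat \<Rightarrow> 'a :: idom"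
  assumes k: "k \<le> length L" and p: "p permutes {..<length L}" and inv: "\<And>j. j < length L \<Longrightarrow> p j < k \<longleftrightarrow> j < k"
  shows "cdet2 k z (permute_list p L) = of_int (sign p) * cdet2 k z L"
proof -
  let ?n = "length L"
  let ?A = "block_mat k z L" and ?B = "block_mat k z (permute_list p L)"
  have p': "p permutes {0..<?n}" using p by (simp only: atLeast0LessThan)
  have A: "?A \<in> carrier_mat ?n ?n" "?B \<in> carrier_mat ?n ?n" by (simp_all add: block_mat_def)
  have "transpose_mat ?B = mat ?n ?n (\<lambda>(i, j). transpose_mat ?A $$ (p i, j))"
  proof (rule eq_matI)
    fix i j assume "i < dim_row (mat ?n ?n (\<lambda>(i, j). transpose_mat ?A $$ (p i, j)))"
      "j < dim_col (mat ?n ?n (\<lambda>(i, j). transpose_mat ?A $$ (p i, j)))"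
    then have ij: "i < ?n" "j < ?n" by simp_all
    moreover have "p i < ?n" using permutes_in_image[OF p, of i] ij by simp
    ultimately show "transpose_mat ?B $$ (i, j) = mat ?n ?n (\<lambda>(i, j). transpose_mat ?A $$ (p i, j)) $$ (i, j)"
      using permute_list_nth[OF p ij(1)] inv[OF ij(1)] by (simp add: block_mat_def block_entry_def)
  qed (simp_all add: block_mat_def)
  then have "det (transpose_mat ?B) = of_int (sign p) * det (transpose_mat ?A)"
    using det_permute_rows[of "transpose_mat ?A" ?n p] p' A by simp
  then have "det ?B = of_int (sign p) * det ?A"
    unfolding det_transpose[OF A(1)] det_transpose[OF A(2)] .
  then show ?thesis using det_block_mat[of k L z] det_block_mat[of k "permute_list p L" z] k by simp
qed

lemma eq_uminus_imp_zero: "(x :: 'a :: {idom, ring_char_0}) = - x \<Longrightarrow> x = 0"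
proof -
  assume "x = - x"
  then have "2 * x = 0" by (metis add.right_inverse mult_2)
  then show "x = 0" by simp
qed

text \<open>The \<open>k + 1\<close> antisymmetrised columns involve only \<open>k\<close> rows.\<close>

lemma pluecker_relation:
  fixes z :: "nat \<times> nat \<Rightarrow> 'a :: {idom, ring_char_0}"
  assumes k: "k \<le> length L" "length L \<le> 2 * k" and B: "B \<subseteq> {..<length L}" "card B = k + 1"
  shows "(\<Sum>p | p permutes B. of_int (sign p) * cdet2 k z (permute_list p L)) = 0"
proof -
  let ?n = "length L" and ?e = "block_entry k z"
  let ?P = "{p. p permutes B}" and ?S = "{\<sigma>. \<sigma> permutes {..<length L}}"
  have finB: "finite B" using B(1) finite_subset by blast
  \<comment> \<open>The contribution of the relabelling \<open>p\<close> for a fixed assignment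
    \<open>\<sigma>\<close> of block rows to positions. The sum over \<open>p\<close> already
    vanishes for each \<open>\<sigma>\<close> separately.\<close>
  define G where "G \<sigma> p = of_int (sign p) * (\<Prod>j<?n. ?e (\<sigma> j) j (L ! p j))" for \<sigma> p
  have perm: "p permutes {..<?n}" if "p \<in> ?P" for p using that permutes_subset B(1) by blast
  have G0: "(\<Sum>p\<in>?P. G \<sigma> p) = 0" if \<sigma>: "\<sigma> \<in> ?S" for \<sigma>
  proof (cases "\<forall>j<?n. (\<sigma> j < k) = (j < k)")
    case False
    then obtain j where j: "j < ?n" "(\<sigma> j < k) \<noteq> (j < k)" by blast
    have "(\<Prod>j<?n. ?e (\<sigma> j) j (L ! p j)) = 0" for p
      by (rule prod_zero) (use j in \<open>auto simp: block_entry_def intro!: bexI[of _ j]\<close>)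
    then show ?thesis unfolding G_def by (simp only: mult_zero_right sum.neutral_const)
  next
    case True
    \<comment> \<open>The row of \<open>z\<close> that \<open>\<sigma>\<close> assigns to position
      \<open>j\<close>. The second column is no longer than the first, so only rows below
      \<open>k\<close> occur, and two of the \<open>k + 1\<close> positions in \<open>B\<close>
      share a row.\<close>
    define row where "row j = (if \<sigma> j < k then \<sigma> j else \<sigma> j - k)" for j
    have "\<sigma> j < ?n" if "j < ?n" for j using permutes_in_image[of \<sigma> "{..<?n}" j] \<sigma> that by simp
    then have row: "row j < k" if "j < ?n" for j using that k(2) unfolding row_def by fastforce
    then have "row ` B \<subseteq> {..<k}" using B(1) by auto
    then have "card (row ` B) \<le> k" using card_mono[of "{..<k}" "row ` B"] by simp
    then have "\<not> inj_on row B" using B(2) by (metis card_image add_le_same_cancel1 not_one_le_zero)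
    then obtain x y where xy: "x \<in> B" "y \<in> B" "x \<noteq> y" "row x = row y" unfolding inj_on_def by blast
    let ?t = "transpose x y"
    have tB: "?t permutes B" using xy by (intro permutes_swap_id) auto
    have tn: "?t permutes {..<?n}" using tB permutes_subset B(1) by blast
    have e: "?e (\<sigma> j) j v = z (row j + 1, v)" if "j < ?n" for j v
      using True that unfolding block_entry_def row_def by simp
    have rowt: "row (?t j) = row j" for j using xy(4) by (cases "j = x"; cases "j = y") auto
    have tj: "?t j < ?n" if "j < ?n" for j using permutes_in_image[OF tn, of j] that by simp
    \<comment> \<open>Exchanging the labels at two positions with the same row leaves the product
      unchanged and reverses the sign, so the sum over all relabellings equals its own
      negative.\<close>
    have "G \<sigma> (p \<circ> ?t) = - G \<sigma> p" if p: "p \<in> ?P" for p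
    proof -
      have "permutation p" "permutation ?t" using p tB finB permutation_permutes by blast+
      then have sgn: "sign (p \<circ> ?t) = - sign p" using xy(3) by (simp add: sign_compose sign_swap_id)
      have "(\<Prod>j<?n. ?e (\<sigma> j) j (L ! (p \<circ> ?t) j)) = (\<Prod>j<?n. z (row (?t j) + 1, L ! p (?t j)))"
        by (rule prod.cong) (simp_all add: e rowt)
      also have "\<dots> = (\<Prod>j<?n. z (row j + 1, L ! p j))"
        using prod.permute[OF tn, of "\<lambda>j. z (row j + 1, L ! p j)"] by (simp add: comp_def)
      also have "\<dots> = (\<Prod>j<?n. ?e (\<sigma> j) j (L ! p j))"
        by (rule prod.cong) (simp_all add: e)
      finally show ?thesis unfolding G_def sgn by simp
    qed
    then have "(\<Sum>p\<in>?P. G \<sigma> (p \<circ> ?t)) = - (\<Sum>p\<in>?P. G \<sigma> p)"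
      unfolding sum_negf[symmetric] by (rule sum.cong[OF refl])
    then show ?thesis
      using sum_permutations_compose_right[OF tB, of "G \<sigma>"] by (intro eq_uminus_imp_zero) simp
  qed
  have "(\<Sum>p\<in>?P. of_int (sign p) * cdet2 k z (permute_list p L)) = (\<Sum>p\<in>?P. \<Sum>\<sigma>\<in>?S. of_int (sign \<sigma>) * G \<sigma> p)"
  proof (rule sum.cong[OF refl])
    fix p assume p: "p \<in> ?P"
    have "cdet2 k z (permute_list p L) = (\<Sum>\<sigma>\<in>?S. of_int (sign \<sigma>) * (\<Prod>j<?n. ?e (\<sigma> j) j (permute_list p L ! j)))"
      using cdet2_expand[of k "permute_list p L" z] k(1) by simp
    also have "\<dots> = (\<Sum>\<sigma>\<in>?S. of_int (sign \<sigma>) * (\<Prod>j<?n. ?e (\<sigma> j) j (L ! p j)))"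
      using permute_list_nth[OF perm[OF p]] by simp
    finally show "of_int (sign p) * cdet2 k z (permute_list p L) = (\<Sum>\<sigma>\<in>?S. of_int (sign \<sigma>) * G \<sigma> p)"
      unfolding G_def by (simp add: sum_distrib_left mult.left_commute)
  qed
  also have "\<dots> = (\<Sum>\<sigma>\<in>?S. of_int (sign \<sigma>) * (\<Sum>p\<in>?P. G \<sigma> p))"
    by (subst sum.swap) (simp add: sum_distrib_left)
  also have "\<dots> = 0" using G0 by simp
  finally show ?thesis .
qed

section \<open>Exchanges between two columns and the order that they increase\<close>

lemma sum_digits: "(\<Sum>s<r. n * (n + 1) ^ s) + 1 = ((n :: nat) + 1) ^ r"
  by (induction r) (simp_all add: algebra_simps)

text \<open>The column read as a number in base \<open>n + 1\<close> whose leading digit is the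
  bottom row.\<close>

definition column_weight :: "nat \<Rightarrow> nat list \<Rightarrow> nat" where
  "column_weight n c = (\<Sum>s<length c. c ! s * (n + 1) ^ s)"

text \<open>Whatever is lost in the rows with index below \<open>r\<close> is worth less than
  \<open>(n + 1) ^ r\<close>, and the gain at \<open>s0\<close> is at least that much.\<close>

lemma column_weight_less:
  assumes a: "set a \<subseteq> {1..n}" and len: "length a' = length a"
    and le: "\<And>s. r \<le> s \<Longrightarrow> s < length a \<Longrightarrow> a ! s \<le> a' ! s"
    and less: "r \<le> s0" "s0 < length a" "a ! s0 < a' ! s0"
  shows "column_weight n a < column_weight n a'"
proof -
  let ?N = "n + 1"
  have split: "column_weight n c = (\<Sum>s<r. c ! s * ?N ^ s) + (\<Sum>s\<in>{r..<length a}. c ! s * ?N ^ s)"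
    if "length c = length a" for c
    unfolding column_weight_def that using less(1,2)
    by (subst sum.atLeastLessThan_concat[of 0 r "length a", symmetric, unfolded atLeast0LessThan]) auto
  have "a ! s \<le> n" if "s < length a" for s using a nth_mem[OF that] by auto
  then have "(\<Sum>s<r. a ! s * ?N ^ s) \<le> (\<Sum>s<r. n * ?N ^ s)"
    using less(1,2) by (intro sum_mono mult_right_mono) simp_all
  then have low: "(\<Sum>s<r. a ! s * ?N ^ s) < ?N ^ r" using sum_digits[of n r] by linarith
  have "(\<Sum>s\<in>{r..<length a}. a ! s * ?N ^ s) + ?N ^ r \<le> (\<Sum>s\<in>{r..<length a}. a ! s * ?N ^ s) + ?N ^ s0"
    using less(1) by (simp add: power_increasing)
  also have "\<dots> = (\<Sum>s\<in>{r..<length a} - {s0}. a ! s * ?N ^ s) + (a ! s0 + 1) * ?N ^ s0"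
    using less(1,2) by (subst sum.remove[of _ s0]) (simp_all add: algebra_simps)
  also have "\<dots> \<le> (\<Sum>s\<in>{r..<length a} - {s0}. a' ! s * ?N ^ s) + a' ! s0 * ?N ^ s0"
    using le less(3) by (intro add_mono sum_mono mult_right_mono) simp_all
  also have "\<dots> = (\<Sum>s\<in>{r..<length a}. a' ! s * ?N ^ s)"
    using less(1,2) by (subst sum.remove[of _ s0]) (simp_all add: algebra_simps)
  finally show ?thesis using low split[OF refl] split[OF len] by linarith
qed

text \<open>
  Every entry moved in is counted by the rank criterion of each row from \<open>r\<close> on, so none of
  these rows decreases.
\<close>

lemma exchange_increases:
  assumes a: "pbw_column a" and a': "pbw_column a'" and len: "length a' = length a"
    and big: "\<And>s. r \<le> s \<Longrightarrow> s < length a \<Longrightarrow> a ! s < v" "length a < v"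
    and gain: "\<And>x. x \<in> set a' \<Longrightarrow> x \<notin> set a \<Longrightarrow> x \<le> r \<or> v \<le> x"
    and loss: "\<And>x. x \<in> set a \<Longrightarrow> x \<notin> set a' \<Longrightarrow> \<exists>s. r \<le> s \<and> s < length a \<and> a ! s = x"
    and ne: "set a' \<noteq> set a"
  shows "\<And>s. r \<le> s \<Longrightarrow> s < length a \<Longrightarrow> a ! s \<le> a' ! s"
    and "\<exists>s. r \<le> s \<and> s < length a \<and> a ! s < a' ! s"
proof -
  have card: "card (set a) = length a" "card (set a') = length a"
    using distinct_card pbw_distinct a a' len by metis+
  have diff: "card (set a' - set a) = card (set a - set a')"
    using card card_Diff_subset_Int[of "set a'" "set a"] card_Diff_subset_Int[of "set a" "set a'"]
    by (simp add: Int_commute)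
  show le: "a ! s \<le> a' ! s" if s: "r \<le> s" "s < length a" for s
  proof (cases "a ! s = s + 1")
    case True
    then show ?thesis using pbw_nth_ge[OF a', of s] s len by simp
  next
    case False
    let ?R = "s + 1" and ?j = "a ! s"
    let ?C = "{x. x < ?R \<or> ?j \<le> x}"
    have j: "length a < ?j" using pbw_nth_eq[OF a s(2)] False by linarith
    have Rj: "1 \<le> ?R" "?R \<le> ?j" using s(2) j by linarith+
    have "(?R, ?j) \<in> dn a" unfolding dn_def using Rj s(2) by auto
    then have "?R \<le> card {x \<in> set a. x < ?R \<or> ?j \<le> x}" using dn_iff_card[OF a Rj] by simp
    also have "{x \<in> set a. x < ?R \<or> ?j \<le> x} = (set a \<inter> set a' \<inter> ?C) \<union> ((set a - set a') \<inter> ?C)" by blast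
    also have "card \<dots> \<le> card (set a \<inter> set a' \<inter> ?C) + card ((set a - set a') \<inter> ?C)" by (rule card_Un_le)
    also have "\<dots> \<le> card (set a \<inter> set a' \<inter> ?C) + card (set a' - set a)"
      unfolding diff by (intro add_left_mono card_mono) auto
    also have "\<dots> = card ((set a \<inter> set a' \<inter> ?C) \<union> (set a' - set a))"
      by (rule card_Un_disjoint[symmetric]) auto
    also have "\<dots> \<le> card {x \<in> set a'. x < ?R \<or> ?j \<le> x}"
    proof (rule card_mono, simp, rule subsetI)
      fix x assume x: "x \<in> (set a \<inter> set a' \<inter> ?C) \<union> (set a' - set a)"
      then consider "x \<in> set a'" "x < ?R \<or> ?j \<le> x" | "x \<in> set a'" "x \<notin> set a" by blast
      then show "x \<in> {x \<in> set a'. x < ?R \<or> ?j \<le> x}"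
      proof cases
        case 2
        have "x \<le> r \<or> v \<le> x" by (rule gain[OF 2])
        then have "x < ?R \<or> ?j \<le> x" using big(1)[OF s] s(1) by linarith
        then show ?thesis using 2 by simp
      qed simp
    qed
    finally have "(?R, ?j) \<in> dn a'" using dn_iff_card[OF a' Rj] by simp
    \<comment> \<open>The witness \<open>q\<close> may lie below row \<open>s\<close>. Entries
      exceeding the length decrease downwards, so row \<open>s\<close> is then at least as large,
      unless it has become a fixed row. In that case \<open>s + 1\<close> would be a newly arrived
      entry, which \<open>gain\<close> excludes because \<open>r < s + 1\<close> and
      \<open>s + 1 < v\<close>.\<close>
    then obtain q where q: "q < length a'" "s \<le> q" "?j \<le> a' ! q" unfolding dn_def by auto
    have s': "s < length a'" using s len by simp
    show ?thesis
    proof (cases "length a' < a' ! s")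
      case True
      show ?thesis
      proof (cases "q = s")
        case False
        then show ?thesis using pbw_nth_less[OF a' _ q(1) True] q j len by simp
      qed (use q in simp)
    next
      case small: False
      then have eq: "a' ! s = s + 1" using pbw_nth_eq[OF a' s'] by simp
      have "s + 1 \<in> set a'" using nth_mem[OF s'] eq by simp
      moreover have "s + 1 \<notin> set a"
      proof
        assume "s + 1 \<in> set a"
        then obtain t where t: "t < length a" "a ! t = s + 1" by (metis in_set_conv_nth)
        then have "a ! t = t + 1" using pbw_nth_eq[OF a t(1)] s by simp
        then show False using t False by simp
      qed
      ultimately have "s + 1 \<le> r \<or> v \<le> s + 1" by (rule gain)
      then show ?thesis using s big(2) by linarith
    qed
  qed
  show "\<exists>s. r \<le> s \<and> s < length a \<and> a ! s < a' ! s"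
  proof (rule ccontr)
    assume no: "\<not> ?thesis"
    have "set a \<subseteq> set a'"
    proof
      fix x assume x: "x \<in> set a"
      show "x \<in> set a'"
      proof (rule ccontr)
        assume "x \<notin> set a'"
        then obtain s where s: "r \<le> s" "s < length a" "a ! s = x" using loss x by blast
        then have "a' ! s = x" using le[OF s(1,2)] no by (metis le_neq_implies_less)
        then show False using \<open>x \<notin> set a'\<close> nth_mem[of s a'] s len by simp
      qed
    qed
    then show False using ne card card_subset_eq[of "set a'" "set a"] by simp
  qed
qed

text \<open>Formed with minors of the generic matrix, although independence is known on triangular
  ones: the relations must lie in \<open>plucker_ideal\<close> and must admit evaluation at other
  matrices.\<close>

definition pair_span :: "(nat list \<times> nat list) set \<Rightarrow> (nat \<times> nat) cpoly set" where
  "pair_span T = {p. \<exists>c. p = (\<Sum>x\<in>T. pconst (c x) * (cdet pvar (fst x) * cdet pvar (snd x)))}"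

lemma pair_span_0: "0 \<in> pair_span T"
  unfolding pair_span_def by (auto intro!: exI[of _ "\<lambda>_. 0"])

lemma pair_span_add:
  assumes "p \<in> pair_span T" "q \<in> pair_span T" shows "p + q \<in> pair_span T"
proof -
  obtain c d where "p = (\<Sum>x\<in>T. pconst (c x) * (cdet pvar (fst x) * cdet pvar (snd x)))"
    "q = (\<Sum>x\<in>T. pconst (d x) * (cdet pvar (fst x) * cdet pvar (snd x)))"
    using assms unfolding pair_span_def by blast
  then have "p + q = (\<Sum>x\<in>T. pconst (c x + d x) * (cdet pvar (fst x) * cdet pvar (snd x)))"
    by (simp add: pconst_add algebra_simps sum.distrib)
  then show ?thesis unfolding pair_span_def by (intro CollectI exI[of _ "\<lambda>x. c x + d x"])
qed

lemma pair_span_sum: "(\<And>i. i \<in> A \<Longrightarrow> f i \<in> pair_span T) \<Longrightarrow> sum f A \<in> pair_span T"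
  by (induction A rule: infinite_finite_induct) (simp_all add: pair_span_0 pair_span_add)

lemma pair_span_scale:
  assumes "p \<in> pair_span T" shows "pconst k * p \<in> pair_span T"
proof -
  obtain c where "p = (\<Sum>x\<in>T. pconst (c x) * (cdet pvar (fst x) * cdet pvar (snd x)))"
    using assms unfolding pair_span_def by blast
  then have "pconst k * p = (\<Sum>x\<in>T. pconst (k * c x) * (cdet pvar (fst x) * cdet pvar (snd x)))"
    by (simp add: pconst_mult sum_distrib_left mult.assoc)
  then show ?thesis unfolding pair_span_def by (intro CollectI exI[of _ "\<lambda>x. k * c x"])
qed

lemma pconst_of_int: "pconst (of_int k) = of_int k"
  unfolding pconst_def by (rule single_of_int)

lemma pair_span_base:
  assumes "finite T" "x \<in> T" shows "cdet pvar (fst x) * cdet pvar (snd x) \<in> pair_span T"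
proof -
  have "(\<Sum>y\<in>T. pconst (if y = x then 1 else 0) * (cdet pvar (fst y) * cdet pvar (snd y)))
      = (\<Sum>y\<in>T. if y = x then cdet pvar (fst x) * cdet pvar (snd x) else 0)"
    by (rule sum.cong) auto
  also have "\<dots> = cdet pvar (fst x) * cdet pvar (snd x)" using assms by simp
  finally have eq: "cdet pvar (fst x) * cdet pvar (snd x) =
    (\<Sum>y\<in>T. pconst (if y = x then 1 else 0) * (cdet pvar (fst y) * cdet pvar (snd y)))" by (rule sym)
  show ?thesis unfolding pair_span_def
    by (intro CollectI exI[of _ "\<lambda>y. if y = x then 1 else 0"]) (rule eq)
qed

text \<open>Both lengths and the joint content are preserved by every exchange. The lengths are
  needed to recognise \<open>odot\<close> and to balance powers of a determinant; the content
  determines one factor from the other.\<close>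

definition pair_class :: "nat \<Rightarrow> nat list \<Rightarrow> nat list \<Rightarrow> (nat list \<times> nat list) set" where
  "pair_class n a b = {(g, h) \<in> standard_pairs n.
     length h = length a \<and> length g = length b \<and> mset g + mset h = mset a + mset b}"

lemma finite_pair_class: "finite (pair_class n a b)"
  by (rule finite_subset[OF _ finite_standard_pairs[of n]]) (unfold pair_class_def, blast)

lemma column_weight_bound:
  assumes "a \<in> pbw_columns n" shows "column_weight n a < (n + 1) ^ n"
proof -
  have "a ! s \<le> n" if "s < length a" for s using pbw_columnsD(2)[OF assms] nth_mem[OF that] by auto
  then have "column_weight n a \<le> (\<Sum>s<length a. n * (n + 1) ^ s)"
    unfolding column_weight_def by (intro sum_mono mult_right_mono) simp_all
  also have "\<dots> < (n + 1) ^ length a" using sum_digits[of n "length a"] by linarith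
  also have "\<dots> \<le> (n + 1) ^ n" using pbw_columnsD(4)[OF assms] by (intro power_increasing) simp_all
  finally show ?thesis .
qed

text \<open>The values that arrive in the longer column are entries of \<open>b\<close> in rows up
  to the violated one. Such an entry is either fixed and at most \<open>r\<close>, or at least
  \<open>b ! r\<close>; hence it is counted by the rank criterion of every row that may lose an
  entry, and \<open>exchange_increases\<close> applies with \<open>v = b ! r\<close>.\<close>

lemma exchange_permutation:
  assumes a: "a \<in> pbw_columns n" and b: "b \<in> pbw_columns n" and lba: "length b \<le> length a"
    and r: "r < length b" and viol: "\<And>s. r \<le> s \<Longrightarrow> s < length a \<Longrightarrow> a ! s < b ! r"
    and p: "p permutes {r..<r + length a + 1}" and not: "\<exists>i<length a. length a \<le> p i"
    and a': "pbw_column a'" "mset a' = mset (take (length a) (permute_list p (a @ b)))"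
  shows "column_weight n a < column_weight n a'"
proof -
  let ?k = "length a" and ?L = "a @ b"
  define xs where "xs = take ?k (permute_list p ?L)"
  have A: "pbw_column a" and Bc: "pbw_column b" using a b pbw_columnsD(1) by blast+
  have pL: "p permutes {..<length ?L}" by (rule permutes_subset[OF p]) (use r in auto)
  have x: "xs ! i = ?L ! p i" if "i < ?k" for i
    using that permute_list_nth[OF pL, of i] unfolding xs_def by simp
  have lx: "length xs = ?k" unfolding xs_def by simp
  have mx: "mset a' = mset xs" unfolding xs_def by (rule a'(2))
  have dx: "distinct xs" using mx a'(1) pbw_distinct mset_eq_imp_distinct_iff by metis
  have sx: "set a' = set xs" using mx by (rule mset_eq_setD)
  have lena': "length a' = ?k" using mset_eq_length[OF mx] lx by simp
  have rk: "r < ?k" using r lba by simp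
  have k1: "r \<le> ?k - 1" "?k - 1 < ?k" using rk by linarith+
  \<comment> \<open>The last row of \<open>a\<close> is among the violated rows and holds at least
    the length of \<open>a\<close>.\<close>
  have vbig: "?k < b ! r" using viol[OF k1] pbw_nth_ge[OF A k1(2)] by linarith
  have pfix: "p i = i" if "i < r" for i using permutes_not_in[OF p, of i] that by simp
  have prange: "p i \<in> {r..<r + ?k + 1}" if "r \<le> i" "i < r + ?k + 1" for i
    using permutes_in_image[OF p, of i] that by simp
  have b_small: "b ! t \<le> r \<or> b ! r \<le> b ! t" if t: "t \<le> r" for t
  proof (cases "t = r \<or> b ! t \<le> length b")
    case True
    have "b ! t \<le> r" if "t \<noteq> r" "b ! t \<le> length b"
      using pbw_nth_eq[OF Bc _ that(2)] that(1) t r by simp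
    then show ?thesis using True by blast
  next
    case False
    then have "t < r" "length b < b ! t" using t by simp_all
    moreover have "length b < b ! r" using vbig lba by linarith
    ultimately show ?thesis using pbw_nth_less[OF Bc, of t r] r by simp
  qed
  have moved: "\<exists>t\<le>r. ?L ! p i = b ! t" if "i < ?k" "?k \<le> p i" for i
  proof -
    have "r \<le> i" using pfix[of i] that by linarith
    then have "p i < r + ?k + 1" using prange[of i] that by simp
    then show ?thesis using that by (intro exI[of _ "p i - ?k"]) (simp add: nth_append)
  qed
  \<comment> \<open>An arrived value cannot already have been an entry of \<open>a\<close>. Above
    the moved rows it would stay in place and be repeated; in one of the moved rows it would lie
    strictly between \<open>r\<close> and \<open>b ! r\<close>, where no arriving value
    lies.\<close>
  have ne: "set a' \<noteq> set a"
  proof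
    assume eq: "set a' = set a"
    obtain i where i: "i < ?k" "?k \<le> p i" using not by blast
    obtain t where t: "t \<le> r" "?L ! p i = b ! t" using moved[OF i] by blast
    have xi: "xs ! i = b ! t" using x[OF i(1)] t by simp
    have "xs ! i \<in> set xs" using i(1) lx by simp
    then have "b ! t \<in> set a" unfolding xi eq[symmetric] sx .
    then obtain s where s: "s < ?k" "a ! s = b ! t" by (metis in_set_conv_nth)
    show False
    proof (cases "s < r")
      case True
      have "xs ! s = a ! s" using x[OF s(1)] pfix[OF True] s(1) by (simp add: nth_append)
      then have "xs ! s = xs ! i" using s xi by simp
      then have "s = i" using nth_eq_iff_index_eq[OF dx, of s i] s(1) i(1) lx by simp
      then show False using pfix[OF True] i by simp
    next
      case False
      then have "b ! t < b ! r" using viol[of s] s by simp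
      moreover have "r < b ! t" using pbw_nth_ge[OF A s(1)] s(2) False by simp
      ultimately show False using b_small[OF t(1)] by simp
    qed
  qed
  have gain: "x \<le> r \<or> b ! r \<le> x" if "x \<in> set a'" "x \<notin> set a" for x
  proof -
    have "x \<in> set xs" using that(1) unfolding sx .
    then obtain i where "i < length xs" "xs ! i = x" unfolding in_set_conv_nth by blast
    then have i: "i < ?k" "xs ! i = x" unfolding lx by simp_all
    have "\<not> p i < ?k"
    proof
      assume "p i < ?k"
      then have "x = a ! p i" using i x[OF i(1)] by (simp add: nth_append)
      then show False using that(2) nth_mem[OF \<open>p i < ?k\<close>] by simp
    qed
    then have "?k \<le> p i" by simp
    from moved[OF i(1) this] obtain t where "t \<le> r" "?L ! p i = b ! t" by blast
    moreover from this have "x = b ! t" using i(2) x[OF i(1)] by simp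
    ultimately show ?thesis using b_small[of t] by simp
  qed
  have loss: "\<exists>s. r \<le> s \<and> s < ?k \<and> a ! s = x" if "x \<in> set a" "x \<notin> set a'" for x
  proof -
    have "x \<in> set a" by (rule that(1))
    then obtain s where s: "s < ?k" "a ! s = x" unfolding in_set_conv_nth by blast
    have "\<not> s < r"
    proof
      assume "s < r"
      have "xs ! s = ?L ! s" using x[OF s(1)] unfolding pfix[OF \<open>s < r\<close>] .
      also have "\<dots> = x" using s by (simp add: nth_append)
      finally have eq: "xs ! s = x" .
      have "xs ! s \<in> set xs" using s(1) lx by simp
      then have "x \<in> set xs" unfolding eq .
      then show False using that(2) unfolding sx by blast
    qed
    then have "r \<le> s" by simp
    then show ?thesis using s(1) s(2) by (intro exI[of _ s] conjI)
  qed
  note inc = exchange_increases[OF A a'(1) lena' viol vbig gain loss ne]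
  obtain s0 where "r \<le> s0" "s0 < ?k" "a ! s0 < a' ! s0" using inc(2) by blast
  then show ?thesis using column_weight_less[OF pbw_columnsD(2)[OF a] lena' inc(1)] by blast
qed

text \<open>Antisymmetrising over \<open>length a + 1\<close> positions gives zero. Permutations
  that do not mix the two columns all return the original product; each of the others gives zero or,
  up to sign, a product whose longer column has greater weight. The weight is bounded by
  \<open>(n + 1) ^ n\<close>, so the straightening terminates.\<close>

lemma standard_pairs_span:
  "a \<in> pbw_columns n \<Longrightarrow> b \<in> pbw_columns n \<Longrightarrow> length b \<le> length a \<Longrightarrow>
    cdet pvar a * cdet pvar b \<in> pair_span (pair_class n a b)"
proof (induction "(n + 1) ^ n - column_weight n a" arbitrary: a b rule: less_induct)
  case less
  note a = less.prems(1) and b = less.prems(2) and lba = less.prems(3)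
  let ?T = "pair_class n a b" and ?k = "length a" and ?L = "a @ b"
  have A: "pbw_column a" and Bc: "pbw_column b" using a b pbw_columnsD(1) by blast+
  show ?case
  proof (cases "dn b \<subseteq> dn a")
    case True
    then have "(b, a) \<in> ?T" unfolding pair_class_def standard_pairs_def using a b by simp
    then show ?thesis using pair_span_base[OF finite_pair_class, of "(b, a)"] by (simp add: mult.commute)
  next
    case False
    then obtain r where r: "r < length b" "\<forall>s. r \<le> s \<and> s < ?k \<longrightarrow> \<not> b ! r \<le> a ! s"
      using pbw_pair_iff_dn[OF A Bc] A Bc lba unfolding pbw_pair_def by blast
    have viol: "a ! s < b ! r" if "r \<le> s" "s < ?k" for s using r(2) that by auto
    \<comment> \<open>In \<open>a @ b\<close> these are the \<open>length a - r\<close> positions of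
      \<open>a\<close> from the violated row on and the first \<open>r + 1\<close> positions of
      \<open>b\<close>, one more than the number of available rows.\<close>
    let ?B = "{r..<r + ?k + 1}"
    let ?P = "{p. p permutes ?B}" and ?f = "\<lambda>p. of_int (sign p) * cdet2 ?k pvar (permute_list p ?L)"
    define Q where "Q = {p \<in> ?P. \<forall>i<?k. p i < ?k}"
    have fin: "finite ?P" by (rule finite_permutations) simp
    have sub: "?B \<subseteq> {..<length ?L}" using r(1) by auto
    have sum0: "sum ?f ?P = 0"
      by (rule pluecker_relation) (use sub lba in auto)
    have FL: "cdet2 ?k pvar ?L = cdet pvar a * cdet pvar b" by (simp add: cdet2_def)
    \<comment> \<open>A permutation that keeps the columns apart acts on the product by its sign,
      and this cancels against the sign in front.\<close>
    have fQ: "?f p = cdet2 ?k pvar ?L" if p: "p \<in> Q" for p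
    proof -
      have pP: "p permutes {..<length ?L}" using p permutes_subset[OF _ sub] unfolding Q_def by blast
      have "p ` {..<?k} \<subseteq> {..<?k}" using p unfolding Q_def by auto
      moreover have "inj_on p {..<?k}" using pP permutes_inj_on by blast
      ultimately have im: "p ` {..<?k} = {..<?k}" by (simp add: endo_inj_surj)
      have inv: "p j < ?k \<longleftrightarrow> j < ?k" for j
      proof
        assume "p j < ?k"
        then obtain i where "i < ?k" "p i = p j" using im by (metis (no_types, lifting) imageE lessThan_iff)
        then show "j < ?k" using permutes_inj[OF pP] by (auto dest: injD)
      qed (use p in \<open>auto simp: Q_def\<close>)
      have "cdet2 ?k pvar (permute_list p ?L) = of_int (sign p) * cdet2 ?k pvar ?L"
        by (rule cdet2_permute_list) (use pP inv in auto)
      moreover have "of_int (sign p) * (of_int (sign p) * x) = x" for x :: "(nat \<times> nat) cpoly"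
        by (simp flip: mult.assoc of_int_mult)
      ultimately show ?thesis by simp
    qed
    have fR: "?f p \<in> pair_span ?T" if p: "p \<in> ?P - Q" for p
    proof -
      let ?x = "take ?k (permute_list p ?L)" and ?y = "drop ?k (permute_list p ?L)"
      have pB: "p permutes ?B" and not: "\<exists>i<?k. ?k \<le> p i" using p unfolding Q_def by (auto simp: not_less)
      have pP: "p permutes {..<length ?L}" using permutes_subset[OF pB sub] .
      have m: "mset ?x + mset ?y = mset a + mset b"
        using mset_permute_list[OF pP] by (metis append_take_drop_id mset_append)
      have "cdet2 ?k pvar (permute_list p ?L) \<in> pair_span ?T"
      proof (cases "distinct ?x \<and> distinct ?y")
        case False
        then have "cdet2 ?k pvar (permute_list p ?L) = 0"
          unfolding cdet2_def using cdet_not_distinct by (metis mult_zero_left mult_zero_right)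
        then show ?thesis by (simp add: pair_span_0)
      next
        case True
        have "set_mset (mset ?x + mset ?y) = set_mset (mset a + mset b)" unfolding m ..
        then have set: "set ?x \<union> set ?y = set a \<union> set b" by simp
        then have sx: "set ?x \<subseteq> {1..n}" "set ?y \<subseteq> {1..n}" using pbw_columnsD(2)[OF a] pbw_columnsD(2)[OF b] by blast+
        obtain a' where a': "pbw_column a'" "set a' = set ?x" using ex_pbw_column[of "set ?x"] sx by fastforce
        obtain b' where b': "pbw_column b'" "set b' = set ?y" using ex_pbw_column[of "set ?y"] sx by fastforce
        have ma: "mset a' = mset ?x" "mset b' = mset ?y"
          using a' b' True pbw_distinct set_eq_iff_mset_eq_distinct by blast+
        have len: "length a' = ?k" "length b' = length b"
          using mset_eq_length[OF ma(1)] mset_eq_length[OF ma(2)] by simp_all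
        have in': "a' \<in> pbw_columns n" "b' \<in> pbw_columns n"
          using a' b' sx len pbw_columnsD(3,4)[OF a] pbw_columnsD(3,4)[OF b] unfolding pbw_columns_def by simp_all
        have w: "column_weight n a < column_weight n a'"
          by (rule exchange_permutation[OF a b lba r(1) viol pB not a'(1) ma(1)])
        have "(n + 1) ^ n - column_weight n a' < (n + 1) ^ n - column_weight n a"
          using w column_weight_bound[OF a] by linarith
        then have IH: "cdet pvar a' * cdet pvar b' \<in> pair_span (pair_class n a' b')"
          by (rule less.hyps[OF _ in']) (use len lba in simp)
        have cl: "pair_class n a' b' = ?T" unfolding pair_class_def len ma m ..
        obtain e1 where e1: "cdet pvar ?x = of_int e1 * cdet pvar a'" using cdet_mset[OF ma(1)[THEN sym]] by blast
        obtain e2 where e2: "cdet pvar ?y = of_int e2 * cdet pvar b'" using cdet_mset[OF ma(2)[THEN sym]] by blast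
        have "cdet2 ?k pvar (permute_list p ?L) = pconst (of_int (e1 * e2)) * (cdet pvar a' * cdet pvar b')"
          unfolding cdet2_def e1 e2 pconst_of_int by (simp add: algebra_simps)
        then show ?thesis using pair_span_scale[OF IH] unfolding cl by simp
      qed
      from pair_span_scale[OF this, of "of_int (sign p)"] show ?thesis unfolding pconst_of_int .
    qed
    have Qsub: "Q \<subseteq> ?P" unfolding Q_def by blast
    \<comment> \<open>The unmixed terms add up to \<open>card Q\<close> copies of the original
      product. The identity makes this number nonzero, so it can be inverted over the complex
      numbers.\<close>
    have "id \<in> Q" unfolding Q_def by (simp add: permutes_id)
    then have card: "card Q \<noteq> 0" using finite_subset[OF Qsub fin] by auto
    have "sum ?f ?P = sum ?f (?P - Q) + sum ?f Q" by (rule sum.subset_diff[OF Qsub fin])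
    also have "sum ?f Q = of_nat (card Q) * (cdet pvar a * cdet pvar b)" using fQ FL by simp
    finally have "of_nat (card Q) * (cdet pvar a * cdet pvar b) = - sum ?f (?P - Q)"
      using sum0 by (simp add: add_eq_0_iff)
    then have "pconst (inverse (of_nat (card Q))) * (pconst (of_nat (card Q)) * (cdet pvar a * cdet pvar b))
        = pconst (inverse (of_nat (card Q))) * (pconst (- 1) * sum ?f (?P - Q))"
      by (simp add: pconst_def single_uminus)
    then have "cdet pvar a * cdet pvar b = pconst (inverse (of_nat (card Q))) * (pconst (- 1) * sum ?f (?P - Q))"
      using card by (simp flip: mult.assoc pconst_mult)
    moreover have "sum ?f (?P - Q) \<in> pair_span ?T" by (rule pair_span_sum) (rule fR)
    ultimately show ?thesis by (simp only:) (intro pair_span_scale)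
  qed
qed

section \<open>Complementary minors\<close>

lemma sum_nth_mset:
  assumes "mset xs = mset [1..<n + 1]"
  shows "(\<Sum>s<n. f (xs ! s)) = (\<Sum>i<n. f (i + 1) :: 'a :: comm_monoid_add)"
proof -
  have len: "length xs = n" using mset_eq_length[OF assms] by simp
  have "(\<Sum>s<n. f (xs ! s)) = sum_list (map f xs)"
    by (simp add: sum_list_sum_nth len atLeast0LessThan)
  also have "\<dots> = sum_list (map f [1..<n + 1])"
    using assms by (metis mset_map sum_mset_sum_list)
  also have "\<dots> = (\<Sum>i<n. f (i + 1))"
    by (simp add: sum_list_sum_nth atLeast0LessThan del: upt_Suc)
  finally show ?thesis .
qed

text \<open>
  Jacobi's identity for complementary minors: the rows of \<open>y\<close> are the rows of the transposed
  adjugate of \<open>w\<close> in reverse order. Both sides compute the determinant of the product of \<open>w\<close>,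
  transposed, with the matrix formed by \<open>length \<beta>\<close> unit rows and \<open>length \<alpha>\<close> rows of \<open>y\<close>.
\<close>

lemma complementary_minors:
  fixes w :: "nat \<times> nat \<Rightarrow> 'a :: idom"
  obtains y :: "nat \<times> nat \<Rightarrow> 'a" where
    "\<And>\<alpha> \<beta>. mset (\<alpha> @ \<beta>) = mset [1..<n + 1] \<Longrightarrow>
      \<exists>e\<in>{1, - 1 :: int}. cdet y \<alpha> * cdet w [1..<n + 1] =
        of_int e * (cdet w [1..<n + 1] ^ length \<alpha> * cdet w \<beta>)"
proof -
  define W where "W = mat n n (\<lambda>(i, j). w (i + 1, j + 1))"
  \<comment> \<open>Rows are reversed: the top \<open>k\<close> rows of \<open>y\<close> are
    cofactors of the bottom \<open>k\<close> rows of \<open>w\<close>, so they complement the top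
    \<open>n - k\<close> rows that enter \<open>cdet w \<beta>\<close>. The argument
    \<open>i\<close> counts from 1, the cofactor indices from 0.\<close>
  define y where "y = (\<lambda>(r, i). cofactor W (n - r) (i - 1))"
  define \<delta> where "\<delta> = cdet w [1..<n + 1]"
  have W: "W \<in> carrier_mat n n" unfolding W_def by simp
  have "mat n n (\<lambda>(r, s). w (r + 1, [1..<n + 1] ! s)) = W"
    unfolding W_def by (rule eq_matI) (simp_all del: upt_Suc)
  then have detW: "det W = \<delta>" unfolding \<delta>_def cdet_def by (simp del: upt_Suc)
  have orth: "(\<Sum>i<n. y (n - q, i + 1) * w (t + 1, i + 1)) = (if t = q then \<delta> else 0)"
    if "q < n" "t < n" for q t
  proof -
    have "(W * adj_mat W) $$ (t, q) = (\<Sum>i<n. w (t + 1, i + 1) * cofactor W q i)"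
      using that W adj_mat(1)[OF W]
      by (simp add: scalar_prod_def adj_mat_def W_def atLeast0LessThan)
    moreover have "(W * adj_mat W) $$ (t, q) = (if t = q then \<delta> else 0)"
      unfolding adj_mat(2)[OF W] detW using that by simp
    moreover have "y (n - q, i + 1) = cofactor W q i" for i using that unfolding y_def by simp
    ultimately show ?thesis by (simp add: mult.commute)
  qed
  have main: "\<exists>e\<in>{1, - 1 :: int}. cdet y \<alpha> * \<delta> = of_int e * (\<delta> ^ length \<alpha> * cdet w \<beta>)"
    if mset: "mset (\<alpha> @ \<beta>) = mset [1..<n + 1]" for \<alpha> \<beta>
  proof -
    let ?k = "length \<alpha>" and ?m = "length \<beta>" and ?\<gamma> = "\<beta> @ \<alpha>"
    have m\<gamma>: "mset ?\<gamma> = mset [1..<n + 1]" using mset by (simp add: union_commute del: upt_Suc)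
    have n: "n = ?m + ?k" using mset_eq_length[OF mset] by (simp del: upt_Suc)
    define D where "D = mat ?k ?k (\<lambda>(q, s). y (?k - q, \<alpha> ! s))"
    define C where "C = mat ?k ?m (\<lambda>(q, s). y (?k - q, \<beta> ! s))"
    define M where "M = four_block_mat (1\<^sub>m ?m) (0\<^sub>m ?m ?k) C D"
    define V where "V = mat n n (\<lambda>(s, t). w (t + 1, ?\<gamma> ! s))"
    define A where "A = mat ?m ?m (\<lambda>(q, t). w (t + 1, \<beta> ! q))"
    define B where "B = mat ?m ?k (\<lambda>(q, t). w (?m + t + 1, \<beta> ! q))"
    have carr: "D \<in> carrier_mat ?k ?k" "C \<in> carrier_mat ?k ?m" "M \<in> carrier_mat n n"
      "V \<in> carrier_mat n n" "A \<in> carrier_mat ?m ?m" "B \<in> carrier_mat ?m ?k"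
      unfolding D_def C_def M_def V_def A_def B_def n by simp_all
    have Mnth: "M $$ (q, s) = (if q < ?m then (if s = q then 1 else 0) else y (n - q, ?\<gamma> ! s))"
      if "q < n" "s < n" for q s
    proof -
      have "?k - (q - ?m) = n - q" if "?m \<le> q" using that n by simp
      then show ?thesis using that unfolding M_def C_def D_def n
        by (cases "q < ?m"; cases "s < ?m") (auto simp: nth_append)
    qed
    \<comment> \<open>The unit rows of \<open>M\<close> copy the first rows of \<open>V\<close>. The
      other rows consist of cofactors and are orthogonal to every row of \<open>w\<close> except the
      one they came from, where the value is the determinant. The product is thus block
      triangular.\<close>
    have "M * V = four_block_mat A B (0\<^sub>m ?k ?m) (\<delta> \<cdot>\<^sub>m 1\<^sub>m ?k)"
    proof (rule eq_matI)
      fix q t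
      assume "q < dim_row (four_block_mat A B (0\<^sub>m ?k ?m) (\<delta> \<cdot>\<^sub>m 1\<^sub>m ?k))"
        "t < dim_col (four_block_mat A B (0\<^sub>m ?k ?m) (\<delta> \<cdot>\<^sub>m 1\<^sub>m ?k))"
      then have qt: "q < n" "t < n" using carr n by simp_all
      have "(M * V) $$ (q, t) = (\<Sum>s<n. M $$ (q, s) * w (t + 1, ?\<gamma> ! s))"
        using qt carr(3,4) by (simp add: scalar_prod_def V_def atLeast0LessThan)
      also have "\<dots> = four_block_mat A B (0\<^sub>m ?k ?m) (\<delta> \<cdot>\<^sub>m 1\<^sub>m ?k) $$ (q, t)"
      proof (cases "q < ?m")
        case True
        have "(\<Sum>s<n. M $$ (q, s) * w (t + 1, ?\<gamma> ! s)) = (\<Sum>s<n. if s = q then w (t + 1, ?\<gamma> ! q) else 0)"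
          using Mnth qt(1) True by (intro sum.cong) auto
        also have "\<dots> = w (t + 1, \<beta> ! q)" using qt True by (simp add: nth_append)
        finally show ?thesis using True qt n unfolding A_def B_def by simp
      next
        case False
        have "(\<Sum>s<n. M $$ (q, s) * w (t + 1, ?\<gamma> ! s)) = (\<Sum>s<n. y (n - q, ?\<gamma> ! s) * w (t + 1, ?\<gamma> ! s))"
          using Mnth qt(1) False by (intro sum.cong) auto
        also have "\<dots> = (\<Sum>i<n. y (n - q, i + 1) * w (t + 1, i + 1))" by (rule sum_nth_mset[OF m\<gamma>])
        also have "\<dots> = (if t = q then \<delta> else 0)" by (rule orth[OF qt])
        finally show ?thesis using False qt n carr(5,6) by auto
      qed
      finally show "(M * V) $$ (q, t) = four_block_mat A B (0\<^sub>m ?k ?m) (\<delta> \<cdot>\<^sub>m 1\<^sub>m ?k) $$ (q, t)" .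
    qed (use carr n in simp_all)
    then have "det M * det V = det (four_block_mat A B (0\<^sub>m ?k ?m) (\<delta> \<cdot>\<^sub>m 1\<^sub>m ?k))"
      using det_mult[OF carr(3,4)] by simp
    also have "\<dots> = det A * det (\<delta> \<cdot>\<^sub>m 1\<^sub>m ?k)"
      by (rule det_four_block_mat_lower_left_zero[OF carr(5,6) refl]) simp
    also have "det (\<delta> \<cdot>\<^sub>m 1\<^sub>m ?k) = \<delta> ^ ?k" by simp
    also have "det A = cdet w \<beta>"
    proof -
      let ?A = "mat ?m ?m (\<lambda>(r, s). w (r + 1, \<beta> ! s))"
      have "A = transpose_mat ?A" unfolding A_def by (rule eq_matI) simp_all
      then show ?thesis using det_transpose[of ?A ?m] unfolding cdet_def by simp
    qed
    finally have prod: "det M * det V = cdet w \<beta> * \<delta> ^ ?k" .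
    have "det M = det (1\<^sub>m ?m) * det D" unfolding M_def
      by (rule det_four_block_mat_upper_right_zero[OF _ refl carr(2,1)]) simp
    then have detM: "det M = det D" by simp
    obtain e2 where e2: "e2 \<in> {1, - 1 :: int}" "\<And>z. cdet z ?\<gamma> = of_int e2 * (cdet z [1..<n + 1] :: 'a)"
      using cdet_mset[OF m\<gamma>] by blast
    have detV: "det V = of_int e2 * \<delta>"
    proof -
      let ?V = "mat n n (\<lambda>(r, s). w (r + 1, ?\<gamma> ! s))"
      have "V = transpose_mat ?V" unfolding V_def by (rule eq_matI) simp_all
      then have "det V = det ?V" using det_transpose[of ?V n] by simp
      also have "\<dots> = cdet w ?\<gamma>" unfolding cdet_def using n by simp
      finally show ?thesis unfolding e2(2) \<delta>_def .
    qed
    \<comment> \<open>\<open>D\<close> lists the rows of \<open>y\<close> from \<open>k\<close>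
      upwards to the top; reversing them costs only a sign, which is absorbed in the result.\<close>
    define p where "p i = (if i < ?k then ?k - 1 - i else i)" for i
    have p: "p permutes {0..<?k}"
    proof (rule bij_imp_permutes)
      show "bij_betw p {0..<?k} {0..<?k}"
        by (rule bij_betw_byWitness[of _ p]) (auto simp: p_def)
    qed (simp add: p_def)
    let ?Y = "mat ?k ?k (\<lambda>(r, s). y (r + 1, \<alpha> ! s))"
    have "D = mat ?k ?k (\<lambda>(i, j). ?Y $$ (p i, j))"
    proof (rule eq_matI)
      fix i j assume "i < dim_row (mat ?k ?k (\<lambda>(i, j). ?Y $$ (p i, j)))" "j < dim_col (mat ?k ?k (\<lambda>(i, j). ?Y $$ (p i, j)))"
      then have ij: "i < ?k" "j < ?k" by simp_all
      then have "p i < ?k" "p i + 1 = ?k - i" unfolding p_def by auto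
      then show "D $$ (i, j) = mat ?k ?k (\<lambda>(i, j). ?Y $$ (p i, j)) $$ (i, j)"
        using ij unfolding D_def by simp
    qed (simp_all add: D_def)
    then have detD: "det D = of_int (sign p) * cdet y \<alpha>"
      using det_permute_rows[OF _ p, of ?Y] unfolding cdet_def by simp
    have "of_int (sign p) * (of_int e2 * (cdet y \<alpha> * \<delta>)) = \<delta> ^ ?k * cdet w \<beta>"
      using prod unfolding detM detD detV by (simp add: algebra_simps)
    then have "of_int (sign p * e2) * (of_int (sign p * e2) * (cdet y \<alpha> * \<delta>)) = of_int (sign p * e2) * (\<delta> ^ ?k * cdet w \<beta>)"
      by (simp add: mult.assoc)
    moreover have sq: "(sign p * e2) * (sign p * e2) = 1" "sign p * e2 \<in> {1, - 1}"
      using e2(1) by (auto simp: sign_def)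
    moreover have "of_int (sign p * e2) * (of_int (sign p * e2) * x) = x" for x :: 'a
      using sq(1) by (metis mult.assoc mult_1 of_int_1 of_int_mult)
    ultimately show ?thesis by metis
  qed
  show thesis
  proof (rule that)
    fix \<alpha> \<beta> :: "nat list"
    assume "mset (\<alpha> @ \<beta>) = mset [1..<n + 1]"
    then show "\<exists>e\<in>{1, - 1 :: int}. cdet y \<alpha> * cdet w [1..<n + 1] =
        of_int e * (cdet w [1..<n + 1] ^ length \<alpha> * cdet w \<beta>)"
      using main unfolding \<delta>_def by blast
  qed
qed

text \<open>The column \<open>1, ..., n\<close> is itself PBW, so its minor has a leading term. This
  permits the cancellation of determinant powers in \<open>expansion_lower_bound\<close>.\<close>

lemma cdet_zres_triangle_neq_0: "cdet (zres triangle) [1..<n + 1] \<noteq> 0"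
proof -
  have "pbw_column [1..<n + 1]" unfolding pbw_column_def by (auto simp del: upt_Suc)
  then have "leads (cmon [1..<n + 1]) (cdet (zres triangle) [1..<n + 1])"
    by (rule leads_cdet_zres[OF staircase_down_full _ dn_subset_triangle])
  then show ?thesis using leads_lookup(1) by fastforce
qed

lemma cdet_cong: "(\<And>r s. r < length c \<Longrightarrow> s < length c \<Longrightarrow> z (r + 1, c ! s) = z' (r + 1, c' ! s)) \<Longrightarrow>
    length c' = length c \<Longrightarrow> cdet z c = cdet z' c'"
  unfolding cdet_def by (intro arg_cong[where f = det] eq_matI) simp_all

text \<open>Relabelling the columns of the cofactor matrix by \<open>flip_index\<close> makes the
  complement of the relabelled column equal to the set of entries of
  \<open>dual_column\<close>.\<close>

lemma complementary_columns:
  obtains z :: "nat \<times> nat \<Rightarrow> (nat \<times> nat) cpoly" and e :: "nat list \<Rightarrow> int" where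
    "\<And>c. c \<in> pbw_columns n \<Longrightarrow> e c \<in> {1, - 1}"
    "\<And>c. c \<in> pbw_columns n \<Longrightarrow> cdet z c * cdet (zres triangle) [1..<n + 1] =
       of_int (e c) * (cdet (zres triangle) [1..<n + 1] ^ length c * cdet (zres triangle) (dual_column n c))"
proof -
  let ?w = "zres triangle"
  obtain y :: "nat \<times> nat \<Rightarrow> (nat \<times> nat) cpoly" where y:
    "\<And>\<alpha> \<beta>. mset (\<alpha> @ \<beta>) = mset [1..<n + 1] \<Longrightarrow>
      \<exists>e\<in>{1, - 1 :: int}. cdet y \<alpha> * cdet ?w [1..<n + 1] =
        of_int e * (cdet ?w [1..<n + 1] ^ length \<alpha> * cdet ?w \<beta>)"
    by (rule complementary_minors[of n ?w]) blast
  define z where "z = (\<lambda>(r, i). y (r, flip_index n i))"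
  have "\<forall>c\<in>pbw_columns n. \<exists>e. e \<in> {1, - 1 :: int} \<and> cdet z c * cdet ?w [1..<n + 1] =
       of_int e * (cdet ?w [1..<n + 1] ^ length c * cdet ?w (dual_column n c))"
  proof
    fix c assume c: "c \<in> pbw_columns n"
    let ?a = "map (flip_index n) c" and ?b = "dual_column n c"
    have "set ?a = flip_index n ` set c" by simp
    moreover have "flip_index n ` {1..n} = {1..n}"
    proof
      show "flip_index n ` {1..n} \<subseteq> {1..n}" by (auto simp: flip_index_def)
      show "{1..n} \<subseteq> flip_index n ` {1..n}"
      proof
        fix i assume "i \<in> {1..n}"
        then have "i = flip_index n (flip_index n i)" "flip_index n i \<in> {1..n}"
          using flip_index_range[of i n] by auto
        then show "i \<in> flip_index n ` {1..n}" by blast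
      qed
    qed
    ultimately have set: "set (?a @ ?b) = {1..n}"
      using set_dual_column[OF c] pbw_columnsD(2)[OF c] by (simp flip: image_Un add: Un_absorb1)
    have "distinct (?a @ ?b)"
    proof (rule card_distinct)
      have "card (set (?a @ ?b)) = n" unfolding set by simp
      also have "n = length (?a @ ?b)" using length_dual_column[OF c] pbw_columnsD(4)[OF c] by simp
      finally show "card (set (?a @ ?b)) = length (?a @ ?b)" .
    qed
    moreover have "set (?a @ ?b) = set [1..<n + 1]" unfolding set by auto
    ultimately have "mset (?a @ ?b) = mset [1..<n + 1]"
      using set_eq_iff_mset_eq_distinct[of "?a @ ?b" "[1..<n + 1]"] by (simp del: upt_Suc)
    from y[OF this] obtain e where "e \<in> {1, - 1 :: int}" "cdet y ?a * cdet ?w [1..<n + 1] =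
        of_int e * (cdet ?w [1..<n + 1] ^ length ?a * cdet ?w ?b)" by blast
    moreover have "cdet z c = cdet y ?a" by (rule cdet_cong) (simp_all add: z_def)
    ultimately show "\<exists>e. e \<in> {1, - 1 :: int} \<and> cdet z c * cdet ?w [1..<n + 1] =
       of_int e * (cdet ?w [1..<n + 1] ^ length c * cdet ?w ?b)" by (intro exI[of _ e]) simp
  qed
  from bchoice[OF this] obtain e where "\<forall>c\<in>pbw_columns n. e c \<in> {1, - 1 :: int} \<and> cdet z c * cdet ?w [1..<n + 1] =
       of_int (e c) * (cdet ?w [1..<n + 1] ^ length c * cdet ?w (dual_column n c))" by blast
  then show thesis using that[of e z] by blast
qed

lemma dual_column_inj:
  assumes c: "c \<in> pbw_columns n" and d: "d \<in> pbw_columns n" and eq: "dual_column n c = dual_column n d"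
  shows "c = d"
proof -
  have "dn c \<subseteq> dn d" "dn d \<subseteq> dn c"
    using dn_dual_column_subset_iff[OF c d] dn_dual_column_subset_iff[OF d c] unfolding eq by simp_all
  then show ?thesis using dn_inj[OF pbw_columnsD(1)[OF c] pbw_columnsD(1)[OF d]] by simp
qed

text \<open>The expansion holds for every matrix, in particular for the one of
  \<open>complementary_columns\<close>. All terms carry the same power of the triangular
  determinant; after cancelling it, an expansion into dual columns remains in which the dual of
  \<open>g\<close> is the larger factor, so \<open>expansion_upper_bound\<close> applies to
  it.\<close>

lemma expansion_lower_bound:
  assumes ab: "a \<in> pbw_columns n" "b \<in> pbw_columns n" and S: "S \<subseteq> pair_class n a b"
    and c: "\<And>x. x \<in> S \<Longrightarrow> c x \<noteq> 0"
    and eq: "cdet pvar a * cdet pvar b = (\<Sum>x\<in>S. pconst (c x) * (cdet pvar (fst x) * cdet pvar (snd x)))"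
    and gh: "(g, h) \<in> S"
  shows "dn g \<subseteq> dn a \<and> dn g \<subseteq> dn b"
proof -
  let ?w = "zres triangle" and ?d = "dual_column n"
  let ?\<delta> = "cdet ?w [1..<n + 1]"
  obtain z :: "nat \<times> nat \<Rightarrow> (nat \<times> nat) cpoly" and e :: "nat list \<Rightarrow> int" where
    e: "\<And>c. c \<in> pbw_columns n \<Longrightarrow> e c \<in> {1, - 1}" and
    z: "\<And>c. c \<in> pbw_columns n \<Longrightarrow> cdet z c * ?\<delta> = of_int (e c) * (?\<delta> ^ length c * cdet ?w (?d c))"
    by (rule complementary_columns[of n]) blast
  have cols: "fst x \<in> pbw_columns n" "snd x \<in> pbw_columns n" "length (snd x) = length a" "length (fst x) = length b"
    "dn (fst x) \<subseteq> dn (snd x)" if "x \<in> S" for x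
    using subsetD[OF S that] unfolding pair_class_def standard_pairs_def by (simp_all add: case_prod_unfold)
  \<comment> \<open>The components are exchanged because duality reverses the order.\<close>
  define \<phi> where "\<phi> x = (?d (snd x), ?d (fst x))" for x :: "nat list \<times> nat list"
  have inj: "inj_on \<phi> S"
  proof (rule inj_onI)
    fix x x' assume x: "x \<in> S" "x' \<in> S" "\<phi> x = \<phi> x'"
    then have "fst x = fst x'" "snd x = snd x'"
      using dual_column_inj[OF cols(1)[OF x(1)] cols(1)[OF x(2)]] dual_column_inj[OF cols(2)[OF x(1)] cols(2)[OF x(2)]]
      unfolding \<phi>_def by simp_all
    then show "x = x'" by (simp add: prod_eq_iff)
  qed
  define c' where "c' x = c x * of_int (e a * e b * e (fst x) * e (snd x))" for x
  have key: "cdet z u * cdet z v * (?\<delta> * ?\<delta>) =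
      ?\<delta> ^ (length u + length v) * (of_int (e u * e v) * (cdet ?w (?d u) * cdet ?w (?d v)))"
    if "u \<in> pbw_columns n" "v \<in> pbw_columns n" for u v
  proof -
    have "cdet z u * cdet z v * (?\<delta> * ?\<delta>) = (cdet z u * ?\<delta>) * (cdet z v * ?\<delta>)" by (simp only: ac_simps)
    then show ?thesis unfolding z[OF that(1)] z[OF that(2)] by (simp add: power_add ac_simps)
  qed
  have "cdet z a * cdet z b = (\<Sum>x\<in>S. pconst (c x) * (cdet z (fst x) * cdet z (snd x)))"
    using arg_cong[OF eq, of "psubst z"] by (simp add: psubst_mult psubst_sum psubst_cdet)
  then have "cdet z a * cdet z b * (?\<delta> * ?\<delta>) =
      (\<Sum>x\<in>S. pconst (c x) * (cdet z (fst x) * cdet z (snd x) * (?\<delta> * ?\<delta>)))"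
    by (simp only: sum_distrib_right mult.assoc)
  also have "\<dots> = (\<Sum>x\<in>S. ?\<delta> ^ (length a + length b) * (pconst (c x) * (of_int (e (fst x) * e (snd x)) *
      (cdet ?w (?d (fst x)) * cdet ?w (?d (snd x))))))"
  proof (rule sum.cong[OF refl])
    fix x assume x: "x \<in> S"
    \<comment> \<open>The power of the determinant depends only on the total length, which
      \<open>pair_class\<close> fixes.\<close>
    have "length (fst x) + length (snd x) = length a + length b" using cols[OF x] by simp
    then show "pconst (c x) * (cdet z (fst x) * cdet z (snd x) * (?\<delta> * ?\<delta>)) =
      ?\<delta> ^ (length a + length b) * (pconst (c x) * (of_int (e (fst x) * e (snd x)) *
      (cdet ?w (?d (fst x)) * cdet ?w (?d (snd x)))))"
      unfolding key[OF cols(1,2)[OF x]] by (simp only: ac_simps)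
  qed
  finally have "?\<delta> ^ (length a + length b) * (of_int (e a * e b) * (cdet ?w (?d a) * cdet ?w (?d b))) =
      ?\<delta> ^ (length a + length b) * (\<Sum>x\<in>S. pconst (c x) * (of_int (e (fst x) * e (snd x)) *
      (cdet ?w (?d (fst x)) * cdet ?w (?d (snd x)))))"
    unfolding key[OF ab] sum_distrib_left .
  then have "of_int (e a * e b) * (cdet ?w (?d a) * cdet ?w (?d b)) =
      (\<Sum>x\<in>S. pconst (c x) * (of_int (e (fst x) * e (snd x)) * (cdet ?w (?d (fst x)) * cdet ?w (?d (snd x)))))"
    using cdet_zres_triangle_neq_0[of n] by simp
  note relation = this
  have square: "of_int (e a * e b) * (of_int (e a * e b) * p) = p" for p :: "(nat \<times> nat) cpoly"
    using e[OF ab(1)] e[OF ab(2)] by auto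
  have "cdet ?w (?d a) * cdet ?w (?d b) =
      of_int (e a * e b) * (of_int (e a * e b) * (cdet ?w (?d a) * cdet ?w (?d b)))"
    by (rule square[symmetric])
  also have "\<dots> = (\<Sum>x\<in>S. of_int (e a * e b) * (pconst (c x) * (of_int (e (fst x) * e (snd x)) * (cdet ?w (?d (fst x)) * cdet ?w (?d (snd x))))))"
    unfolding relation by (rule sum_distrib_left)
  also have "\<dots> = (\<Sum>x\<in>S. pconst (c' x) * (cdet ?w (fst (\<phi> x)) * cdet ?w (snd (\<phi> x))))"
    unfolding c'_def \<phi>_def fst_conv snd_conv pconst_mult pconst_of_int of_int_mult by (simp only: ac_simps)
  also have "\<dots> = (\<Sum>x\<in>S. pconst (c' (inv_into S \<phi> (\<phi> x))) * (cdet ?w (fst (\<phi> x)) * cdet ?w (snd (\<phi> x))))"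
    using inv_into_f_f[OF inj] by simp
  also have "\<dots> = (\<Sum>x\<in>\<phi> ` S. pconst (c' (inv_into S \<phi> x)) * (cdet ?w (fst x) * cdet ?w (snd x)))"
    by (rule sum.reindex[OF inj, unfolded comp_def, symmetric])
  finally have rel: "cdet ?w (?d a) * cdet ?w (?d b) =
      (\<Sum>(g, h)\<in>\<phi> ` S. pconst (c' (inv_into S \<phi> (g, h))) * (cdet ?w g * cdet ?w h))"
    by (simp only: case_prod_unfold prod.collapse)
  have "dn (?d a) \<subseteq> dn (?d g) \<and> dn (?d b) \<subseteq> dn (?d g)"
  proof (rule expansion_upper_bound[OF dual_column_in[OF ab(1)] dual_column_in[OF ab(2)] _ _ rel])
    show "\<phi> ` S \<subseteq> standard_pairs n"
    proof (rule image_subsetI)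
      fix x assume x: "x \<in> S"
      show "\<phi> x \<in> standard_pairs n"
        using dual_column_in[OF cols(1)[OF x]] dual_column_in[OF cols(2)[OF x]] cols(5)[OF x]
          dn_dual_column_subset_iff[OF cols(1,2)[OF x]]
        unfolding standard_pairs_def \<phi>_def by simp
    qed
    show "c' (inv_into S \<phi> x) \<noteq> 0" if x: "x \<in> \<phi> ` S" for x
    proof -
      have y: "inv_into S \<phi> x \<in> S" using inv_into_into[OF x] .
      have "e u \<noteq> 0" if "u \<in> pbw_columns n" for u using e[OF that] by auto
      then show ?thesis using c[OF y] cols(1,2)[OF y] ab unfolding c'_def by simp
    qed
    show "(?d h, ?d g) \<in> \<phi> ` S" using gh unfolding \<phi>_def by force
  qed
  then show ?thesis using dn_dual_column_subset_iff cols(1)[OF gh] ab by simp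
qed

section \<open>The quadratic relations\<close>

text \<open>The cheapest leading monomial on the right cannot be cancelled, so it occurs in
  \<open>p\<close> and costs at least as much as \<open>m\<close>. Conversely \<open>m\<close>
  occurs in some summand and costs at least as much as that summand's leading monomial. Hence the
  two coincide, and comparing coefficients gives 1.\<close>

lemma leads_sum:
  assumes fin: "finite S" and inj: "inj_on M S" and lead: "\<And>i. i \<in> S \<Longrightarrow> leads (M i) (P i)"
    and nz: "\<And>i. i \<in> S \<Longrightarrow> a i \<noteq> 0" and p: "leads m p" "p = (\<Sum>i\<in>S. pconst (a i) * P i)"
  shows "\<exists>i\<in>S. M i = m \<and> a i = 1"
proof -
  have look: "plook p k = (\<Sum>i\<in>S. a i * plook (P i) k)" for k
    unfolding p(2) by (simp add: lookup_sum lookup_pconst_mult)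
  have "\<exists>i\<in>S. plook (P i) m \<noteq> 0"
  proof (rule ccontr)
    assume "\<not> ?thesis"
    then have "plook p m = 0" unfolding look by simp
    then show False using leads_lookup(1)[OF p(1)] by simp
  qed
  then obtain i where i: "i \<in> S" "m \<in> pkeys (P i)" by (auto simp: in_keys_iff)
  obtain j where j: "j \<in> S" "\<And>k. k \<in> S \<Longrightarrow> mcost (M j) \<le> mcost (M k)"
    using ex_has_least_nat[of "\<lambda>i. i \<in> S" i "\<lambda>i. mcost (M i)"] i(1) by blast
  have "plook p (M j) = (\<Sum>k\<in>S. if k = j then a j else 0)"
    unfolding look
  proof (rule sum.cong[OF refl])
    fix k assume k: "k \<in> S"
    show "a k * plook (P k) (M j) = (if k = j then a j else 0)"
    proof (cases "k = j")
      case True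
      then show ?thesis using leads_lookup(1)[OF lead[OF k]] by simp
    next
      case False
      then have "M j \<noteq> M k" using inj j(1) k by (auto dest: inj_onD)
      then have "M j \<notin> pkeys (P k)" using leads_lookup(2)[OF lead[OF k], of "M j"] j(2)[OF k] by auto
      then show ?thesis using False by (simp add: in_keys_iff)
    qed
  qed
  then have pj: "plook p (M j) = a j" using fin j(1) by simp
  then have "M j \<in> pkeys p" using nz[OF j(1)] by (simp add: in_keys_iff)
  then have "M j = m \<or> mcost m < mcost (M j)" by (rule leads_lookup(2)[OF p(1)])
  moreover have "m = M i \<or> mcost (M i) < mcost m" by (rule leads_lookup(2)[OF lead[OF i(1)] i(2)])
  ultimately have "M j = m" using j(2)[OF i(1)] by auto
  then show ?thesis using j(1) pj leads_lookup(1)[OF p(1)] by auto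
qed

section \<open>The sets \<open>K\<close> of order ideals and the operation
  \<open>odot\<close>\<close>

lemma mem_K_diag:
  assumes c: "c \<in> pbw_columns n" and r: "2 \<le> r" "r \<le> n - 1"
  shows "(r, r) \<in> K n (ideal_of c) \<longleftrightarrow> r \<le> length c"
  using dn_diag[OF pbw_columnsD(1)[OF c], of r] r unfolding K_def V_o_def V_c_def ideal_of_def by simp

lemma mem_K_off_diag:
  assumes c: "c \<in> pbw_columns n" and rs: "(r, s) \<in> V_c n"
  shows "(r, s) \<in> K n (ideal_of c) \<longleftrightarrow> plook (cmon c) (r, s) = 1"
proof -
  have r: "1 \<le> r" "r < s" using rs unfolding V_c_def poset_P_def by auto
  have "(r, s) \<in> K n (ideal_of c) \<longleftrightarrow> (r, s) \<in> maximal_elements (ideal_of c)"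
    using rs r(2) unfolding K_def V_o_def by auto
  also have "\<dots> \<longleftrightarrow> 1 \<le> r \<and> r \<le> length c \<and> c ! (r - 1) = s"
  proof
    assume "(r, s) \<in> maximal_elements (ideal_of c)"
    then show "1 \<le> r \<and> r \<le> length c \<and> c ! (r - 1) = s" using maximal_ideal_of[OF c] by simp
  next
    assume *: "1 \<le> r \<and> r \<le> length c \<and> c ! (r - 1) = s"
    then have "r - 1 < length c" "r - 1 + 1 = r" by linarith+
    then show "(r, s) \<in> maximal_elements (ideal_of c)"
      using maximal_ideal_of_big[OF c, of "r - 1"] r(2) * by simp
  qed
  also have "\<dots> \<longleftrightarrow> plook (cmon c) (r, s) = 1" unfolding lookup_cmon by simp
  finally show ?thesis .
qed

text \<open>On \<open>V_o\<close> the set \<open>K\<close> sees only the length, on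
  \<open>V_c\<close> only the diagonal monomial. The equation defining \<open>odot\<close> thereby
  follows from equal lengths and equal leading monomials.\<close>

lemma indicator_K:
  assumes c: "c \<in> pbw_columns n"
  shows "indicator (K n (ideal_of c)) p =
    (if p \<in> V_o n then of_bool (fst p \<le> length c) else if p \<in> V_c n then plook (cmon c) p else (0 :: nat))"
proof -
  obtain r s where p: "p = (r, s)" by (cases p)
  consider "p \<in> V_o n" | "p \<notin> V_o n" "p \<in> V_c n" | "p \<notin> V_o n" "p \<notin> V_c n" by blast
  then show ?thesis
  proof cases
    case 1
    then have "r = s" "2 \<le> r" "r \<le> n - 1" unfolding p V_o_def by auto
    then show ?thesis using 1 mem_K_diag[OF c, of r] unfolding p by (simp add: indicator_def)
  next
    case 2
    have "plook (cmon c) p = 0 \<or> plook (cmon c) p = 1" unfolding p lookup_cmon by simp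
    then show ?thesis using 2 mem_K_off_diag[OF c, of r s] unfolding p by (auto simp: indicator_def)
  next
    case 3
    then have "p \<notin> K n (ideal_of c)" unfolding K_def by blast
    then show ?thesis using 3 by simp
  qed
qed

text \<open>The diagonal part of \<open>K\<close> recovers the length, and the remaining part
  recovers every entry that is not fixed. This is the uniqueness behind the definite description in
  \<open>odot\<close>.\<close>

lemma K_inj:
  assumes c: "c \<in> pbw_columns n" and d: "d \<in> pbw_columns n" and eq: "K n (ideal_of c) = K n (ideal_of d)"
  shows "c = d"
proof -
  have lenle: "length u \<le> length v"
    if "u \<in> pbw_columns n" "v \<in> pbw_columns n" "K n (ideal_of u) = K n (ideal_of v)" for u v
  proof (cases "length u \<ge> 2")
    case True
    then have "(length u, length u) \<in> K n (ideal_of v)"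
      using mem_K_diag[OF that(1) True] pbw_columnsD(4)[OF that(1)] that(3) by simp
    then show ?thesis using mem_K_diag[OF that(2) True] pbw_columnsD(4)[OF that(1)] by simp
  next
    case False
    then show ?thesis using pbw_columnsD(3)[OF that(2)] by simp
  qed
  have len: "length c = length d" using lenle[OF c d eq] lenle[OF d c eq[symmetric]] by simp
  have entry: "v ! s = u ! s"
    if uv: "u \<in> pbw_columns n" "v \<in> pbw_columns n" "K n (ideal_of u) = K n (ideal_of v)" and s: "s < length u" "s + 1 < u ! s" for u v s
  proof -
    have "u ! s \<le> n" using pbw_columnsD(2)[OF uv(1)] nth_mem[OF s(1)] by auto
    then have V: "(s + 1, u ! s) \<in> V_c n" using s(2) unfolding V_c_def poset_P_def by auto
    have "(s + 1, u ! s) \<in> K n (ideal_of u)" using mem_K_off_diag[OF uv(1) V] s(1) unfolding lookup_cmon by simp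
    then have "plook (cmon v) (s + 1, u ! s) = 1" using mem_K_off_diag[OF uv(2) V] uv(3) by simp
    then show ?thesis unfolding lookup_cmon by (simp split: if_splits)
  qed
  show ?thesis
  proof (rule nth_equalityI[OF len])
    fix i assume i: "i < length c"
    consider "i + 1 < c ! i" | "i + 1 < d ! i" | "c ! i \<le> i + 1" "d ! i \<le> i + 1" by linarith
    then show "c ! i = d ! i"
    proof cases
      case 1 then show ?thesis using entry[OF c d eq i] by simp
    next
      case 2 then show ?thesis using entry[OF d c eq[symmetric]] i len by simp
    next
      case 3
      moreover have "i + 1 \<le> c ! i" "i + 1 \<le> d ! i" using pbw_nth_ge pbw_columnsD(1) c d i len by metis+
      ultimately show ?thesis by simp
    qed
  qed
qed

lemma odot_commute: "odot n a b = odot n b a"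
  unfolding odot_def by (simp add: Un_commute add.commute)

lemma odot_eqI:
  assumes n: "n \<ge> 2" and ab: "a \<in> pbw_columns n" "b \<in> pbw_columns n" and gh: "g \<in> pbw_columns n" "h \<in> pbw_columns n"
    and len: "length h = length a" "length g = length b" and mon: "cmon a + cmon b = cmon g + cmon h"
    and h: "dn h = dn a \<union> dn b"
  shows "odot n a b = g"
proof -
  have un: "ideal_of_column n a \<union> ideal_of_column n b = ideal_of h"
    unfolding ideal_of_column_eq[OF n ab(1)] ideal_of_column_eq[OF n ab(2)] using h unfolding ideal_of_def by blast
  let ?P = "\<lambda>J'. J' \<in> order_ideals n \<and>
     (\<forall>p. (indicator (K n (ideal_of_column n a)) p :: nat) + indicator (K n (ideal_of_column n b)) p =
           indicator (K n (ideal_of_column n a \<union> ideal_of_column n b)) p + indicator (K n J') p)"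
  have look: "plook (cmon a) p + plook (cmon b) p = plook (cmon g) p + plook (cmon h) p" for p
    using arg_cong[OF mon, of "\<lambda>m. plook m p"] by (simp add: lookup_add)
  have ind: "(indicator (K n (ideal_of a)) p :: nat) + indicator (K n (ideal_of b)) p =
      indicator (K n (ideal_of h)) p + indicator (K n (ideal_of g)) p" for p
    unfolding indicator_K[OF ab(1)] indicator_K[OF ab(2)] indicator_K[OF gh(1)] indicator_K[OF gh(2)]
    using look[of p] len by simp
  have "(THE J'. ?P J') = ideal_of g"
  proof (rule the_equality)
    show "?P (ideal_of g)"
      unfolding un unfolding ideal_of_column_eq[OF n ab(1)] ideal_of_column_eq[OF n ab(2)]
      using ind ideal_of_order_ideal[OF gh(1)] by blast
  next
    fix J assume J: "?P J"
    then obtain c where c: "c \<in> pbw_columns n" "ideal_of c = J" using order_ideal_cases[OF n] by blast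
    have "(indicator (K n J) p :: nat) = indicator (K n (ideal_of g)) p" for p
      using J ind[of p] unfolding un unfolding ideal_of_column_eq[OF n ab(1)] ideal_of_column_eq[OF n ab(2)]
      by (metis add_left_imp_eq)
    then have "p \<in> K n J \<longleftrightarrow> p \<in> K n (ideal_of g)" for p
      by (metis indicator_simps(1) indicator_simps(2) zero_neq_one)
    then have "K n (ideal_of c) = K n (ideal_of g)" unfolding c(2) by blast
    then show "J = ideal_of g" using K_inj[OF c(1) gh(1)] c(2) by simp
  qed
  then show ?thesis unfolding odot_def using column_of_ideal_of[OF gh(1)] by simp
qed

text \<open>Everything is phrased with \<open>dn\<close> and minors of the generic matrix. The join
  is represented by the column \<open>h\<close>, which is produced by the expansion.\<close>

definition straightening_data ::
  "nat \<Rightarrow> nat list \<Rightarrow> nat list \<Rightarrow> (nat list \<times> nat list) set \<Rightarrow> (nat list \<times> nat list \<Rightarrow> complex) \<Rightarrow> nat list \<Rightarrow> bool" where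
  "straightening_data n a b S c h \<longleftrightarrow> S \<subseteq> standard_pairs n \<and>
    (\<forall>x\<in>S. dn (fst x) \<subset> dn (snd x) \<and> c x \<noteq> 0 \<and> dn (fst x) \<subseteq> dn a \<inter> dn b) \<and>
    (odot n a b, h) \<in> S \<and> c (odot n a b, h) = 1 \<and> dn h = dn a \<union> dn b \<and>
    (\<forall>x\<in>S - {(odot n a b, h)}. dn a \<union> dn b \<subset> dn (snd x)) \<and>
    cdet pvar a * cdet pvar b = (\<Sum>x\<in>S. pconst (c x) * (cdet pvar (fst x) * cdet pvar (snd x)))"

lemma straightening_pairs_aux:
  assumes n: "n \<ge> 2" and ab: "a \<in> pbw_columns n" "b \<in> pbw_columns n" "\<not> dn a \<subseteq> dn b" "\<not> dn b \<subseteq> dn a"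
    and len: "length b \<le> length a"
  shows "\<exists>S c h. straightening_data n a b S c h"
proof -
  let ?w = "zres triangle"
  obtain c where rel0: "cdet pvar a * cdet pvar b =
      (\<Sum>x\<in>pair_class n a b. pconst (c x) * (cdet pvar (fst x) * cdet pvar (snd x)))"
    using standard_pairs_span[OF ab(1,2) len] unfolding pair_span_def by blast
  define S where "S = {x \<in> pair_class n a b. c x \<noteq> 0}"
  have rel: "cdet pvar a * cdet pvar b = (\<Sum>x\<in>S. pconst (c x) * (cdet pvar (fst x) * cdet pvar (snd x)))"
    unfolding rel0 by (rule sum.mono_neutral_right[OF finite_pair_class]) (auto simp: S_def)
  have nz: "c x \<noteq> 0" if "x \<in> S" for x using that unfolding S_def by auto
  have Ssub: "S \<subseteq> pair_class n a b" unfolding S_def by blast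
  have Sstd: "S \<subseteq> standard_pairs n" using Ssub unfolding pair_class_def by blast
  have fin: "finite S" using finite_subset[OF Ssub finite_pair_class] .
  have cls: "fst x \<in> pbw_columns n" "snd x \<in> pbw_columns n" "dn (fst x) \<subseteq> dn (snd x)"
    "length (snd x) = length a" "length (fst x) = length b" "mset (fst x) + mset (snd x) = mset a + mset b"
    if "x \<in> S" for x
    using subsetD[OF Ssub that] unfolding pair_class_def standard_pairs_def by (simp_all add: case_prod_unfold)
  have relw: "cdet ?w a * cdet ?w b = (\<Sum>x\<in>S. pconst (c x) * (cdet ?w (fst x) * cdet ?w (snd x)))"
    using arg_cong[OF rel, of "psubst ?w"] by (simp only: psubst_mult psubst_sum psubst_cdet_pvar psubst_pconst)
  have lead: "leads (cmon u + cmon v) (cdet ?w u * cdet ?w v)" if "u \<in> pbw_columns n" "v \<in> pbw_columns n" for u v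
    using leads_mult[OF leads_cdet_zres[OF staircase_down_full _ dn_subset_triangle] leads_cdet_zres[OF staircase_down_full _ dn_subset_triangle]]
      pbw_columnsD(1) that by blast
  have inj: "inj_on (\<lambda>x. cmon (fst x) + cmon (snd x)) S"
  proof (rule inj_onI)
    fix x y assume x: "x \<in> S" and y: "y \<in> S" and eq: "cmon (fst x) + cmon (snd x) = cmon (fst y) + cmon (snd y)"
    have "[fst x, snd x] = [fst y, snd y]"
      by (rule wmon_inj[of n]) (use cls[OF x] cls[OF y] eq in \<open>simp_all add: chain_word_def wmon_def\<close>)
    then show "x = y" by (simp add: prod_eq_iff)
  qed
  \<comment> \<open>The product on the left has leading coefficient 1, and distinct standard pairs
    have distinct leading monomials, so exactly this monomial is the leading one of some pair, with
    coefficient 1.\<close>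
  obtain x0 where x0: "x0 \<in> S" "cmon (fst x0) + cmon (snd x0) = cmon a + cmon b" "c x0 = 1"
    using leads_sum[OF fin inj lead[OF cls(1,2)] nz lead[OF ab(1,2)] relw] by blast
  define h where "h = snd x0"
  \<comment> \<open>The support of the common monomial determines the union of the ideals of the
    factors. For the standard pair this union is the ideal of its larger column, hence that column
    is the join.\<close>
  have hull: "staircase_hull (pkeys (wmon [fst x0, snd x0])) = staircase_hull (pkeys (wmon [a, b]))"
    using x0(2) by (simp add: wmon_def)
  have h: "dn h = dn a \<union> dn b"
    using hull cls(3)[OF x0(1)] unfolding hull_keys_wmon h_def by auto
  have g: "fst x0 = odot n a b"
    using odot_eqI[OF n ab(1,2) cls(1,2)[OF x0(1)] cls(4,5)[OF x0(1)] x0(2)[symmetric]] h unfolding h_def by simp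
  have x0': "x0 = (odot n a b, h)" using g unfolding h_def by (simp add: prod_eq_iff)
  \<comment> \<open>With equal factors every entry of the content would have multiplicity two. As
    neither \<open>a\<close> nor \<open>b\<close> repeats an entry, both would have the same entries
    and coincide.\<close>
  have strict: "dn (fst x) \<subset> dn (snd x)" if x: "x \<in> S" for x
  proof -
    have "fst x \<noteq> snd x"
    proof
      assume eq: "fst x = snd x"
      have m: "mset a + mset b = mset (fst x) + mset (fst x)" using cls(6)[OF x] eq by simp
      have cnt: "count (mset u) v = of_bool (v \<in> set u)" if "u \<in> pbw_columns n" for u v
        using pbw_columnsD(5)[OF that] by (simp add: distinct_count_atmost_1)
      have "v \<in> set a \<longleftrightarrow> v \<in> set b" for v
        using arg_cong[OF m, of "\<lambda>m. count m v"] cnt[OF ab(1), of v] cnt[OF ab(2), of v] cnt[OF cls(1)[OF x], of v]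
        by (cases "v \<in> set a"; cases "v \<in> set b"; cases "v \<in> set (fst x)") simp_all
      then have "a = b" using pbw_unique[OF pbw_columnsD(1)[OF ab(1)] pbw_columnsD(1)[OF ab(2)]] by blast
      then show False using ab(3) by simp
    qed
    then show ?thesis using cls(3)[OF x] dn_inj[OF pbw_columnsD(1)[OF cls(1)[OF x]] pbw_columnsD(1)[OF cls(2)[OF x]]] by blast
  qed
  have up: "dn a \<union> dn b \<subseteq> dn (snd x)" if x: "x \<in> S" for x
  proof -
    have "dn a \<subseteq> dn (snd x) \<and> dn b \<subseteq> dn (snd x)"
      by (rule expansion_upper_bound[OF ab(1,2) Sstd, of c "fst x"])
        (use nz relw x in \<open>simp_all add: case_prod_unfold\<close>)
    then show ?thesis by blast
  qed
  have low: "dn (fst x) \<subseteq> dn a \<inter> dn b" if x: "x \<in> S" for x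
    using expansion_lower_bound[OF ab(1,2) Ssub nz rel, of "fst x" "snd x"] x by simp
  have "dn a \<union> dn b \<subset> dn (snd x)" if x: "x \<in> S - {(odot n a b, h)}" for x
  proof -
    have xS: "x \<in> S" and ne: "x \<noteq> x0" using x x0' by auto
    have "dn (snd x) \<noteq> dn a \<union> dn b"
    proof
      assume "dn (snd x) = dn a \<union> dn b"
      then have s: "snd x = snd x0"
        using dn_inj[OF pbw_columnsD(1)[OF cls(2)[OF xS]] pbw_columnsD(1)[OF cls(2)[OF x0(1)]]] h unfolding h_def by simp
      have "mset (fst x) + mset (snd x) = mset (fst x0) + mset (snd x0)"
        unfolding cls(6)[OF xS] cls(6)[OF x0(1)] ..
      then have "mset (fst x) = mset (fst x0)" unfolding s by simp
      then have "fst x = fst x0"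
        using pbw_unique[OF pbw_columnsD(1)[OF cls(1)[OF xS]] pbw_columnsD(1)[OF cls(1)[OF x0(1)]]] mset_eq_setD by blast
      then show False using s ne by (simp add: prod_eq_iff)
    qed
    then show ?thesis using up[OF xS] by blast
  qed
  note above = this
  have "(odot n a b, h) \<in> S" "c (odot n a b, h) = 1" using x0(1,3) unfolding x0' by simp_all
  moreover have "\<forall>x\<in>S. dn (fst x) \<subset> dn (snd x) \<and> c x \<noteq> 0 \<and> dn (fst x) \<subseteq> dn a \<inter> dn b"
    using strict nz low by simp
  ultimately have "straightening_data n a b S c h"
    unfolding straightening_data_def using Sstd h rel above by simp
  then show ?thesis by (intro exI)
qed

lemma straightening_data_commute: "straightening_data n a b S c h \<longleftrightarrow> straightening_data n b a S c h"
  unfolding straightening_data_def odot_commute[of n b a] Un_commute[of "dn b" "dn a"] Int_commute[of "dn b" "dn a"]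
    mult.commute[of "cdet pvar b" "cdet pvar a"] ..

lemma ex_straightening_data:
  assumes n: "n \<ge> 2" and inc: "incomparable (pbw_lattice n) a b"
  obtains S c h where "straightening_data n a b S c h"
proof -
  have ab: "a \<in> pbw_columns n" "b \<in> pbw_columns n" "\<not> dn a \<subseteq> dn b" "\<not> dn b \<subseteq> dn a"
    using inc unfolding incomparable_pbw_lattice by simp_all
  show thesis
  proof (cases "length b \<le> length a")
    case True
    then show thesis using straightening_pairs_aux[OF n ab] that by blast
  next
    case False
    then show thesis using straightening_pairs_aux[OF n ab(2,1,4,3)] that straightening_data_commute[of n a b]
      by (metis nat_le_linear)
  qed
qed

section \<open>The ideal of relations\<close>

lemma plucker_ring_simps [simp]:
  "x \<otimes>\<^bsub>plucker_ring n\<^esub> y = x * y" "x \<oplus>\<^bsub>plucker_ring n\<^esub> y = x + y"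
  "\<one>\<^bsub>plucker_ring n\<^esub> = 1" "\<zero>\<^bsub>plucker_ring n\<^esub> = 0"
  by (simp_all add: plucker_ring_def ring_of_type_algebra_def)

lemma carrier_plucker_ring:
  "p \<in> carrier (plucker_ring n) \<longleftrightarrow> (\<forall>m\<in>pkeys p. pkeys m \<subseteq> plucker_indices n)"
  by (simp add: plucker_ring_def)

lemma plucker_ring_0: "0 \<in> carrier (plucker_ring n)"
  by (simp add: carrier_plucker_ring)

lemma plucker_ring_add:
  "p \<in> carrier (plucker_ring n) \<Longrightarrow> q \<in> carrier (plucker_ring n) \<Longrightarrow> p + q \<in> carrier (plucker_ring n)"
  using Poly_Mapping.keys_add[of p q] unfolding carrier_plucker_ring by blast

lemma plucker_ring_uminus: "p \<in> carrier (plucker_ring n) \<Longrightarrow> - p \<in> carrier (plucker_ring n)"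
  unfolding carrier_plucker_ring by (simp add: in_keys_iff)

lemma plucker_ring_diff:
  "p \<in> carrier (plucker_ring n) \<Longrightarrow> q \<in> carrier (plucker_ring n) \<Longrightarrow> p - q \<in> carrier (plucker_ring n)"
  using plucker_ring_add[of p n "- q"] plucker_ring_uminus[of q n] by simp

lemma plucker_ring_mult:
  assumes "p \<in> carrier (plucker_ring n)" "q \<in> carrier (plucker_ring n)"
  shows "p * q \<in> carrier (plucker_ring n)"
  unfolding carrier_plucker_ring
proof
  fix m assume "m \<in> pkeys (p * q)"
  then obtain u v where uv: "u \<in> pkeys p" "v \<in> pkeys q" "m = u + v" by (rule keys_multE)
  then show "pkeys m \<subseteq> plucker_indices n"
    using assms unfolding carrier_plucker_ring uv(3) keys_add_nat by blast
qed

lemma plucker_ring_pconst: "pconst c \<in> carrier (plucker_ring n)"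
  unfolding carrier_plucker_ring pconst_def by simp

lemma plucker_ring_1: "1 \<in> carrier (plucker_ring n)"
  using plucker_ring_pconst[of 1 n] by simp

lemma plucker_ring_of_int: "of_int k \<in> carrier (plucker_ring n)"
  using plucker_ring_pconst[of "of_int k" n] unfolding pconst_of_int .

lemma plucker_ring_sum: "(\<And>i. i \<in> A \<Longrightarrow> f i \<in> carrier (plucker_ring n)) \<Longrightarrow> sum f A \<in> carrier (plucker_ring n)"
  by (induction A rule: infinite_finite_induct) (simp_all add: plucker_ring_0 plucker_ring_add)

lemma plucker_ring_prod_list:
  "(\<And>x. x \<in> set xs \<Longrightarrow> f x \<in> carrier (plucker_ring n)) \<Longrightarrow> prod_list (map f xs) \<in> carrier (plucker_ring n)"
  by (induction xs) (simp_all add: plucker_ring_1 plucker_ring_mult)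

lemma sort_in_plucker_indices: "c \<in> pbw_columns n \<Longrightarrow> sort c \<in> plucker_indices n"
  using pbw_columnsD[of c n] unfolding plucker_indices_def by (simp add: strict_sorted_iff)

lemma plucker_var_eq:
  assumes "c \<in> pbw_columns n"
  obtains e where "e \<in> {1, - 1 :: int}" "plucker_var c = of_int e * pvar (sort c)"
proof -
  obtain \<sigma> where "\<sigma> permutes {..<length c}" "permute_list \<sigma> (sort c) = c"
    "plucker_var c = of_int (sign \<sigma>) * pvar (sort c)"
    by (rule plucker_var_sign[OF pbw_columnsD(5)[OF assms]])
  moreover have "sign \<sigma> \<in> {1, - 1}" by (simp add: sign_def)
  ultimately show thesis using that by blast
qed

lemma plucker_ring_var: "c \<in> pbw_columns n \<Longrightarrow> plucker_var c \<in> carrier (plucker_ring n)"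
proof -
  assume c: "c \<in> pbw_columns n"
  obtain e where e: "plucker_var c = of_int e * pvar (sort c)" using plucker_var_eq[OF c] by blast
  have "pvar (sort c) \<in> carrier (plucker_ring n)"
    unfolding carrier_plucker_ring pvar_def using sort_in_plucker_indices[OF c] by simp
  then show ?thesis unfolding e by (intro plucker_ring_mult plucker_ring_of_int)
qed

lemma cring_plucker_ring: "cring (plucker_ring n)"
proof (rule cringI)
  show "abelian_group (plucker_ring n)"
  proof (rule abelian_groupI)
    fix x assume "x \<in> carrier (plucker_ring n)"
    then show "\<exists>y\<in>carrier (plucker_ring n). y \<oplus>\<^bsub>plucker_ring n\<^esub> x = \<zero>\<^bsub>plucker_ring n\<^esub>"
      by (intro bexI[of _ "- x"]) (simp_all add: plucker_ring_uminus)
  qed (simp_all add: plucker_ring_add plucker_ring_0 add.assoc add.commute)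
  show "Group.comm_monoid (plucker_ring n)"
    by (rule comm_monoidI) (simp_all add: plucker_ring_mult plucker_ring_1 mult.assoc mult.commute)
qed (simp add: distrib_right)

lemma a_inv_plucker_ring: "p \<in> carrier (plucker_ring n) \<Longrightarrow> \<ominus>\<^bsub>plucker_ring n\<^esub> p = - p"
proof -
  assume p: "p \<in> carrier (plucker_ring n)"
  interpret cring "plucker_ring n" by (rule cring_plucker_ring)
  show ?thesis by (rule minus_equality) (use p plucker_ring_uminus in simp_all)
qed

lemma ideal_plucker_ringI:
  assumes sub: "A \<subseteq> carrier (plucker_ring n)" and 0: "0 \<in> A" and add: "\<And>p q. p \<in> A \<Longrightarrow> q \<in> A \<Longrightarrow> p + q \<in> A"
    and mult: "\<And>p q. p \<in> A \<Longrightarrow> q \<in> carrier (plucker_ring n) \<Longrightarrow> q * p \<in> A"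
  shows "ideal A (plucker_ring n)"
proof -
  interpret cring "plucker_ring n" by (rule cring_plucker_ring)
  show ?thesis
  proof (rule idealI[OF cring.axioms(1)[OF cring_plucker_ring]])
    show "subgroup A (add_monoid (plucker_ring n))"
    proof (rule add.subgroupI)
      show "A \<subseteq> carrier (plucker_ring n)" by (rule sub)
      show "A \<noteq> {}" using 0 by blast
      show "\<ominus>\<^bsub>plucker_ring n\<^esub> p \<in> A" if "p \<in> A" for p
        using mult[OF that plucker_ring_of_int[of "- 1"]] a_inv_plucker_ring that sub by auto
      show "p \<oplus>\<^bsub>plucker_ring n\<^esub> q \<in> A" if "p \<in> A" "q \<in> A" for p q
        using add[OF that] by simp
    qed
    show "q \<otimes>\<^bsub>plucker_ring n\<^esub> p \<in> A" if "p \<in> A" "q \<in> carrier (plucker_ring n)" for p q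
      using mult[OF that] by simp
    show "p \<otimes>\<^bsub>plucker_ring n\<^esub> q \<in> A" if "p \<in> A" "q \<in> carrier (plucker_ring n)" for p q
      using mult[OF that] by (simp add: mult.commute)
  qed
qed

lemma ideal_plucker_ringD:
  assumes A: "ideal A (plucker_ring n)"
  shows "A \<subseteq> carrier (plucker_ring n)" "0 \<in> A" "p \<in> A \<Longrightarrow> q \<in> A \<Longrightarrow> p + q \<in> A"
    "p \<in> A \<Longrightarrow> q \<in> carrier (plucker_ring n) \<Longrightarrow> q * p \<in> A" "p \<in> A \<Longrightarrow> - p \<in> A"
proof -
  interpret ideal A "plucker_ring n" by (rule A)
  show sub: "A \<subseteq> carrier (plucker_ring n)" by (rule a_subset)
  show "0 \<in> A" using additive_subgroup.zero_closed[OF is_additive_subgroup] by simp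
  show "p + q \<in> A" if "p \<in> A" "q \<in> A"
    using additive_subgroup.a_closed[OF is_additive_subgroup that] by simp
  show mult: "q * p \<in> A" if "p \<in> A" "q \<in> carrier (plucker_ring n)" for p q
    using I_l_closed[OF that] by simp
  show "- p \<in> A" if "p \<in> A" using mult[OF that plucker_ring_of_int[of "- 1"]] by simp
qed

lemma plucker_ideal_iff: "p \<in> plucker_ideal n \<longleftrightarrow> p \<in> carrier (plucker_ring n) \<and> psubst minor p = 0"
  by (simp add: plucker_ideal_def)

lemma ideal_plucker_ideal: "ideal (plucker_ideal n) (plucker_ring n)"
  by (rule ideal_plucker_ringI)
    (auto simp: plucker_ideal_iff plucker_ring_0 plucker_ring_add plucker_ring_mult psubst_add psubst_mult)

lemma psubst_minor_column: "c \<in> pbw_columns n \<Longrightarrow> psubst minor (plucker_var c) = cdet pvar c"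
  by (rule psubst_minor_plucker_var) (rule pbw_columnsD(5))

section \<open>Words in the Pluecker variables and quadratic relations among them\<close>

definition var_word :: "nat list list \<Rightarrow> nat list cpoly" where
  "var_word w = prod_list (map plucker_var w)"

lemma plucker_ring_var_word: "set w \<subseteq> pbw_columns n \<Longrightarrow> var_word w \<in> carrier (plucker_ring n)"
  unfolding var_word_def by (rule plucker_ring_prod_list) (auto intro: plucker_ring_var)

lemma var_word_mset: "mset w = mset w' \<Longrightarrow> var_word w = var_word w'"
  unfolding var_word_def by (metis mset_map prod_mset_prod_list)

lemma var_word_append: "var_word (v @ w) = var_word v * var_word w"
  by (simp add: var_word_def)

lemma psubst_minor_var_word:
  "set w \<subseteq> pbw_columns n \<Longrightarrow> psubst (zres triangle) (psubst minor (var_word w)) = prod_list (map (cdet (zres triangle)) w)"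
  unfolding var_word_def
proof (induction w)
  case (Cons a w)
  then have "a \<in> pbw_columns n" by simp
  then have a: "psubst (zres triangle) (psubst minor (plucker_var a)) = cdet (zres triangle) a"
    by (simp only: psubst_minor_column psubst_cdet_pvar)
  have "set w \<subseteq> pbw_columns n" using Cons.prems by simp
  from Cons.IH[OF this] a show ?case by (simp only: list.map prod_list.Cons psubst_mult)
qed simp

text \<open>A combination killed by \<open>psubst minor\<close> stays zero after the further
  restriction to triangular matrices, where chains are independent.\<close>

lemma var_words_independent:
  assumes fin: "finite W" and W: "\<And>w. w \<in> W \<Longrightarrow> chain_word n w"
    and sum0: "psubst minor (\<Sum>w\<in>W. pconst (a w) * var_word w) = 0" and w: "w \<in> W"
  shows "a w = 0"
proof (rule chain_words_independent[OF staircase_down_full fin W _ _ w])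
  show "dn c \<subseteq> triangle" for c by (rule dn_subset_triangle)
  have "(\<Sum>w\<in>W. pconst (a w) * prod_list (map (cdet (zres triangle)) w)) =
      psubst (zres triangle) (psubst minor (\<Sum>w\<in>W. pconst (a w) * var_word w))"
    using psubst_minor_var_word[of _ n] W by (simp add: psubst_sum psubst_mult chain_word_def)
  then show "(\<Sum>w\<in>W. pconst (a w) * prod_list (map (cdet (zres triangle)) w)) = 0" unfolding sum0 by simp
qed

definition pair_poly :: "nat list \<times> nat list \<Rightarrow> nat list cpoly" where
  "pair_poly x = plucker_var (fst x) * plucker_var (snd x)"

definition quadratic_relation ::
  "nat list \<Rightarrow> nat list \<Rightarrow> (nat list \<times> nat list) set \<Rightarrow> (nat list \<times> nat list \<Rightarrow> complex) \<Rightarrow> nat list cpoly" where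
  "quadratic_relation a b S k = pair_poly (a, b) - (\<Sum>x\<in>S. pconst (k x) * pair_poly x)"

lemma standard_pairsD: "x \<in> standard_pairs n \<Longrightarrow> fst x \<in> pbw_columns n \<and> snd x \<in> pbw_columns n \<and> dn (fst x) \<subseteq> dn (snd x)"
  unfolding standard_pairs_def by auto

lemma psubst_minor_pair:
  "fst x \<in> pbw_columns n \<Longrightarrow> snd x \<in> pbw_columns n \<Longrightarrow> psubst minor (pair_poly x) = cdet pvar (fst x) * cdet pvar (snd x)"
  by (simp add: pair_poly_def psubst_mult psubst_minor_column)

lemma psubst_minor_quadratic_relation:
  assumes "a \<in> pbw_columns n" "b \<in> pbw_columns n" "S \<subseteq> standard_pairs n"
  shows "psubst minor (quadratic_relation a b S k) =
    cdet pvar a * cdet pvar b - (\<Sum>x\<in>S. pconst (k x) * (cdet pvar (fst x) * cdet pvar (snd x)))"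
proof -
  have "psubst minor (\<Sum>x\<in>S. pconst (k x) * pair_poly x) =
      (\<Sum>x\<in>S. pconst (k x) * (cdet pvar (fst x) * cdet pvar (snd x)))"
    unfolding psubst_sum
  proof (rule sum.cong[OF refl])
    fix x assume "x \<in> S"
    then have "x \<in> standard_pairs n" using assms(3) by blast
    then have "psubst minor (pair_poly x) = cdet pvar (fst x) * cdet pvar (snd x)"
      using standard_pairsD psubst_minor_pair by blast
    then show "psubst minor (pconst (k x) * pair_poly x) = pconst (k x) * (cdet pvar (fst x) * cdet pvar (snd x))"
      by (simp add: psubst_mult)
  qed
  moreover have "psubst minor (pair_poly (a, b)) = cdet pvar a * cdet pvar b"
    using psubst_minor_pair[of "(a, b)" n] assms(1,2) by simp
  ultimately show ?thesis by (simp only: quadratic_relation_def psubst_diff)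
qed

lemma quadratic_relation_carrier:
  assumes "a \<in> pbw_columns n" "b \<in> pbw_columns n" "S \<subseteq> standard_pairs n"
  shows "quadratic_relation a b S k \<in> carrier (plucker_ring n)"
  unfolding quadratic_relation_def pair_poly_def
  by (intro plucker_ring_diff plucker_ring_mult plucker_ring_sum plucker_ring_pconst plucker_ring_var)
    (use assms standard_pairsD in \<open>auto dest!: subsetD\<close>)

text \<open>Rewrites an indexed expansion as a sum over all standard pairs, with coefficient 0 for
  the pairs that do not occur. Two expansions then differ only in their coefficient function, which
  independence determines.\<close>

lemma expansion_quadratic_relation:
  assumes "straightening_expansion n a b p m c g h"
  obtains k where "p = quadratic_relation a b (standard_pairs n) k"
proof -
  have p: "p = plucker_var a * plucker_var b - (\<Sum>i=0..m. pconst (c i) * plucker_var (g i) * plucker_var (h i))"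
    and terms: "\<And>i. i \<in> {0..m} \<Longrightarrow> g i \<in> pbw_columns n \<and> h i \<in> pbw_columns n \<and> g i \<sqsubset>\<^bsub>pbw_lattice n\<^esub> h i"
    using assms unfolding straightening_expansion_def carrier_pbw_lattice by blast+
  have std: "(g i, h i) \<in> standard_pairs n" if "i \<in> {0..m}" for i
    using terms[OF that] lless_pbw_lattice[of "g i" n "h i"] unfolding standard_pairs_def by auto
  define k where "k x = (\<Sum>i\<in>{i \<in> {0..m}. (g i, h i) = x}. c i)" for x
  have "(\<Sum>i=0..m. pconst (c i) * plucker_var (g i) * plucker_var (h i)) =
      (\<Sum>x\<in>standard_pairs n. \<Sum>i\<in>{i \<in> {0..m}. (g i, h i) = x}. pconst (c i) * plucker_var (g i) * plucker_var (h i))"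
    by (rule sum.group[symmetric]) (use std finite_standard_pairs in auto)
  also have "\<dots> = (\<Sum>x\<in>standard_pairs n. pconst (k x) * pair_poly x)"
  proof (rule sum.cong[OF refl])
    fix x
    have "(\<Sum>i\<in>{i \<in> {0..m}. (g i, h i) = x}. pconst (c i) * plucker_var (g i) * plucker_var (h i)) =
        (\<Sum>i\<in>{i \<in> {0..m}. (g i, h i) = x}. pconst (c i) * pair_poly x)"
      by (rule sum.cong) (auto simp: pair_poly_def mult.assoc)
    then show "(\<Sum>i\<in>{i \<in> {0..m}. (g i, h i) = x}. pconst (c i) * plucker_var (g i) * plucker_var (h i)) = pconst (k x) * pair_poly x"
      unfolding k_def pconst_sum sum_distrib_right .
  qed
  finally show thesis using that[of k] p unfolding quadratic_relation_def pair_poly_def by simp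
qed

lemma quadratic_relation_unique:
  assumes ab: "a \<in> pbw_columns n" "b \<in> pbw_columns n"
    and k: "quadratic_relation a b (standard_pairs n) k \<in> plucker_ideal n"
    and k': "quadratic_relation a b (standard_pairs n) k' \<in> plucker_ideal n"
  shows "quadratic_relation a b (standard_pairs n) k = quadratic_relation a b (standard_pairs n) k'"
proof -
  let ?P = "standard_pairs n"
  have "(\<Sum>x\<in>?P. pconst (k x) * (cdet pvar (fst x) * cdet pvar (snd x))) =
      (\<Sum>x\<in>?P. pconst (k' x) * (cdet pvar (fst x) * cdet pvar (snd x)))"
    using k k' psubst_minor_quadratic_relation[OF ab subset_refl, of k] psubst_minor_quadratic_relation[OF ab subset_refl, of k']
    unfolding plucker_ideal_iff by simp
  then have "(\<Sum>x\<in>?P. pconst (k x - k' x) * (cdet pvar (fst x) * cdet pvar (snd x))) = 0"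
    by (simp add: pconst_diff left_diff_distrib sum_subtractf)
  then have "psubst (zres triangle) (\<Sum>x\<in>?P. pconst (k x - k' x) * (cdet pvar (fst x) * cdet pvar (snd x))) = 0"
    by simp
  then have "(\<Sum>(g, h)\<in>?P. pconst (k (g, h) - k' (g, h)) * (cdet (zres triangle) g * cdet (zres triangle) h)) = 0"
    by (simp add: psubst_sum psubst_mult psubst_cdet_pvar case_prod_unfold)
  then have "(\<lambda>x. k x - k' x) (g, h) = 0" if "(g, h) \<in> ?P" for g h
    by (intro standard_pairs_independent[OF staircase_down_full subset_refl _ _ that] dn_subset_triangle)
  then have "k x = k' x" if "x \<in> ?P" for x using that by (cases x) auto
  then show ?thesis unfolding quadratic_relation_def by simp
qed

text \<open>Connects the definite description in \<open>straightening_relation\<close> with the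
  expansion that has been constructed; uniqueness comes from writing both candidates over all
  standard pairs.\<close>

lemma straightening_relation_data:
  assumes inc: "incomparable (pbw_lattice n) a b" and data: "straightening_data n a b S c h"
  shows "straightening_relation n a b = quadratic_relation a b S c"
    and "quadratic_relation a b S c \<in> plucker_ideal n"
    and "\<exists>m f. bij_betw f {0..m} S \<and> f 0 = (odot n a b, h) \<and>
      straightening_expansion n a b (quadratic_relation a b S c) m (c \<circ> f) (fst \<circ> f) (snd \<circ> f)"
proof -
  have ab: "a \<in> pbw_columns n" "b \<in> pbw_columns n" using inc unfolding incomparable_pbw_lattice by simp_all
  have S: "S \<subseteq> standard_pairs n" and strict: "\<And>x. x \<in> S \<Longrightarrow> dn (fst x) \<subset> dn (snd x)" and nz: "\<And>x. x \<in> S \<Longrightarrow> c x \<noteq> 0"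
    and x0: "(odot n a b, h) \<in> S"
    and rel: "cdet pvar a * cdet pvar b = (\<Sum>x\<in>S. pconst (c x) * (cdet pvar (fst x) * cdet pvar (snd x)))"
    using data unfolding straightening_data_def by blast+
  let ?p = "quadratic_relation a b S c" and ?x0 = "(odot n a b, h)"
  have fin: "finite S" using finite_subset[OF S finite_standard_pairs] .
  show pI: "?p \<in> plucker_ideal n"
    unfolding plucker_ideal_iff using quadratic_relation_carrier[OF ab S] psubst_minor_quadratic_relation[OF ab S] rel by simp
  show ex: "\<exists>m f. bij_betw f {0..m} S \<and> f 0 = ?x0 \<and> straightening_expansion n a b ?p m (c \<circ> f) (fst \<circ> f) (snd \<circ> f)"
  proof -
    define m where "m = card (S - {?x0})"
    obtain e where e: "bij_betw e {0..<m} (S - {?x0})"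
      using ex_bij_betw_nat_finite[of "S - {?x0}"] fin unfolding m_def by blast
    \<comment> \<open>Index 0 is reserved for the distinguished pair, and the enumeration of the
      other pairs is shifted by one.\<close>
    define f where "f i = (if i = 0 then ?x0 else e (i - 1))" for i
    have "bij_betw (\<lambda>i. i - 1) {1..m} {0..<m}"
      by (rule bij_betw_byWitness[of _ "\<lambda>i. i + 1"]) auto
    then have "bij_betw (e \<circ> (\<lambda>i. i - 1)) {1..m} (S - {?x0})" using e by (rule bij_betw_trans)
    then have f1: "bij_betw f {1..m} (S - {?x0})"
      by (rule bij_betw_cong[THEN iffD1, rotated]) (simp add: f_def)
    have f0: "f 0 = ?x0" unfolding f_def by simp
    have "bij_betw f (insert 0 {1..m}) (insert (f 0) (S - {?x0}))"
      using f1 unfolding bij_betw_def f0 by (auto simp: inj_on_insert f0)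
    moreover have "insert 0 {1..m} = {0..m}" by auto
    moreover have "insert (f 0) (S - {?x0}) = S" using x0 f0 by auto
    ultimately have f: "bij_betw f {0..m} S" by simp
    have "straightening_expansion n a b ?p m (c \<circ> f) (fst \<circ> f) (snd \<circ> f)"
      unfolding straightening_expansion_def
    proof (intro conjI ballI)
      have "(\<Sum>i=0..m. pconst (c (f i)) * pair_poly (f i)) = (\<Sum>x\<in>S. pconst (c x) * pair_poly x)"
        by (rule sum.reindex_bij_betw[OF f])
      then show "?p = plucker_var a * plucker_var b -
          (\<Sum>i=0..m. pconst ((c \<circ> f) i) * plucker_var ((fst \<circ> f) i) * plucker_var ((snd \<circ> f) i))"
        unfolding quadratic_relation_def by (simp add: pair_poly_def mult.assoc)
      show "inj_on (\<lambda>i. ((fst \<circ> f) i, (snd \<circ> f) i)) {0..m}"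
        using bij_betw_imp_inj_on[OF f] by simp
      fix i assume "i \<in> {0..m}"
      then have i: "f i \<in> S" using f by (auto simp: bij_betw_def)
      then have cols: "fst (f i) \<in> pbw_columns n" "snd (f i) \<in> pbw_columns n" using S standard_pairsD by blast+
      then show "(fst \<circ> f) i \<in> carrier (pbw_lattice n)" "(snd \<circ> f) i \<in> carrier (pbw_lattice n)"
        by (simp_all add: carrier_pbw_lattice)
      show "(fst \<circ> f) i \<sqsubset>\<^bsub>pbw_lattice n\<^esub> (snd \<circ> f) i" using strict[OF i] lless_pbw_lattice[OF cols] by simp
      show "(c \<circ> f) i \<noteq> 0" using nz[OF i] by simp
    qed
    then show ?thesis using f f0 by blast
  qed
  show "straightening_relation n a b = ?p"
    unfolding straightening_relation_def
  proof (rule the_equality)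
    show "?p \<in> plucker_ideal n \<and> (\<exists>m c g h. straightening_expansion n a b ?p m c g h)" using pI ex by blast
  next
    fix q assume q: "q \<in> plucker_ideal n \<and> (\<exists>m c g h. straightening_expansion n a b q m c g h)"
    obtain k where k: "q = quadratic_relation a b (standard_pairs n) k" using q expansion_quadratic_relation by blast
    obtain k' where k': "?p = quadratic_relation a b (standard_pairs n) k'" using ex expansion_quadratic_relation by blast
    show "q = ?p" using quadratic_relation_unique[OF ab, of k k'] q pI unfolding k k' by blast
  qed
qed

lemma straightening_relation_commute: "straightening_relation n a b = straightening_relation n b a"
  unfolding straightening_relation_def straightening_expansion_def mult.commute[of "plucker_var a" "plucker_var b"] ..

definition relation_set :: "nat \<Rightarrow> nat list cpoly set" where
  "relation_set n = {straightening_relation n a b | a b. incomparable (pbw_lattice n) a b}"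

lemma relation_set_subset:
  assumes n: "n \<ge> 2" shows "relation_set n \<subseteq> plucker_ideal n"
proof
  fix p assume "p \<in> relation_set n"
  then obtain a b where p: "p = straightening_relation n a b" and inc: "incomparable (pbw_lattice n) a b"
    unfolding relation_set_def by blast
  obtain S c h where "straightening_data n a b S c h" using ex_straightening_data[OF n inc] .
  then show "p \<in> plucker_ideal n" unfolding p using straightening_relation_data(1,2)[OF inc] by simp
qed

section \<open>Reduction to combinations of chains modulo the quadratic relations\<close>

definition standard_combinations :: "nat \<Rightarrow> nat list cpoly set" where
  "standard_combinations n = {p. \<exists>W c. finite W \<and> (\<forall>w\<in>W. chain_word n w) \<and> p = (\<Sum>w\<in>W. pconst (c w) * var_word w)}"

lemma standard_combinations_0: "0 \<in> standard_combinations n"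
  unfolding standard_combinations_def by (intro CollectI exI[of _ "{}"]) simp

lemma standard_combinations_word: "chain_word n w \<Longrightarrow> var_word w \<in> standard_combinations n"
  unfolding standard_combinations_def by (intro CollectI exI[of _ "{w}"] exI[of _ "\<lambda>_. 1"]) simp

lemma standard_combinations_add:
  assumes "p \<in> standard_combinations n" "q \<in> standard_combinations n"
  shows "p + q \<in> standard_combinations n"
proof -
  obtain W c where W: "finite W" "\<forall>w\<in>W. chain_word n w" "p = (\<Sum>w\<in>W. pconst (c w) * var_word w)"
    using assms(1) unfolding standard_combinations_def by blast
  obtain V d where V: "finite V" "\<forall>w\<in>V. chain_word n w" "q = (\<Sum>w\<in>V. pconst (d w) * var_word w)"
    using assms(2) unfolding standard_combinations_def by blast
  let ?c = "\<lambda>w. if w \<in> W then c w else 0" and ?d = "\<lambda>w. if w \<in> V then d w else 0"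
  have "p = (\<Sum>w\<in>W \<union> V. pconst (?c w) * var_word w)" "q = (\<Sum>w\<in>W \<union> V. pconst (?d w) * var_word w)"
    unfolding W(3) V(3) using W(1) V(1) by (auto intro!: sum.mono_neutral_cong_left)
  then have "p + q = (\<Sum>w\<in>W \<union> V. pconst (?c w + ?d w) * var_word w)"
    by (simp only: pconst_add distrib_right sum.distrib)
  then show ?thesis unfolding standard_combinations_def
    using W V by (intro CollectI exI[of _ "W \<union> V"] exI[of _ "\<lambda>w. ?c w + ?d w"]) auto
qed

lemma standard_combinations_scale:
  assumes "p \<in> standard_combinations n" shows "pconst k * p \<in> standard_combinations n"
proof -
  obtain W c where W: "finite W" "\<forall>w\<in>W. chain_word n w" "p = (\<Sum>w\<in>W. pconst (c w) * var_word w)"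
    using assms unfolding standard_combinations_def by blast
  then have "pconst k * p = (\<Sum>w\<in>W. pconst (k * c w) * var_word w)"
    by (simp add: sum_distrib_left pconst_mult mult.assoc)
  then show ?thesis unfolding standard_combinations_def
    using W by (intro CollectI exI[of _ W] exI[of _ "\<lambda>w. k * c w"]) auto
qed

abbreviation relation_ideal :: "nat \<Rightarrow> nat list cpoly set" where
  "relation_ideal n \<equiv> Idl\<^bsub>plucker_ring n\<^esub> relation_set n"

lemma ideal_genideal_relation_set:
  assumes n: "n \<ge> 2" shows "ideal (relation_ideal n) (plucker_ring n)"
proof -
  interpret cring "plucker_ring n" by (rule cring_plucker_ring)
  have "relation_set n \<subseteq> carrier (plucker_ring n)"
    using relation_set_subset[OF n] ideal_plucker_ringD(1)[OF ideal_plucker_ideal] by blast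
  then show ?thesis by (rule genideal_ideal)
qed

text \<open>Congruence is taken modulo the ideal generated by the relations, not modulo the full
  kernel; the equality of the two is deduced from it.\<close>

definition reducible :: "nat \<Rightarrow> nat list cpoly set" where
  "reducible n = {p. \<exists>q\<in>standard_combinations n. p - q \<in> relation_ideal n}"

lemma reducible_0:
  assumes n: "n \<ge> 2" shows "0 \<in> reducible n"
  unfolding reducible_def using standard_combinations_0 ideal_plucker_ringD(2)[OF ideal_genideal_relation_set[OF n]] by force

lemma reducible_add:
  assumes n: "n \<ge> 2" and "p \<in> reducible n" "q \<in> reducible n" shows "p + q \<in> reducible n"
proof -
  obtain p' q' where *: "p' \<in> standard_combinations n" "p - p' \<in> relation_ideal n"
    "q' \<in> standard_combinations n" "q - q' \<in> relation_ideal n"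
    using assms(2,3) unfolding reducible_def by blast
  have "(p + q) - (p' + q') = (p - p') + (q - q')" by simp
  also have "\<dots> \<in> relation_ideal n"
    by (rule ideal_plucker_ringD(3)[OF ideal_genideal_relation_set[OF n] *(2,4)])
  finally show ?thesis unfolding reducible_def using standard_combinations_add[OF *(1,3)] by blast
qed

lemma reducible_sum: "n \<ge> 2 \<Longrightarrow> (\<And>i. i \<in> A \<Longrightarrow> f i \<in> reducible n) \<Longrightarrow> sum f A \<in> reducible n"
  by (induction A rule: infinite_finite_induct) (simp_all add: reducible_0 reducible_add)

lemma reducible_scale:
  assumes n: "n \<ge> 2" and "p \<in> reducible n" shows "pconst k * p \<in> reducible n"
proof -
  obtain p' where *: "p' \<in> standard_combinations n" "p - p' \<in> relation_ideal n"
    using assms(2) unfolding reducible_def by blast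
  have "pconst k * p - pconst k * p' = pconst k * (p - p')" by (simp add: right_diff_distrib)
  also have "\<dots> \<in> relation_ideal n"
    by (rule ideal_plucker_ringD(4)[OF ideal_genideal_relation_set[OF n] *(2) plucker_ring_pconst])
  finally show ?thesis unfolding reducible_def using standard_combinations_scale[OF *(1)] by blast
qed

lemma reducible_add_ideal:
  assumes n: "n \<ge> 2" and "p \<in> reducible n" and q: "q \<in> relation_ideal n"
  shows "q + p \<in> reducible n"
proof -
  obtain p' where *: "p' \<in> standard_combinations n" "p - p' \<in> relation_ideal n"
    using assms(2) unfolding reducible_def by blast
  have "q + p - p' = q + (p - p')" by simp
  also have "\<dots> \<in> relation_ideal n"
    by (rule ideal_plucker_ringD(3)[OF ideal_genideal_relation_set[OF n] q *(2)])
  finally show ?thesis unfolding reducible_def using *(1) by blast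
qed

lemma finite_dn: "c \<in> pbw_columns n \<Longrightarrow> finite (dn c)"
  by (rule finite_subset[of _ "{1..n} \<times> {1..n}"]) (use dn_bound[of c n] in fastforce)+

lemma card_dn: "c \<in> pbw_columns n \<Longrightarrow> card (dn c) \<le> n * n"
proof -
  assume c: "c \<in> pbw_columns n"
  have "dn c \<subseteq> {1..n} \<times> {1..n}" using dn_bound[OF c] by fastforce
  then have "card (dn c) \<le> card ({1..n} \<times> {1..n})" by (rule card_mono[rotated]) simp
  then show ?thesis by simp
qed

text \<open>Between comparable columns inclusion is decided by the size of the ideal, so sorting by
  size produces a chain.\<close>

lemma ex_chain_word:
  assumes ws: "set ws \<subseteq> pbw_columns n" and comp: "\<And>a b. a \<in> set ws \<Longrightarrow> b \<in> set ws \<Longrightarrow> dn a \<subseteq> dn b \<or> dn b \<subseteq> dn a"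
  shows "\<exists>w. chain_word n w \<and> mset w = mset ws"
proof -
  let ?w = "sort_key (\<lambda>c. card (dn c)) ws"
  have "sorted_wrt (\<lambda>a b. card (dn a) \<le> card (dn b)) ?w"
    using sorted_sort_key[of "\<lambda>c. card (dn c)" ws] by (simp add: sorted_wrt_map)
  then have "sorted_wrt (\<lambda>a b. dn a \<subseteq> dn b) ?w"
  proof (rule sorted_wrt_mono_rel[rotated])
    fix a b assume ab: "a \<in> set ?w" "b \<in> set ?w" "card (dn a) \<le> card (dn b)"
    then have "a \<in> set ws" "b \<in> set ws" by simp_all
    then have "dn a \<subseteq> dn b \<or> dn b \<subseteq> dn a" "finite (dn a)" using comp finite_dn ws by blast+
    then show "dn a \<subseteq> dn b" using ab(3) card_seteq[of "dn a" "dn b"] by blast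
  qed
  then show ?thesis unfolding chain_word_def using ws by (intro exI[of _ ?w]) simp
qed

text \<open>
  Every straightening step replaces \<open>a, b\<close> by \<open>g, h\<close> with \<open>h\<close> strictly above both, so the
  exponential weight decreases.
\<close>

definition word_weight :: "nat \<Rightarrow> nat list list \<Rightarrow> nat" where
  "word_weight n w = sum_list (map (\<lambda>c. 3 ^ (n * n) - 3 ^ card (dn c)) w)"

lemma word_weight_mset: "mset v = mset w \<Longrightarrow> word_weight n v = word_weight n w"
  unfolding word_weight_def by (metis mset_map sum_mset_sum_list)

lemma word_weight_less:
  assumes cols: "a \<in> pbw_columns n" "b \<in> pbw_columns n" "g \<in> pbw_columns n" "h \<in> pbw_columns n"
    and sub: "dn a \<subset> dn h" "dn b \<subset> dn h"
  shows "word_weight n (g # h # r) < word_weight n (a # b # r)"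
proof -
  have "card (dn a) + 1 \<le> card (dn h)" "card (dn b) + 1 \<le> card (dn h)"
    using psubset_card_mono[OF finite_dn[OF cols(4)]] sub by (simp_all add: Suc_le_eq)
  then have "(3::nat) ^ (card (dn a) + 1) \<le> 3 ^ card (dn h)" "(3::nat) ^ (card (dn b) + 1) \<le> 3 ^ card (dn h)"
    by (intro power_increasing; simp)+
  then have *: "3 * 3 ^ card (dn a) \<le> (3::nat) ^ card (dn h)" "3 * 3 ^ card (dn b) \<le> (3::nat) ^ card (dn h)"
    by simp_all
  have le: "(3::nat) ^ card (dn x) \<le> 3 ^ (n * n)" if "x \<in> pbw_columns n" for x
    using card_dn[OF that] by (intro power_increasing) simp_all
  \<comment> \<open>\<open>A + B < H\<close> follows from the two bounds by \<open>H\<close>, so the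
    exchange raises the sum of the powers. The bounds by \<open>M\<close> keep the truncated
    differences exact.\<close>
  have arith: "(M - G) + (M - H) < (M - A) + (M - B)"
    if "3 * A \<le> H" "3 * B \<le> H" "A \<le> M" "B \<le> M" "G \<le> M" "H \<le> M" "0 < A" "0 < G" for A B G H M :: nat
    using that by linarith
  have "(3 ^ (n * n) - 3 ^ card (dn g)) + (3 ^ (n * n) - 3 ^ card (dn h)) <
      (3 ^ (n * n) - 3 ^ card (dn a)) + (3 ^ (n * n) - (3::nat) ^ card (dn b))"
    by (rule arith[OF * le[OF cols(1)] le[OF cols(2)] le[OF cols(3)] le[OF cols(4)]]) simp_all
  then show ?thesis unfolding word_weight_def by simp
qed

text \<open>A word that is not a chain up to order contains an incomparable pair. Replacing this
  pair by means of its quadratic relation changes the word by an element of the ideal and gives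
  words of smaller weight.\<close>

lemma var_word_reducible:
  assumes n: "n \<ge> 2"
  shows "set ws \<subseteq> pbw_columns n \<Longrightarrow> var_word ws \<in> reducible n"
proof (induction "word_weight n ws" arbitrary: ws rule: less_induct)
  case less
  let ?J = "relation_ideal n"
  show ?case
  proof (cases "\<forall>a\<in>set ws. \<forall>b\<in>set ws. dn a \<subseteq> dn b \<or> dn b \<subseteq> dn a")
    case True
    then obtain w where w: "chain_word n w" "mset w = mset ws" using ex_chain_word[OF less.prems] by blast
    have "var_word ws - var_word w \<in> ?J"
      using var_word_mset[OF w(2)] ideal_plucker_ringD(2)[OF ideal_genideal_relation_set[OF n]] by simp
    then show ?thesis unfolding reducible_def using standard_combinations_word[OF w(1)] by blast
  next
    case False
    then obtain a b where ab: "a \<in> set ws" "b \<in> set ws" "\<not> dn a \<subseteq> dn b" "\<not> dn b \<subseteq> dn a" by blast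
    have cols: "a \<in> pbw_columns n" "b \<in> pbw_columns n" using ab less.prems by blast+
    have inc: "incomparable (pbw_lattice n) a b" unfolding incomparable_pbw_lattice using ab cols by blast
    have "a \<noteq> b" using ab by blast
    define r where "r = remove1 b (remove1 a ws)"
    have ba: "b \<in> set (remove1 a ws)" using ab(2) \<open>a \<noteq> b\<close> by simp
    have "mset ws = add_mset a (mset (remove1 a ws))" "mset (remove1 a ws) = add_mset b (mset r)"
      unfolding r_def using ab(1) ba by (simp_all del: mset_remove1 add: perm_remove)
    then have mset: "mset ws = mset (a # b # r)" by simp
    have r: "set r \<subseteq> pbw_columns n"
      unfolding r_def using less.prems set_remove1_subset[of b "remove1 a ws"] set_remove1_subset[of a ws] by blast
    obtain S c h where data: "straightening_data n a b S c h" using ex_straightening_data[OF n inc] .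
    let ?e = "quadratic_relation a b S c"
    have eJ: "?e \<in> ?J"
    proof -
      interpret cring "plucker_ring n" by (rule cring_plucker_ring)
      have "relation_set n \<subseteq> carrier (plucker_ring n)"
        using relation_set_subset[OF n] ideal_plucker_ringD(1)[OF ideal_plucker_ideal] by blast
      then have "relation_set n \<subseteq> ?J" by (rule genideal_self)
      moreover have "?e \<in> relation_set n"
        unfolding relation_set_def using straightening_relation_data(1)[OF inc data] inc by (metis (mono_tags, lifting) mem_Collect_eq)
      ultimately show ?thesis by blast
    qed
    have "var_word ws = pair_poly (a, b) * var_word r"
      unfolding var_word_mset[OF mset] by (simp add: var_word_def pair_poly_def mult.assoc)
    also have "pair_poly (a, b) = ?e + (\<Sum>x\<in>S. pconst (c x) * pair_poly x)" unfolding quadratic_relation_def by simp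
    finally have "var_word ws = var_word r * ?e + (\<Sum>x\<in>S. pconst (c x) * var_word (fst x # snd x # r))"
      by (simp add: distrib_right sum_distrib_right var_word_def pair_poly_def mult.assoc mult.commute[of _ ?e])
    moreover have "var_word r * ?e \<in> ?J"
      by (rule ideal_plucker_ringD(4)[OF ideal_genideal_relation_set[OF n] eJ plucker_ring_var_word[OF r]])
    moreover have "(\<Sum>x\<in>S. pconst (c x) * var_word (fst x # snd x # r)) \<in> reducible n"
    proof (rule reducible_sum[OF n], rule reducible_scale[OF n])
      fix x assume x: "x \<in> S"
      have gh: "fst x \<in> pbw_columns n" "snd x \<in> pbw_columns n"
        using data x standard_pairsD unfolding straightening_data_def by blast+
      have "dn a \<union> dn b \<subseteq> dn (snd x)" using data x unfolding straightening_data_def by fastforce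
      \<comment> \<open>Incomparability makes both inclusions strict even for the distinguished
        term, whose larger column is only the join.\<close>
      then have "dn a \<subset> dn (snd x)" "dn b \<subset> dn (snd x)" using ab(3,4) by blast+
      then have "word_weight n (fst x # snd x # r) < word_weight n ws"
        unfolding word_weight_mset[OF mset] by (rule word_weight_less[OF cols gh])
      then show "var_word (fst x # snd x # r) \<in> reducible n" by (rule less.hyps) (use gh r in simp)
    qed
    ultimately show ?thesis using reducible_add_ideal[OF n] by simp
  qed
qed

definition signed_words :: "nat \<Rightarrow> nat list cpoly set" where
  "signed_words n = {p. \<exists>e\<in>{1, - 1 :: int}. \<exists>w. set w \<subseteq> pbw_columns n \<and> p = of_int e * var_word w}"

lemma signed_words_mult:
  assumes "p \<in> signed_words n" "q \<in> signed_words n" shows "p * q \<in> signed_words n"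
proof -
  obtain e w where p: "e \<in> {1, - 1 :: int}" "set w \<subseteq> pbw_columns n" "p = of_int e * var_word w"
    using assms(1) unfolding signed_words_def by blast
  obtain e' w' where q: "e' \<in> {1, - 1 :: int}" "set w' \<subseteq> pbw_columns n" "q = of_int e' * var_word w'"
    using assms(2) unfolding signed_words_def by blast
  have "p * q = of_int (e * e') * var_word (w @ w')"
    unfolding p(3) q(3) var_word_append by (simp add: ac_simps)
  moreover have "e * e' \<in> {1, - 1}" using p(1) q(1) by auto
  ultimately show ?thesis unfolding signed_words_def using p(2) q(2) by (intro CollectI bexI exI conjI) auto
qed

lemma signed_words_1: "1 \<in> signed_words n"
  unfolding signed_words_def by (intro CollectI bexI[of _ 1] exI[of _ "[]"]) (simp_all add: var_word_def)

text \<open>The ring is generated by variables with sorted indices, whereas words use PBW columns.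
  The same entries arranged as a PBW column give the same variable up to a sign.\<close>

lemma signed_words_pvar:
  assumes v: "v \<in> plucker_indices n" shows "pvar v \<in> signed_words n"
proof -
  have v': "sorted_wrt (<) v" "set v \<subseteq> {1..n}" "1 \<le> length v" "length v \<le> n - 1"
    using v unfolding plucker_indices_def by simp_all
  then have dist: "distinct v" "sorted v" by (simp_all add: strict_sorted_iff)
  have "0 \<notin> set v" using v'(2) by auto
  then obtain c where c: "pbw_column c" "set c = set v" using ex_pbw_column[of "set v"] by auto
  have len: "length c = length v" using c dist(1) pbw_distinct distinct_card by metis
  have col: "c \<in> pbw_columns n" unfolding pbw_columns_def using c v' len by simp
  have "mset c = mset v" using c dist(1) pbw_distinct set_eq_iff_mset_eq_distinct by blast
  then have sort: "sort c = v" using dist(2) by (metis properties_for_sort)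
  obtain e where e: "e \<in> {1, - 1 :: int}" "plucker_var c = of_int e * pvar v"
    using plucker_var_eq[OF col] unfolding sort by blast
  have "of_int e * of_int e = (1 :: nat list cpoly)" using e(1) by auto
  then have "pvar v = of_int e * plucker_var c" unfolding e(2) by (simp flip: mult.assoc)
  then have "pvar v = of_int e * var_word [c]" by (simp add: var_word_def)
  then show ?thesis unfolding signed_words_def using e(1) col by (intro CollectI bexI[of _ e] exI[of _ "[c]"]) simp_all
qed

lemma signed_words_prod: "(\<And>i. i \<in> A \<Longrightarrow> f i \<in> signed_words n) \<Longrightarrow> prod f A \<in> signed_words n"
  by (induction A rule: infinite_finite_induct) (simp_all add: signed_words_1 signed_words_mult)

lemma signed_words_power: "p \<in> signed_words n \<Longrightarrow> p ^ k \<in> signed_words n"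
  by (induction k) (simp_all add: signed_words_1 signed_words_mult)

lemma psingle_eq_prod: "psingle m (1::complex) = (\<Prod>v\<in>pkeys m. pvar v ^ plook m v)"
proof -
  have "pvar v ^ k = psingle (psingle v k) 1" for v :: 'a and k
    by (induction k) (simp_all add: pvar_def mult_single flip: single_add)
  then have "(\<Prod>v\<in>pkeys m. pvar v ^ plook m v) = psingle (\<Sum>v\<in>pkeys m. psingle v (plook m v)) 1"
    by (simp add: prod_psingle)
  then show ?thesis by (simp add: sum_single_lookup)
qed

lemma carrier_reducible:
  assumes n: "n \<ge> 2" and p: "p \<in> carrier (plucker_ring n)" shows "p \<in> reducible n"
proof -
  have "psingle m (plook p m) \<in> reducible n" if m: "m \<in> pkeys p" for m
  proof -
    have "psingle m 1 \<in> signed_words n"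
      unfolding psingle_eq_prod using p m unfolding carrier_plucker_ring
      by (intro signed_words_prod signed_words_power signed_words_pvar) blast
    then obtain e w where w: "set w \<subseteq> pbw_columns n" "psingle m 1 = of_int e * var_word w"
      unfolding signed_words_def by blast
    have "psingle m (plook p m) = pconst (plook p m * of_int e) * var_word w"
      unfolding psingle_eq[of m "plook p m"] w(2) pconst_mult pconst_of_int by (simp only: mult.assoc)
    then show ?thesis using reducible_scale[OF n var_word_reducible[OF n w(1)]] by simp
  qed
  then have "(\<Sum>m\<in>pkeys p. psingle m (plook p m)) \<in> reducible n" by (rule reducible_sum[OF n])
  then show ?thesis unfolding sum_single_lookup .
qed

lemma standard_combinations_plucker_ideal:
  assumes "q \<in> standard_combinations n" "q \<in> plucker_ideal n" shows "q = 0"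
proof -
  obtain W c where W: "finite W" "\<And>w. w \<in> W \<Longrightarrow> chain_word n w" "q = (\<Sum>w\<in>W. pconst (c w) * var_word w)"
    using assms(1) unfolding standard_combinations_def by blast
  have "c w = 0" if "w \<in> W" for w
    by (rule var_words_independent[OF W(1) W(2) _ that]) (use assms(2) W(3) in \<open>simp_all add: plucker_ideal_iff\<close>)
  then show ?thesis unfolding W(3) by simp
qed

text \<open>An element of \<open>plucker_ideal\<close> is congruent to a combination of chains
  modulo the relations. That combination lies in \<open>plucker_ideal\<close> as well, and
  independence makes it zero.\<close>

lemma genideal_relation_set:
  assumes n: "n \<ge> 2" shows "relation_ideal n = plucker_ideal n"
proof
  interpret cring "plucker_ring n" by (rule cring_plucker_ring)
  show sub: "relation_ideal n \<subseteq> plucker_ideal n"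
    by (rule genideal_minimal[OF ideal_plucker_ideal relation_set_subset[OF n]])
  show "plucker_ideal n \<subseteq> relation_ideal n"
  proof
    fix p assume p: "p \<in> plucker_ideal n"
    then have "p \<in> reducible n" using carrier_reducible[OF n] unfolding plucker_ideal_iff by blast
    then obtain q where q: "q \<in> standard_combinations n" "p - q \<in> relation_ideal n"
      unfolding reducible_def by blast
    then have "p - q \<in> plucker_ideal n" using sub by blast
    then have "p + - (p - q) \<in> plucker_ideal n"
      using ideal_plucker_ringD(3,5)[OF ideal_plucker_ideal] p by blast
    then have "q \<in> plucker_ideal n" by simp
    then have "q = 0" by (rule standard_combinations_plucker_ideal[OF q(1)])
    then show "p \<in> relation_ideal n" using q(2) by simp
  qed
qed

section \<open>Degrees and minimality of the generating set\<close>

definition mdeg :: "('v \<Rightarrow>\<^sub>0 nat) \<Rightarrow> nat" where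
  "mdeg m = (\<Sum>v\<in>pkeys m. plook m v)"

lemma mdeg_superset: "finite A \<Longrightarrow> pkeys m \<subseteq> A \<Longrightarrow> mdeg m = (\<Sum>v\<in>A. plook m v)"
  unfolding mdeg_def by (rule sum.mono_neutral_left) (auto simp: in_keys_iff)

lemma mdeg_add: "mdeg (m + m') = mdeg m + mdeg m'"
  using Poly_Mapping.keys_add[of m m']
  by (simp add: mdeg_superset[of "pkeys m \<union> pkeys m'"] lookup_add sum.distrib)

lemma mdeg_eq_0: "mdeg m = 0 \<Longrightarrow> m = 0"
  unfolding mdeg_def by (metis finite_keys in_keys_iff keys_eq_empty sum_eq_0_iff equals0I)

definition pair_monomial :: "nat list \<times> nat list \<Rightarrow> (nat list \<Rightarrow>\<^sub>0 nat)" where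
  "pair_monomial x = psingle (sort (fst x)) 1 + psingle (sort (snd x)) 1"

lemma mdeg_pair_monomial: "mdeg (pair_monomial x) = 2"
  unfolding pair_monomial_def mdeg_add by (simp add: mdeg_def)

lemma sort_pbw_inj: "c \<in> pbw_columns n \<Longrightarrow> d \<in> pbw_columns n \<Longrightarrow> sort c = sort d \<Longrightarrow> c = d"
  using pbw_unique[of c d] pbw_columnsD(1) by (metis set_sort)

lemma pair_monomial_eq:
  assumes ab: "a \<in> pbw_columns n" "b \<in> pbw_columns n" "a \<noteq> b" and gh: "g \<in> pbw_columns n" "h \<in> pbw_columns n"
    and eq: "pair_monomial (a, b) = pair_monomial (g, h)"
  shows "a = g \<and> b = h \<or> a = h \<and> b = g"
proof -
  have keys: "pkeys (pair_monomial (u, v)) = {sort u, sort v}" for u v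
    unfolding pair_monomial_def keys_add_nat by auto
  have "{sort a, sort b} = {sort g, sort h}" using keys[of a b] keys[of g h] eq by simp
  moreover have "sort a \<noteq> sort b" using sort_pbw_inj[OF ab(1,2)] ab(3) by blast
  ultimately have "sort a = sort g \<and> sort b = sort h \<or> sort a = sort h \<and> sort b = sort g"
    by (auto simp: doubleton_eq_iff)
  then show ?thesis using sort_pbw_inj ab gh by blast
qed

lemma pair_poly_eq:
  assumes "fst x \<in> pbw_columns n" "snd x \<in> pbw_columns n"
  obtains k :: complex where "k \<noteq> 0" "pair_poly x = psingle (pair_monomial x) k"
proof -
  obtain e where e: "e \<in> {1, - 1 :: int}" "plucker_var (fst x) = of_int e * pvar (sort (fst x))"
    using plucker_var_eq[OF assms(1)] by blast
  obtain e' where e': "e' \<in> {1, - 1 :: int}" "plucker_var (snd x) = of_int e' * pvar (sort (snd x))"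
    using plucker_var_eq[OF assms(2)] by blast
  have "pair_poly x = of_int (e * e') * (pvar (sort (fst x)) * pvar (sort (snd x)))"
    unfolding pair_poly_def e(2) e'(2) by (simp add: ac_simps)
  also have "\<dots> = psingle (pair_monomial x) (of_int (e * e'))"
    unfolding pair_monomial_def pvar_def by (simp add: mult_single flip: single_of_int)
  finally show thesis using that[of "of_int (e * e')"] e(1) e'(1) by auto
qed

text \<open>A relation is homogeneous of degree two, and at a monomial of no standard pair only the
  product \<open>X_a X_b\<close> contributes.\<close>

lemma
  assumes ab: "a \<in> pbw_columns n" "b \<in> pbw_columns n" and S: "S \<subseteq> standard_pairs n"
  shows keys_quadratic_relation: "k \<in> pkeys (quadratic_relation a b S c) \<Longrightarrow> mdeg k = 2"
    and lookup_quadratic_relation: "m \<notin> pair_monomial ` standard_pairs n \<Longrightarrow>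
      plook (quadratic_relation a b S c) m = plook (pair_poly (a, b)) m"
proof -
  have pair: "plook (pair_poly x) m = 0" if x: "fst x \<in> pbw_columns n" "snd x \<in> pbw_columns n" "m \<noteq> pair_monomial x" for x m
  proof -
    obtain k where "pair_poly x = psingle (pair_monomial x) k" using pair_poly_eq[OF x(1,2)] by blast
    then show ?thesis using x(3) by (simp add: lookup_single when_def)
  qed
  have look: "plook (quadratic_relation a b S c) m = plook (pair_poly (a, b)) m - (\<Sum>x\<in>S. c x * plook (pair_poly x) m)" for m
    unfolding quadratic_relation_def by (simp add: lookup_minus lookup_sum lookup_pconst_mult)
  have zero: "(\<Sum>x\<in>S. c x * plook (pair_poly x) m) = 0" if "\<And>x. x \<in> S \<Longrightarrow> m \<noteq> pair_monomial x" for m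
  proof (rule sum.neutral, rule ballI)
    fix x assume x: "x \<in> S"
    then have "fst x \<in> pbw_columns n" "snd x \<in> pbw_columns n" using S standard_pairsD by blast+
    then show "c x * plook (pair_poly x) m = 0" using pair[of x m] that[OF x] by simp
  qed
  show "mdeg k = 2" if k: "k \<in> pkeys (quadratic_relation a b S c)" for k
  proof (rule ccontr)
    assume "mdeg k \<noteq> 2"
    then have ne: "k \<noteq> pair_monomial x" for x using mdeg_pair_monomial by metis
    have "plook (quadratic_relation a b S c) k = 0"
      unfolding look using pair[of "(a, b)" k] ab ne zero[of k] by simp
    then show False using k by (simp add: in_keys_iff)
  qed
  show "plook (quadratic_relation a b S c) m = plook (pair_poly (a, b)) m" if "m \<notin> pair_monomial ` standard_pairs n" for m
    unfolding look using zero[of m] that S by fastforce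
qed

text \<open>Once the relation of \<open>a, b\<close> is dropped, all others lie in the ideal
  \<open>A\<close> of polynomials without terms of degree below two and without the monomial of
  \<open>X_a X_b\<close>: this monomial belongs to no standard pair and to no other incomparable
  pair. The dropped relation is not in \<open>A\<close>.\<close>

lemma minimal_generating_relation_set:
  assumes n: "n \<ge> 2"
  shows "minimal_generating_set (plucker_ring n) (plucker_ideal n) (relation_set n)"
  unfolding minimal_generating_set_def
proof (intro conjI allI impI)
  interpret cring "plucker_ring n" by (rule cring_plucker_ring)
  show carr: "relation_set n \<subseteq> carrier (plucker_ring n)"
    using relation_set_subset[OF n] ideal_plucker_ringD(1)[OF ideal_plucker_ideal] by blast
  show gen: "relation_ideal n = plucker_ideal n" by (rule genideal_relation_set[OF n])
  fix E' assume E': "E' \<subset> relation_set n"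
  then obtain e0 where e0: "e0 \<in> relation_set n" "e0 \<notin> E'" by blast
  then obtain a b where ab: "e0 = straightening_relation n a b" "incomparable (pbw_lattice n) a b"
    unfolding relation_set_def by blast
  let ?m = "pair_monomial (a, b)"
  have cols: "a \<in> pbw_columns n" "b \<in> pbw_columns n" "\<not> dn a \<subseteq> dn b" "\<not> dn b \<subseteq> dn a"
    using ab(2) unfolding incomparable_pbw_lattice by simp_all
  then have "a \<noteq> b" by blast
  define A where "A = {p \<in> carrier (plucker_ring n). (\<forall>k\<in>pkeys p. 2 \<le> mdeg k) \<and> ?m \<notin> pkeys p}"
  have idA: "ideal A (plucker_ring n)"
  proof (rule ideal_plucker_ringI)
    show "A \<subseteq> carrier (plucker_ring n)" unfolding A_def by blast
    show "0 \<in> A" unfolding A_def by (simp add: plucker_ring_0)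
    show "p + q \<in> A" if "p \<in> A" "q \<in> A" for p q
      using that Poly_Mapping.keys_add[of p q] plucker_ring_add[of p n q] unfolding A_def by blast
    show "q * p \<in> A" if p: "p \<in> A" and q: "q \<in> carrier (plucker_ring n)" for p q
    proof -
      have "2 \<le> mdeg k \<and> k \<noteq> ?m" if k: "k \<in> pkeys (q * p)" for k
      proof -
        obtain u v where uv: "u \<in> pkeys q" "v \<in> pkeys p" "k = u + v" using k by (rule keys_multE)
        have v: "2 \<le> mdeg v" "v \<noteq> ?m" using p uv(2) unfolding A_def by auto
        have "k \<noteq> ?m"
        \<comment> \<open>A monomial of degree two that is a multiple of one of degree at least two
          equals it, so multiplication cannot create the excluded monomial.\<close>
        proof
          assume "k = ?m"
          then have "mdeg u + mdeg v = 2" using mdeg_add[of u v] mdeg_pair_monomial[of "(a, b)"] uv(3) by simp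
          then have "u = 0" using v(1) by (intro mdeg_eq_0) simp
          then show False using \<open>k = ?m\<close> uv(3) v(2) by simp
        qed
        then show ?thesis using v(1) unfolding uv(3) mdeg_add by simp
      qed
      moreover have "q * p \<in> carrier (plucker_ring n)" using plucker_ring_mult[OF q] p unfolding A_def by blast
      ultimately show ?thesis unfolding A_def by blast
    qed
  qed
  have standard: "?m \<notin> pair_monomial ` standard_pairs n"
  proof
    assume "?m \<in> pair_monomial ` standard_pairs n"
    then obtain g h where gh: "(g, h) \<in> standard_pairs n" "?m = pair_monomial (g, h)" by auto
    then have "g \<in> pbw_columns n" "h \<in> pbw_columns n" "dn g \<subseteq> dn h" using standard_pairsD[OF gh(1)] by simp_all
    then show False using pair_monomial_eq[OF cols(1,2) \<open>a \<noteq> b\<close> _ _ gh(2)] cols(3,4) by blast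
  qed
  have look: "plook (straightening_relation n u v) ?m = plook (pair_poly (u, v)) ?m \<and>
      (\<forall>k\<in>pkeys (straightening_relation n u v). mdeg k = 2)" if uv: "incomparable (pbw_lattice n) u v" for u v
  proof -
    have c: "u \<in> pbw_columns n" "v \<in> pbw_columns n" using uv unfolding incomparable_pbw_lattice by simp_all
    obtain S c h where data: "straightening_data n u v S c h" using ex_straightening_data[OF n uv] .
    then have S: "S \<subseteq> standard_pairs n" unfolding straightening_data_def by blast
    show ?thesis unfolding straightening_relation_data(1)[OF uv data]
      using lookup_quadratic_relation[OF c S standard] keys_quadratic_relation[OF c S] by blast
  qed
  have "E' \<subseteq> A"
  proof
    fix p assume p: "p \<in> E'"
    then have "p \<in> relation_set n" using E' by blast
    then obtain u v where uv: "p = straightening_relation n u v" "incomparable (pbw_lattice n) u v"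
      unfolding relation_set_def by blast
    have c: "u \<in> pbw_columns n" "v \<in> pbw_columns n" using uv(2) unfolding incomparable_pbw_lattice by simp_all
    have "?m \<noteq> pair_monomial (u, v)"
    proof
      assume "?m = pair_monomial (u, v)"
      then have "a = u \<and> b = v \<or> a = v \<and> b = u" by (rule pair_monomial_eq[OF cols(1,2) \<open>a \<noteq> b\<close> c])
      then have "p = e0" using uv(1) ab(1) straightening_relation_commute[of n a b] by auto
      then show False using p e0(2) by simp
    qed
    moreover obtain k where "pair_poly (u, v) = psingle (pair_monomial (u, v)) k"
      using pair_poly_eq[of "(u, v)" n] c by auto
    ultimately have "plook p ?m = 0" using look[OF uv(2)] unfolding uv(1) by (simp add: lookup_single when_def)
    then have "?m \<notin> pkeys p" by (simp add: in_keys_iff)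
    moreover have "\<forall>k\<in>pkeys p. 2 \<le> mdeg k" using look[OF uv(2)] unfolding uv(1) by simp
    moreover have "p \<in> carrier (plucker_ring n)" using p E' carr by blast
    ultimately show "p \<in> A" unfolding A_def by blast
  qed
  then have "Idl\<^bsub>plucker_ring n\<^esub> E' \<subseteq> A" by (rule genideal_minimal[OF idA])
  moreover have "e0 \<notin> A"
  proof -
    obtain k where k: "k \<noteq> 0" "pair_poly (a, b) = psingle ?m k"
      using pair_poly_eq[of "(a, b)" n] cols by auto
    then have "plook e0 ?m = k" using look[OF ab(2)] unfolding ab(1) by simp
    then have "?m \<in> pkeys e0" using k(1) by (simp add: in_keys_iff)
    then show ?thesis unfolding A_def by blast
  qed
  moreover have "e0 \<in> plucker_ideal n" using e0(1) relation_set_subset[OF n] by blast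
  ultimately show "Idl\<^bsub>plucker_ring n\<^esub> E' \<noteq> plucker_ideal n" by blast
qed

lemma straightening_expansion_bounds:
  assumes n: "n \<ge> 2" and inc: "incomparable (pbw_lattice n) a b"
  shows "\<exists>m c g h.
     straightening_expansion n a b (straightening_relation n a b) m c g h \<and>
     g 0 = odot n a b \<and> h 0 = a \<squnion>\<^bsub>pbw_lattice n\<^esub> b \<and> c 0 = 1 \<and>
     (\<forall>i\<in>{1..m}. g i \<sqsubseteq>\<^bsub>pbw_lattice n\<^esub> (a \<sqinter>\<^bsub>pbw_lattice n\<^esub> b) \<and>
        (a \<squnion>\<^bsub>pbw_lattice n\<^esub> b) \<sqsubset>\<^bsub>pbw_lattice n\<^esub> h i)"
proof -
  have ab: "a \<in> pbw_columns n" "b \<in> pbw_columns n" using inc unfolding incomparable_pbw_lattice by simp_all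
  obtain S c h where data: "straightening_data n a b S c h" using ex_straightening_data[OF n inc] .
  obtain m f where f: "bij_betw f {0..m} S" "f 0 = (odot n a b, h)"
    "straightening_expansion n a b (quadratic_relation a b S c) m (c \<circ> f) (fst \<circ> f) (snd \<circ> f)"
    using straightening_relation_data(3)[OF inc data] by blast
  have S: "S \<subseteq> standard_pairs n" "(odot n a b, h) \<in> S" "c (odot n a b, h) = 1" "dn h = dn a \<union> dn b"
    using data unfolding straightening_data_def by blast+
  have h: "h \<in> pbw_columns n" using S(1,2) standard_pairsD by fastforce
  have join: "a \<squnion>\<^bsub>pbw_lattice n\<^esub> b = h" by (rule join_pbw_lattice[OF ab h S(4)])
  obtain w where w: "w \<in> pbw_columns n" "dn w = dn a \<inter> dn b" using ex_meet[OF n ab] .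
  have meet: "a \<sqinter>\<^bsub>pbw_lattice n\<^esub> b = w" by (rule meet_pbw_lattice[OF ab w])
  have "(fst \<circ> f) i \<sqsubseteq>\<^bsub>pbw_lattice n\<^esub> w \<and> h \<sqsubset>\<^bsub>pbw_lattice n\<^esub> (snd \<circ> f) i" if i: "i \<in> {1..m}" for i
  proof -
    have fi: "f i \<in> S" using f(1) i by (auto simp: bij_betw_def)
    \<comment> \<open>Injectivity of the enumeration keeps later indices away from the distinguished
      pair, so the strict bound applies to them.\<close>
    have "f i \<noteq> f 0" using bij_betw_imp_inj_on[OF f(1)] i by (auto dest: inj_onD)
    then have "f i \<in> S - {(odot n a b, h)}" using fi f(2) by simp
    then have "dn (fst (f i)) \<subseteq> dn a \<inter> dn b" "dn a \<union> dn b \<subset> dn (snd (f i))"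
      using data fi unfolding straightening_data_def by blast+
    moreover have "fst (f i) \<in> pbw_columns n" "snd (f i) \<in> pbw_columns n" using fi S(1) standard_pairsD by blast+
    ultimately show ?thesis using w h S(4) by (simp add: le_pbw_lattice lless_pbw_lattice)
  qed
  then show ?thesis unfolding straightening_relation_data(1)[OF inc data] join meet
    using f(2,3) S(3) by (intro exI[of _ m] exI[of _ "c \<circ> f"] exI[of _ "fst \<circ> f"] exI[of _ "snd \<circ> f"]) simp
qed

section \<open>The algebra with straightening laws\<close>

definition plucker_class :: "nat \<Rightarrow> nat list cpoly \<Rightarrow> nat list cpoly set" where
  "plucker_class n p = plucker_ideal n +>\<^bsub>plucker_ring n\<^esub> p"

lemma plucker_class_eq:
  assumes "p \<in> carrier (plucker_ring n)" "q \<in> carrier (plucker_ring n)"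
  shows "plucker_class n p = plucker_class n q \<longleftrightarrow> p - q \<in> plucker_ideal n"
proof -
  interpret ideal "plucker_ideal n" "plucker_ring n" by (rule ideal_plucker_ideal)
  have "p \<ominus>\<^bsub>plucker_ring n\<^esub> q = p - q"
    unfolding a_minus_def using a_inv_plucker_ring[OF assms(2)] by simp
  then show ?thesis unfolding plucker_class_def
    using quotient_eq_iff_same_a_r_cos[OF ideal_plucker_ideal assms] by simp
qed

lemma plucker_algebra_simps:
  shows carrier_plucker_algebra: "carrier (plucker_algebra n) = plucker_class n ` carrier (plucker_ring n)"
    and mult_plucker_class: "p \<in> carrier (plucker_ring n) \<Longrightarrow> q \<in> carrier (plucker_ring n) \<Longrightarrow>
      plucker_class n p \<otimes>\<^bsub>plucker_algebra n\<^esub> plucker_class n q = plucker_class n (p * q)"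
    and add_plucker_class: "p \<in> carrier (plucker_ring n) \<Longrightarrow> q \<in> carrier (plucker_ring n) \<Longrightarrow>
      plucker_class n p \<oplus>\<^bsub>plucker_algebra n\<^esub> plucker_class n q = plucker_class n (p + q)"
    and one_plucker_algebra: "\<one>\<^bsub>plucker_algebra n\<^esub> = plucker_class n 1"
    and zero_plucker_algebra: "\<zero>\<^bsub>plucker_algebra n\<^esub> = plucker_class n 0"
    and smult_plucker_class: "p \<in> carrier (plucker_ring n) \<Longrightarrow>
      k \<odot>\<^bsub>plucker_algebra n\<^esub> plucker_class n p = plucker_class n (pconst k * p)"
proof -
  interpret ideal "plucker_ideal n" "plucker_ring n" by (rule ideal_plucker_ideal)
  show "carrier (plucker_algebra n) = plucker_class n ` carrier (plucker_ring n)"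
    unfolding plucker_algebra_def Let_def FactRing_def plucker_class_def A_RCOSETS_def' by auto
  have mult: "plucker_class n p \<otimes>\<^bsub>plucker_ring n Quot plucker_ideal n\<^esub> plucker_class n q = plucker_class n (p * q)"
    if "p \<in> carrier (plucker_ring n)" "q \<in> carrier (plucker_ring n)" for p q
    using rcoset_mult_add[OF that] unfolding FactRing_def plucker_class_def by simp
  show "plucker_class n p \<otimes>\<^bsub>plucker_algebra n\<^esub> plucker_class n q = plucker_class n (p * q)"
    if "p \<in> carrier (plucker_ring n)" "q \<in> carrier (plucker_ring n)"
    using mult[OF that] unfolding plucker_algebra_def Let_def by simp
  show "plucker_class n p \<oplus>\<^bsub>plucker_algebra n\<^esub> plucker_class n q = plucker_class n (p + q)"
    if "p \<in> carrier (plucker_ring n)" "q \<in> carrier (plucker_ring n)"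
    using a_rcos_sum[OF that] unfolding plucker_algebra_def Let_def FactRing_def plucker_class_def by simp
  show "\<one>\<^bsub>plucker_algebra n\<^esub> = plucker_class n 1"
    unfolding plucker_algebra_def Let_def FactRing_def plucker_class_def by simp
  show "\<zero>\<^bsub>plucker_algebra n\<^esub> = plucker_class n 0"
    using a_rcos_const[OF ideal_plucker_ringD(2)[OF ideal_plucker_ideal]]
    unfolding plucker_algebra_def Let_def FactRing_def plucker_class_def by simp
  show "k \<odot>\<^bsub>plucker_algebra n\<^esub> plucker_class n p = plucker_class n (pconst k * p)"
    if "p \<in> carrier (plucker_ring n)"
    using mult[OF plucker_ring_pconst that, of k] unfolding plucker_algebra_def Let_def by (simp add: plucker_class_def)
qed

lemma plucker_algebra_cases:
  assumes "x \<in> carrier (plucker_algebra n)"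
  obtains p where "p \<in> carrier (plucker_ring n)" "x = plucker_class n p"
  using assms unfolding carrier_plucker_algebra by blast

lemma plucker_class_in: "p \<in> carrier (plucker_ring n) \<Longrightarrow> plucker_class n p \<in> carrier (plucker_algebra n)"
  unfolding carrier_plucker_algebra by blast

lemmas plucker_class_ops = mult_plucker_class add_plucker_class one_plucker_algebra zero_plucker_algebra
  smult_plucker_class plucker_class_in plucker_ring_mult plucker_ring_add plucker_ring_pconst
  plucker_ring_1 plucker_ring_0

lemma cring_plucker_algebra: "cring (plucker_algebra n)"
proof (rule cringI)
  show "abelian_group (plucker_algebra n)"
  proof (rule abelian_groupI)
    fix x assume "x \<in> carrier (plucker_algebra n)"
    then obtain p where p: "p \<in> carrier (plucker_ring n)" "x = plucker_class n p" by (rule plucker_algebra_cases)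
    then have "plucker_class n (- p) \<oplus>\<^bsub>plucker_algebra n\<^esub> x = \<zero>\<^bsub>plucker_algebra n\<^esub>"
      by (simp add: add_plucker_class plucker_ring_uminus zero_plucker_algebra)
    then show "\<exists>y\<in>carrier (plucker_algebra n). y \<oplus>\<^bsub>plucker_algebra n\<^esub> x = \<zero>\<^bsub>plucker_algebra n\<^esub>"
      using plucker_class_in plucker_ring_uminus p(1) by blast
  qed (auto elim!: plucker_algebra_cases simp: plucker_class_ops ac_simps)
next
  show "Group.comm_monoid (plucker_algebra n)"
    by (rule comm_monoidI) (auto elim!: plucker_algebra_cases simp: plucker_class_ops ac_simps)
qed (auto elim!: plucker_algebra_cases simp: plucker_class_ops distrib_right)

lemma algebra_plucker_algebra: "algebra (ring_of_type_algebra :: complex ring) (plucker_algebra n)"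
  by (rule algebraI[OF cring_from_type_algebra cring_plucker_algebra])
    (auto elim!: plucker_algebra_cases simp: plucker_class_ops ring_of_type_algebra_def
      pconst_add pconst_mult distrib_left distrib_right ac_simps)

lemma finsum_plucker_class:
  "finite W \<Longrightarrow> (\<And>w. w \<in> W \<Longrightarrow> G w = plucker_class n (f w) \<and> f w \<in> carrier (plucker_ring n)) \<Longrightarrow>
    finsum (plucker_algebra n) G W = plucker_class n (sum f W)"
proof (induction W rule: finite_induct)
  interpret A: cring "plucker_algebra n" by (rule cring_plucker_algebra)
  {
    case empty
    show ?case by (simp add: zero_plucker_algebra)
  next
    case (insert w W)
    have G: "G \<in> W \<rightarrow> carrier (plucker_algebra n)" "G w \<in> carrier (plucker_algebra n)"
      using insert.prems plucker_class_in by auto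
    have "finsum (plucker_algebra n) G (insert w W) = G w \<oplus>\<^bsub>plucker_algebra n\<^esub> finsum (plucker_algebra n) G W"
      by (rule A.finsum_insert[OF insert.hyps G])
    also have "finsum (plucker_algebra n) G W = plucker_class n (sum f W)"
      by (rule insert.IH) (use insert.prems in simp)
    also have "G w \<oplus>\<^bsub>plucker_algebra n\<^esub> \<dots> = plucker_class n (f w + sum f W)"
      using insert.prems by (simp add: add_plucker_class plucker_ring_sum)
    finally show ?case using insert.hyps by simp
  }
qed

abbreviation generator :: "nat \<Rightarrow> nat list \<Rightarrow> nat list cpoly set" where
  "generator n \<equiv> \<lambda>b. plucker_ideal n +>\<^bsub>plucker_ring n\<^esub> plucker_var b"

lemma generator_eq: "generator n b = plucker_class n (plucker_var b)"
  unfolding plucker_class_def ..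

lemma word_product_plucker:
  "set w \<subseteq> pbw_columns n \<Longrightarrow> word_product (plucker_algebra n) (generator n) w = plucker_class n (var_word w)"
proof (induction w)
  case Nil
  show ?case by (simp add: word_product_def var_word_def one_plucker_algebra)
next
  case (Cons a w)
  then have "word_product (plucker_algebra n) (generator n) w = plucker_class n (var_word w)" by simp
  moreover have "plucker_var a \<in> carrier (plucker_ring n)" "var_word w \<in> carrier (plucker_ring n)"
    using Cons.prems plucker_ring_var plucker_ring_var_word by simp_all
  ultimately show ?case
    unfolding word_product_def foldr.simps comp_def generator_eq by (simp add: mult_plucker_class var_word_def)
qed

lemma standard_words_pbw_lattice: "standard_words (pbw_lattice n) = {w. chain_word n w}"
proof -
  have "sorted_wrt (\<lambda>x y. x \<sqsubseteq>\<^bsub>pbw_lattice n\<^esub> y) w \<longleftrightarrow> sorted_wrt (\<lambda>x y. dn x \<subseteq> dn y) w"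
    if w: "set w \<subseteq> pbw_columns n" for w
  proof
    assume "sorted_wrt (\<lambda>x y. x \<sqsubseteq>\<^bsub>pbw_lattice n\<^esub> y) w"
    then show "sorted_wrt (\<lambda>x y. dn x \<subseteq> dn y) w"
      by (rule sorted_wrt_mono_rel[rotated]) (use w le_pbw_lattice in blast)
  next
    assume "sorted_wrt (\<lambda>x y. dn x \<subseteq> dn y) w"
    then show "sorted_wrt (\<lambda>x y. x \<sqsubseteq>\<^bsub>pbw_lattice n\<^esub> y) w"
      by (rule sorted_wrt_mono_rel[rotated]) (use w le_pbw_lattice in blast)
  qed
  then show ?thesis unfolding standard_words_def chain_word_def carrier_pbw_lattice by blast
qed

text \<open>A lift of \<open>word_combination\<close> to the polynomial ring, where sums can be
  compared by coefficients before passing to classes.\<close>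

definition combination_poly :: "(nat list list \<Rightarrow>\<^sub>0 complex) \<Rightarrow> nat list cpoly" where
  "combination_poly c = (\<Sum>w\<in>pkeys c. pconst (plook c w) * var_word w)"

lemma combination_poly_superset:
  assumes "finite W" "pkeys c \<subseteq> W"
  shows "combination_poly c = (\<Sum>w\<in>W. pconst (plook c w) * var_word w)"
  unfolding combination_poly_def
  by (rule sum.mono_neutral_left) (use assms in \<open>auto simp: in_keys_iff\<close>)

lemma combination_poly_carrier:
  "pkeys c \<subseteq> {w. chain_word n w} \<Longrightarrow> combination_poly c \<in> carrier (plucker_ring n)"
  unfolding combination_poly_def
  by (intro plucker_ring_sum plucker_ring_mult plucker_ring_pconst plucker_ring_var_word) (auto simp: chain_word_def)

lemma word_combination_plucker:
  assumes c: "pkeys c \<subseteq> {w. chain_word n w}"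
  shows "word_combination (plucker_algebra n) (generator n) c = plucker_class n (combination_poly c)"
  unfolding word_combination_def combination_poly_def
proof (rule finsum_plucker_class[OF finite_keys])
  fix w assume "w \<in> pkeys c"
  then have w: "set w \<subseteq> pbw_columns n" using c unfolding chain_word_def by blast
  have v: "var_word w \<in> carrier (plucker_ring n)" by (rule plucker_ring_var_word[OF w])
  show "plook c w \<odot>\<^bsub>plucker_algebra n\<^esub> word_product (plucker_algebra n) (generator n) w =
      plucker_class n (pconst (plook c w) * var_word w) \<and> pconst (plook c w) * var_word w \<in> carrier (plucker_ring n)"
    unfolding word_product_plucker[OF w] by (simp add: smult_plucker_class[OF v] plucker_ring_mult[OF plucker_ring_pconst v])
qed

lemma combination_poly_inj:
  assumes c: "pkeys c \<subseteq> {w. chain_word n w}" and d: "pkeys d \<subseteq> {w. chain_word n w}"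
    and eq: "plucker_class n (combination_poly c) = plucker_class n (combination_poly d)"
  shows "c = d"
proof (rule poly_mapping_eqI)
  fix w
  let ?W = "pkeys c \<union> pkeys d"
  have fin: "finite ?W" by simp
  have "combination_poly c - combination_poly d \<in> plucker_ideal n"
    using eq plucker_class_eq[OF combination_poly_carrier[OF c] combination_poly_carrier[OF d]] by simp
  moreover have "combination_poly c - combination_poly d = (\<Sum>w\<in>?W. pconst (plook c w - plook d w) * var_word w)"
    using combination_poly_superset[OF fin, of c] combination_poly_superset[OF fin, of d]
    by (simp add: pconst_diff left_diff_distrib sum_subtractf)
  ultimately have sum0: "psubst minor (\<Sum>w\<in>?W. pconst (plook c w - plook d w) * var_word w) = 0"
    unfolding plucker_ideal_iff by simp
  show "plook c w = plook d w"
  proof (cases "w \<in> ?W")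
    case True
    have "plook c w - plook d w = 0"
      by (rule var_words_independent[OF fin _ sum0 True, of n]) (use c d in blast)
    then show ?thesis by simp
  qed (simp add: in_keys_iff)
qed

lemma combination_poly_sum:
  assumes fin: "finite W"
  shows "pkeys (\<Sum>w\<in>W. psingle w (c w)) \<subseteq> W" "combination_poly (\<Sum>w\<in>W. psingle w (c w)) = (\<Sum>w\<in>W. pconst (c w) * var_word w)"
proof -
  let ?c = "\<Sum>w\<in>W. psingle w (c w)"
  have look: "plook ?c w = (if w \<in> W then c w else 0)" for w
  proof -
    have "plook ?c w = (\<Sum>v\<in>W. if v = w then c w else 0)"
      unfolding lookup_sum by (rule sum.cong) (auto simp: lookup_single when_def)
    then show ?thesis using fin by simp
  qed
  show sub: "pkeys ?c \<subseteq> W" using look by (auto simp: in_keys_iff split: if_splits)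
  show "combination_poly ?c = (\<Sum>w\<in>W. pconst (c w) * var_word w)"
    unfolding combination_poly_superset[OF fin sub] by (rule sum.cong) (simp_all add: look)
qed

text \<open>The basis property combines \<open>carrier_reducible\<close> with the independence of
  chains. For the straightening law, unique coefficients force any given expansion to be the one of
  \<open>straightening_data\<close>, whose smaller factors lie below both columns.\<close>

lemma straightening_laws_plucker_algebra:
  assumes n: "n \<ge> 2"
  shows "algebra_with_straightening_laws (plucker_algebra n) (pbw_lattice n) (generator n)"
  unfolding algebra_with_straightening_laws_def standard_words_pbw_lattice
proof (intro conjI allI impI)
  let ?C = "{c. pkeys c \<subseteq> {w. chain_word n w}}"
  let ?comb = "word_combination (plucker_algebra n) (generator n)"
  show "algebra (ring_of_type_algebra :: complex ring) (plucker_algebra n)" by (rule algebra_plucker_algebra)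
  show "partial_order (pbw_lattice n)" by (rule partial_order_pbw_lattice)
  show "finite (carrier (pbw_lattice n))" unfolding carrier_pbw_lattice by (rule finite_pbw_columns)
  show "generator n \<in> carrier (pbw_lattice n) \<rightarrow> carrier (plucker_algebra n)"
    unfolding carrier_pbw_lattice generator_eq using plucker_class_in plucker_ring_var by blast
  have inj: "inj_on ?comb ?C"
    by (rule inj_onI) (use combination_poly_inj word_combination_plucker in \<open>metis mem_Collect_eq\<close>)
  show "inj_on (generator n) (carrier (pbw_lattice n))"
  proof (rule inj_onI)
    fix a b assume "a \<in> carrier (pbw_lattice n)" "b \<in> carrier (pbw_lattice n)" and eq: "generator n a = generator n b"
    then have ab: "a \<in> pbw_columns n" "b \<in> pbw_columns n" unfolding carrier_pbw_lattice by simp_all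
    have single: "combination_poly (psingle [x] 1) = plucker_var x" for x
      by (simp add: combination_poly_def var_word_def)
    \<comment> \<open>Words of one letter are chains, so injectivity on generators is an instance of
      independence.\<close>
    have "psingle [a] (1::complex) = psingle [b] 1"
      by (rule combination_poly_inj[of _ n]) (use ab eq in \<open>simp_all add: chain_word_def single generator_eq\<close>)
    then have "pkeys (psingle [a] (1::complex)) = pkeys (psingle [b] (1::complex))" by simp
    then show "a = b" by simp
  qed
  show "bij_betw ?comb ?C (carrier (plucker_algebra n))"
    unfolding bij_betw_def
  proof (intro conjI inj equalityI subsetI)
    fix x assume "x \<in> ?comb ` ?C"
    then obtain c where "pkeys c \<subseteq> {w. chain_word n w}" "x = ?comb c" by blast
    then show "x \<in> carrier (plucker_algebra n)"
      using word_combination_plucker combination_poly_carrier plucker_class_in by simp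
  next
    fix x assume "x \<in> carrier (plucker_algebra n)"
    then obtain p where p: "p \<in> carrier (plucker_ring n)" "x = plucker_class n p" by (rule plucker_algebra_cases)
    obtain q where q: "q \<in> standard_combinations n" "p - q \<in> plucker_ideal n"
      using carrier_reducible[OF n p(1)] unfolding reducible_def genideal_relation_set[OF n] by blast
    obtain W c where W: "finite W" "\<forall>w\<in>W. chain_word n w" "q = (\<Sum>w\<in>W. pconst (c w) * var_word w)"
      using q(1) unfolding standard_combinations_def by blast
    let ?c = "\<Sum>w\<in>W. psingle w (c w)"
    have keys: "pkeys ?c \<subseteq> {w. chain_word n w}" using combination_poly_sum(1)[OF W(1), of c] W(2) by blast
    have qc: "combination_poly ?c = q" unfolding W(3) by (rule combination_poly_sum(2)[OF W(1)])
    have "q \<in> carrier (plucker_ring n)" using combination_poly_carrier[OF keys] unfolding qc .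
    then have "x = plucker_class n q" unfolding p(2) using plucker_class_eq[OF p(1)] q(2) by blast
    then have "x = ?comb ?c" unfolding word_combination_plucker[OF keys] qc .
    then show "x \<in> ?comb ` ?C" using keys by blast
  qed
  fix a b c w
  assume *: "incomparable (pbw_lattice n) a b \<and> pkeys c \<subseteq> {w. chain_word n w} \<and>
      ?comb c = generator n a \<otimes>\<^bsub>plucker_algebra n\<^esub> generator n b"
  have ab: "a \<in> pbw_columns n" "b \<in> pbw_columns n" using * unfolding incomparable_pbw_lattice by simp_all
  obtain S k h where data: "straightening_data n a b S k h" using ex_straightening_data[OF n] * by blast
  have S: "S \<subseteq> standard_pairs n" "\<And>x. x \<in> S \<Longrightarrow> dn (fst x) \<subseteq> dn a \<inter> dn b"
    using data unfolding straightening_data_def by blast+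
  have fin: "finite S" using finite_subset[OF S(1) finite_standard_pairs] .
  \<comment> \<open>The known expansion is recast as a coefficient function on words of two letters;
    in particular the empty word has coefficient 0.\<close>
  let ?w = "\<lambda>x :: nat list \<times> nat list. [fst x, snd x]"
  have inj_w: "inj_on ?w S" by (rule inj_onI) (simp add: prod_eq_iff)
  let ?d = "\<Sum>v\<in>?w ` S. psingle v (k (hd v, last v))"
  have fin_w: "finite (?w ` S)" using fin by simp
  have chain: "chain_word n v" if "v \<in> ?w ` S" for v
    using that S(1) standard_pairsD unfolding chain_word_def by fastforce
  have keys: "pkeys ?d \<subseteq> {w. chain_word n w}"
    by (rule subset_trans[OF combination_poly_sum(1)[OF fin_w]]) (use chain in blast)
  have poly: "combination_poly ?d = (\<Sum>x\<in>S. pconst (k x) * pair_poly x)"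
  proof -
    have "combination_poly ?d = (\<Sum>v\<in>?w ` S. pconst (k (hd v, last v)) * var_word v)"
      by (rule combination_poly_sum(2)[OF fin_w])
    also have "\<dots> = (\<Sum>x\<in>S. pconst (k x) * pair_poly x)"
      unfolding sum.reindex[OF inj_w] by (rule sum.cong) (simp_all add: var_word_def pair_poly_def)
    finally show ?thesis .
  qed
  have "plucker_class n (combination_poly c) = ?comb c" using word_combination_plucker[of c n] * by simp
  also have "\<dots> = generator n a \<otimes>\<^bsub>plucker_algebra n\<^esub> generator n b" using * by blast
  also have "\<dots> = plucker_class n (pair_poly (a, b))"
    unfolding generator_eq pair_poly_def fst_conv snd_conv
    by (rule mult_plucker_class[OF plucker_ring_var[OF ab(1)] plucker_ring_var[OF ab(2)]])
  also have "\<dots> = plucker_class n (combination_poly ?d)"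
    unfolding poly
  proof (rule plucker_class_eq[THEN iffD2])
    show "pair_poly (a, b) \<in> carrier (plucker_ring n)"
      unfolding pair_poly_def using ab by (simp add: plucker_ring_mult plucker_ring_var)
    show "(\<Sum>x\<in>S. pconst (k x) * pair_poly x) \<in> carrier (plucker_ring n)"
      using combination_poly_carrier[OF keys] unfolding poly .
    show "pair_poly (a, b) - (\<Sum>x\<in>S. pconst (k x) * pair_poly x) \<in> plucker_ideal n"
      using straightening_relation_data(2)[OF _ data] * unfolding quadratic_relation_def by blast
  qed
  finally have "c = ?d" using combination_poly_inj[of c n ?d] * keys by blast
  then have sub: "pkeys c \<subseteq> ?w ` S" using combination_poly_sum(1)[OF fin_w] by simp
  show "\<forall>ws\<in>pkeys c. ws \<noteq> [] \<and> hd ws \<sqsubseteq>\<^bsub>pbw_lattice n\<^esub> a \<and> hd ws \<sqsubseteq>\<^bsub>pbw_lattice n\<^esub> b"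
  proof
    fix ws assume "ws \<in> pkeys c"
    then obtain x where x: "x \<in> S" "ws = ?w x" using sub by blast
    have "fst x \<in> pbw_columns n" using x(1) S(1) standard_pairsD by blast
    then show "ws \<noteq> [] \<and> hd ws \<sqsubseteq>\<^bsub>pbw_lattice n\<^esub> a \<and> hd ws \<sqsubseteq>\<^bsub>pbw_lattice n\<^esub> b"
      using S(2)[OF x(1)] ab x(2) by (simp add: le_pbw_lattice)
  qed
qed

theorem theorem7p2:
  fixes n :: nat
  assumes "n \<ge> 2"
  shows "minimal_generating_set (plucker_ring n) (plucker_ideal n)
           {straightening_relation n a b | a b. incomparable (pbw_lattice n) a b} \<and>
         (\<forall>a b. incomparable (pbw_lattice n) a b \<longrightarrow>
           (\<exists>m c g h.
              straightening_expansion n a b (straightening_relation n a b) m c g h \<and>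
              g 0 = odot n a b \<and> h 0 = a \<squnion>\<^bsub>pbw_lattice n\<^esub> b \<and> c 0 = 1 \<and>
              (\<forall>i\<in>{1..m}. g i \<sqsubseteq>\<^bsub>pbw_lattice n\<^esub> (a \<sqinter>\<^bsub>pbw_lattice n\<^esub> b) \<and>
                 (a \<squnion>\<^bsub>pbw_lattice n\<^esub> b) \<sqsubset>\<^bsub>pbw_lattice n\<^esub> h i))) \<and>
         algebra_with_straightening_laws (plucker_algebra n) (pbw_lattice n)
           (\<lambda>b. plucker_ideal n +>\<^bsub>plucker_ring n\<^esub> plucker_var b)"
  using minimal_generating_relation_set[OF assms] straightening_expansion_bounds[OF assms]
    straightening_laws_plucker_algebra[OF assms]
  unfolding relation_set_def by blast

end
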